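(* Let $\Psi\in\mathcal B_0$ satisfy the Hartman–Wintner condition $\lim_{|u|\to\infty}\Psi(u^2)/\log|u|=\infty$, let $V\in L^\infty(\mathbb R^d)$, and let $\mathcal D\subset\mathbb R^d$ be a bounded domain with regular boundary for which there exists a decreasing sequence of bounded domains $(\mathcal D_n)_{n\ge1}$ with regular boundary such that $\overline{\mathcal D_{n+1}}\subset\mathcal D_n$ for all $n$ and $\bigcap_{n\ge1}\mathcal D_n=\overline{\mathcal D}$. Let $(\varphi^*,\lambda^* )$ be the principal eigenpair of $H^{\mathcal D,V}$. Let $\hat x\in\mathcal D$ be any point and denote by $\mathscr B_r$ the ball of radius $r$ around $\hat x$ and by $\breve\tau_r$ the first hitting time of $\mathscr B_r$ by $(X_t)_{t\ge0}$. Then $$\varphi^*(x)=\mathbb E^x\Big[e^{\int_0^{\breve\tau_r}(\lambda^*-V(X_s))ds}\,\varphi^*(X_{\breve\tau_r})\mathbf 1_{\{\breve\tau_r<\tau_{\mathcal D}\}}\Big],\qquad x\in\mathcal D\setminus\overline{\mathscr B_r}.$$ In particular, for every $x\in\mathcal D$, $$\varphi^*(x)=\varphi^*(\hat x)\,\lim_{r\to0}\mathbb E^x\Big[e^{\int_0^{\breve\tau_r}(\lambda^*-V(X_s))ds}\,\mathbf 1_{\{\breve\tau_r<\tau_{\mathcal D}\}}\Big].$$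
   Context: $\mathcal B_0$ is the set of Bernstein functions $\Psi\in C^\infty((0,\infty))$ with $\Psi\ge0$, $(-1)^n\Psi^{(n)}\le0$ for all integers $n\ge1$, and $\lim_{u\downarrow0}\Psi(u)=0$. $(X_t)_{t\ge0}$ is the subordinate Brownian motion $X_t=B_{S_t}$ in $\mathbb R^d$, where $B$ is $d$-dimensional Brownian motion with $\mathbb E[e^{i\xi\cdot B_t}]=e^{-t|\xi|^2}$ and $S$ is an independent subordinator with $\mathbb E[e^{-uS_t}]=e^{-t\Psi(u)}$; $X$ is a Lévy process with generator $-\Psi(-\Delta)$. $\mathbb P^x,\mathbb E^x$ refer to $X$ started at $x$. For a domain $\mathcal D$, $\tau_{\mathcal D}=\inf\{t>0: X_t\notin\mathcal D\}$; its boundary is regular if $\mathbb P^z(\tau_{\mathcal D}=0)=1$ for every $z\in\partial\mathcal D$. The first hitting time is $\breve\tau_r=\inf\{t>0:X_t\in\mathscr B_r\}$ with $\mathscr B_r=\{y:|y-\hat x|<r\}$. $H^{\mathcal D,V}=\Psi(-\Delta)+V$ on $\mathcal D$ with Dirichlet exterior condition: $-H^{\mathcal D,V}$ is the generator of the self-adjoint, strongly continuous semigroup on $L^2(\mathcal D)$ $$T_t^{\mathcal D,V}f(x)=\mathbb E^x\big[e^{-\int_0^tV(X_s)ds}f(X_t)\mathbf 1_{\{t<\tau_{\mathcal D}\}}\big],$$ whose operators are Hilbert–Schmidt for $t>0$. The principal eigenvalue $\lambda^*$ is the lowest eigenvalue of $H^{\mathcal D,V}$ (so $e^{-\lambda^*t}=\max\{\langle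 T^{\mathcal D,V}_t\xi,\xi\rangle:\|\xi\|_{L^2(\mathcal D)}=1\}$); it is simple, and $\varphi^*$ denotes a corresponding eigenfunction, chosen strictly positive in $\mathcal D$; it is continuous on $\mathbb R^d$ when set to $0$ on $\mathcal D^c$, and $T_t^{\mathcal D,V}\varphi^*=e^{-\lambda^*t}\varphi^*$ for $t\ge0$. *)

theory Defs
  imports "HOL-Probability.Probability"
begin

section \<open>Bernstein functions\<close>

text \<open>The class \<open>\<B>\<^sub>0\<close>. Since \<open>(0,\<infinity>)\<close> is open, \<^term>\<open>(deriv ^^ n) \<Psi>\<close> on it depends only on
  \<open>\<Psi>\<close> restricted to \<open>(0,\<infinity>)\<close>; the values of \<open>\<Psi>\<close> at \<open>u \<le> 0\<close> are irrelevant throughout.\<close>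

definition bernstein0 :: "(real \<Rightarrow> real) \<Rightarrow> bool" where
  "bernstein0 \<Psi> \<longleftrightarrow>
     (\<forall>n. \<forall>u>0. (deriv ^^ n) \<Psi> differentiable at u) \<and>
     (\<forall>u>0. \<Psi> u \<ge> 0) \<and>
     (\<forall>n\<ge>1. \<forall>u>0. (-1) ^ n * (deriv ^^ n) \<Psi> u \<le> 0) \<and>
     (\<Psi> \<longlongrightarrow> 0) (at_right 0)"

definition hartman_wintner :: "(real \<Rightarrow> real) \<Rightarrow> bool" where
  "hartman_wintner \<Psi> \<longleftrightarrow> filterlim (\<lambda>u::real. \<Psi> (u\<^sup>2) / ln \<bar>u\<bar>) at_top at_infinity"

section \<open>Subordinate Brownian motion\<close>

definition cadlag_path :: "(real \<Rightarrow> 'v::topological_space) \<Rightarrow> bool" where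
  "cadlag_path y \<longleftrightarrow>
     (\<forall>t\<ge>0. (y \<longlongrightarrow> y t) (at_right t)) \<and> (\<forall>t>0. \<exists>l. (y \<longlongrightarrow> l) (at_left t))"

text \<open>Processes are indexed by \<^typ>\<open>real\<close>; only times \<open>t \<ge> 0\<close> matter.\<close>

definition levy_process :: "'w measure \<Rightarrow> (real \<Rightarrow> 'w \<Rightarrow> 'v::euclidean_space) \<Rightarrow> bool" where
  "levy_process M Y \<longleftrightarrow>
     prob_space M \<and>
     (\<forall>t\<ge>0. Y t \<in> borel_measurable M) \<and>
     (AE \<omega> in M. Y 0 \<omega> = 0) \<and>
     (\<forall>(n::nat) (t::nat \<Rightarrow> real). 0 \<le> t 0 \<and> (\<forall>i<n. t i \<le> t (Suc i)) \<longrightarrow>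
        prob_space.indep_vars M (\<lambda>_. borel) (\<lambda>i \<omega>. Y (t (Suc i)) \<omega> - Y (t i) \<omega>) {..<n}) \<and>
     (\<forall>s\<ge>0. \<forall>t\<ge>0. distr M borel (\<lambda>\<omega>. Y (s + t) \<omega> - Y s \<omega>) = distr M borel (Y t)) \<and>
     (AE \<omega> in M. cadlag_path (\<lambda>t. Y t \<omega>))"

text \<open>The normalisation is that of the generator \<open>\<Delta>\<close> (variance \<open>2t\<close> in each coordinate).\<close>

definition brownian_motion :: "'w measure \<Rightarrow> (real \<Rightarrow> 'w \<Rightarrow> 'v::euclidean_space) \<Rightarrow> bool" where
  "brownian_motion M B \<longleftrightarrow>
     levy_process M B \<and>
     (AE \<omega> in M. continuous_on {0..} (\<lambda>t. B t \<omega>)) \<and>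
     (\<forall>t\<ge>0. \<forall>\<xi>. (LINT \<omega>|M. exp (\<i> * complex_of_real (\<xi> \<bullet> B t \<omega>))) =
        complex_of_real (exp (- t * (norm \<xi>)\<^sup>2)))"

definition subordinator :: "'w measure \<Rightarrow> (real \<Rightarrow> 'w \<Rightarrow> real) \<Rightarrow> (real \<Rightarrow> real) \<Rightarrow> bool" where
  "subordinator M S \<Psi> \<longleftrightarrow>
     levy_process M S \<and>
     (AE \<omega> in M. mono_on {0..} (\<lambda>t. S t \<omega>)) \<and>
     (\<forall>t\<ge>0. \<forall>u>0. (LINT \<omega>|M. exp (- u * S t \<omega>)) = exp (- t * \<Psi> u))"

text \<open>Independence is that of the generated sigma-algebras: \<^const>\<open>prob_space.indep_var\<close> requires
  both variables to have the same type.\<close>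

definition subordinate_brownian_motion ::
  "'w measure \<Rightarrow> (real \<Rightarrow> 'w \<Rightarrow> 'v::euclidean_space) \<Rightarrow> (real \<Rightarrow> 'w \<Rightarrow> real) \<Rightarrow> (real \<Rightarrow> real) \<Rightarrow>
   (real \<Rightarrow> 'w \<Rightarrow> 'v) \<Rightarrow> bool" where
  "subordinate_brownian_motion M B S \<Psi> X \<longleftrightarrow>
     brownian_motion M B \<and> subordinator M S \<Psi> \<and>
     prob_space.indep_set M
       {(\<lambda>\<omega>. \<lambda>t\<in>{0..}. B t \<omega>) -` A \<inter> space M |A. A \<in> sets (PiM {0..} (\<lambda>_. borel :: 'v measure))}
       {(\<lambda>\<omega>. \<lambda>t\<in>{0..}. S t \<omega>) -` A \<inter> space M |A. A \<in> sets (PiM {0..} (\<lambda>_. borel :: real measure))} \<and>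
     X = (\<lambda>t \<omega>. B (S t \<omega>) \<omega>)"

text \<open>\<open>X\<close> starts at \<open>0\<close> under \<open>M\<close>. The law \<open>\<bbbP>\<^sup>x\<close> of the process started at \<open>x\<close> is the law of
  \<^term>\<open>started x X\<close> under \<open>M\<close>. Expectations are taken with respect to \<^term>\<open>completion M\<close>, because
  hitting times of Borel sets by a cadlag process are in general measurable only after completion
  (for a non-measurable integrand the Bochner integral would be the default value \<open>0\<close>).\<close>

definition started :: "'v::plus \<Rightarrow> (real \<Rightarrow> 'w \<Rightarrow> 'v) \<Rightarrow> real \<Rightarrow> 'w \<Rightarrow> 'v" where
  "started x X t \<omega> = x + X t \<omega>"

definition hitting_time :: "(real \<Rightarrow> 'w \<Rightarrow> 'v) \<Rightarrow> 'v set \<Rightarrow> 'w \<Rightarrow> ereal" where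
  "hitting_time Y A \<omega> = Inf {ereal t |t. 0 < t \<and> Y t \<omega> \<in> A}"

definition exit_time :: "(real \<Rightarrow> 'w \<Rightarrow> 'v) \<Rightarrow> 'v set \<Rightarrow> 'w \<Rightarrow> ereal" where
  "exit_time Y D \<omega> = Inf {ereal t |t. 0 < t \<and> Y t \<omega> \<notin> D}"

text \<open>\<open>\<integral>\<^sub>0\<^sup>\<tau> W(Y\<^sub>s) ds\<close> for \<open>\<tau> \<in> [0,\<infinity>]\<close>. The integral is over \<^term>\<open>lebesgue\<close> since \<open>W\<close> will be
  Lebesgue measurable only.\<close>

definition time_integral ::
  "('v \<Rightarrow> real) \<Rightarrow> (real \<Rightarrow> 'w \<Rightarrow> 'v) \<Rightarrow> ereal \<Rightarrow> 'w \<Rightarrow> real" where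
  "time_integral W Y \<tau> \<omega> = (LINT s:{s. 0 \<le> s \<and> ereal s \<le> \<tau>}|lebesgue. W (Y s \<omega>))"

section \<open>Domains and potentials\<close>

definition bounded_domain :: "'v::euclidean_space set \<Rightarrow> bool" where
  "bounded_domain D \<longleftrightarrow> open D \<and> connected D \<and> D \<noteq> {} \<and> bounded D"

definition regular_boundary ::
  "'w measure \<Rightarrow> (real \<Rightarrow> 'w \<Rightarrow> 'v::euclidean_space) \<Rightarrow> 'v set \<Rightarrow> bool" where
  "regular_boundary M X D \<longleftrightarrow>
     (\<forall>z\<in>frontier D. AE \<omega> in M. exit_time (started z X) D \<omega> = 0)"

definition essentially_bounded :: "('v::euclidean_space \<Rightarrow> real) \<Rightarrow> bool" where
  "essentially_bounded V \<longleftrightarrow>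
     V \<in> borel_measurable lebesgue \<and> (\<exists>C. AE x in lebesgue. \<bar>V x\<bar> \<le> C)"

section \<open>The Feynman-Kac semigroup and its generator\<close>

definition feynman_kac ::
  "'w measure \<Rightarrow> (real \<Rightarrow> 'w \<Rightarrow> 'v::euclidean_space) \<Rightarrow> 'v set \<Rightarrow> ('v \<Rightarrow> real) \<Rightarrow>
   real \<Rightarrow> ('v \<Rightarrow> real) \<Rightarrow> 'v \<Rightarrow> real" where
  "feynman_kac M X D V t f x =
     (LINT \<omega>|completion M.
        exp (- time_integral V (started x X) (ereal t) \<omega>) * f (started x X t \<omega>) *
        of_bool (ereal t < exit_time (started x X) D \<omega>))"

text \<open>Functions in \<open>L\<^sup>2(D)\<close>, represented on the whole space; values outside \<open>D\<close> are irrelevant.\<close>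

definition L2_on :: "'v::euclidean_space set \<Rightarrow> ('v \<Rightarrow> real) set" where
  "L2_on D = {f. f \<in> borel_measurable (lebesgue_on D) \<and> integrable (lebesgue_on D) (\<lambda>x. (f x)\<^sup>2)}"

text \<open>\<open>f\<close> is in the domain of the \<open>L\<^sup>2(D)\<close>-generator of the semigroup and the generator maps \<open>f\<close> to
  \<open>g\<close>. The squared norm is a nonnegative integral, so that it cannot vanish for lack of
  integrability.\<close>

definition fk_generator ::
  "'w measure \<Rightarrow> (real \<Rightarrow> 'w \<Rightarrow> 'v::euclidean_space) \<Rightarrow> 'v set \<Rightarrow> ('v \<Rightarrow> real) \<Rightarrow>
   ('v \<Rightarrow> real) \<Rightarrow> ('v \<Rightarrow> real) \<Rightarrow> bool" where
  "fk_generator M X D V f g \<longleftrightarrow>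
     f \<in> L2_on D \<and> g \<in> L2_on D \<and>
     ((\<lambda>t. \<integral>\<^sup>+x. ennreal (((feynman_kac M X D V t f x - f x) / t - g x)\<^sup>2) \<partial>lebesgue_on D) \<longlongrightarrow> 0)
       (at_right 0)"

text \<open>The graph of the operator \<open>H\<^bsup>D,V\<^esup>\<close>, whose negative is the generator.\<close>

definition hamiltonian ::
  "'w measure \<Rightarrow> (real \<Rightarrow> 'w \<Rightarrow> 'v::euclidean_space) \<Rightarrow> 'v set \<Rightarrow> ('v \<Rightarrow> real) \<Rightarrow>
   ('v \<Rightarrow> real) \<Rightarrow> ('v \<Rightarrow> real) \<Rightarrow> bool" where
  "hamiltonian M X D V f g \<longleftrightarrow> fk_generator M X D V f (\<lambda>x. - g x)"

definition eigenfunction ::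
  "'w measure \<Rightarrow> (real \<Rightarrow> 'w \<Rightarrow> 'v::euclidean_space) \<Rightarrow> 'v set \<Rightarrow> ('v \<Rightarrow> real) \<Rightarrow>
   real \<Rightarrow> ('v \<Rightarrow> real) \<Rightarrow> bool" where
  "eigenfunction M X D V \<mu> f \<longleftrightarrow>
     hamiltonian M X D V f (\<lambda>x. \<mu> * f x) \<and> \<not> (AE x in lebesgue_on D. f x = 0)"

definition simple_eigenvalue ::
  "'w measure \<Rightarrow> (real \<Rightarrow> 'w \<Rightarrow> 'v::euclidean_space) \<Rightarrow> 'v set \<Rightarrow> ('v \<Rightarrow> real) \<Rightarrow> real \<Rightarrow> bool" where
  "simple_eigenvalue M X D V \<mu> \<longleftrightarrow>
     (\<exists>f. eigenfunction M X D V \<mu> f) \<and>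
     (\<forall>f g. eigenfunction M X D V \<mu> f \<and> eigenfunction M X D V \<mu> g \<longrightarrow>
        (\<exists>c. AE x in lebesgue_on D. g x = c * f x))"

text \<open>The operator is self-adjoint and commutes with complex conjugation, so that real eigenvalues
  and real-valued eigenfunctions suffice. \<open>\<phi>\<close> is the positive continuous representative, extended
  by \<open>0\<close> outside \<open>D\<close>. Simplicity of the lowest eigenvalue and the identity
  \<open>T\<^sub>t \<phi> = e\<^bsup>-\<lambda>t\<^esup> \<phi>\<close> (pointwise on \<open>D\<close>) are standard facts about the principal eigenpair,
  included here as part of its description.\<close>

definition principal_eigenpair ::
  "'w measure \<Rightarrow> (real \<Rightarrow> 'w \<Rightarrow> 'v::euclidean_space) \<Rightarrow> 'v set \<Rightarrow> ('v \<Rightarrow> real) \<Rightarrow>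
   ('v \<Rightarrow> real) \<Rightarrow> real \<Rightarrow> bool" where
  "principal_eigenpair M X D V \<phi> lam \<longleftrightarrow>
     (\<forall>\<mu> f. eigenfunction M X D V \<mu> f \<longrightarrow> lam \<le> \<mu>) \<and>
     simple_eigenvalue M X D V lam \<and>
     eigenfunction M X D V lam \<phi> \<and>
     (\<forall>x\<in>D. 0 < \<phi> x) \<and> (\<forall>x. x \<notin> D \<longrightarrow> \<phi> x = 0) \<and> continuous_on UNIV \<phi> \<and>
     (\<forall>t\<ge>0. \<forall>x\<in>D. feynman_kac M X D V t \<phi> x = exp (- lam * t) * \<phi> x)"

end

theory Submission
  imports Defs
begin

text \<open>Write \<open>T\<^sub>t\<close> for the Feynman-Kac semigroup on \<open>D\<close>. Since \<open>e\<^bsup>\<lambda>t\<^esup> T\<^sub>t \<phi> = \<phi>\<close>, the process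
  \<open>M\<^sub>t = exp(\<integral>\<^sub>0\<^sup>t (\<lambda> - V(X\<^sub>s)) ds) \<phi>(X\<^sub>t) 1{t < \<tau>\<^sub>D}\<close> has the mean value property at grid times, and refining
  the grid gives \<open>\<phi>(x) = E\<^sup>x[M\<^sub>\<sigma>]\<close> for the hitting time \<open>\<sigma>\<close> of the open ball truncated at \<open>t\<close>. The part
  of this expectation where the ball has not been hit by time \<open>t\<close> is at most
  \<open>u\<^sub>t = e\<^bsup>\<lambda>t\<^esup> T'\<^sub>t \<phi>\<close>, where \<open>T'\<close> is the semigroup killed also in the ball. It
  decreases to some \<open>u \<le> e\<^bsup>\<lambda>s\<^esup> T\<^sub>s u\<close>; integrating against \<open>\<phi>\<close> and using the symmetry of \<open>T\<^sub>s\<close>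
  gives equality almost everywhere, so \<open>u\<close> is a multiple of \<open>\<phi>\<close> by simplicity of \<open>\<lambda>\<close>. As \<open>u\<close> vanishes on
  the ball, \<open>u = 0\<close> almost everywhere, and then everywhere because \<open>X\<^sub>s\<close> has an absolutely
  continuous law (this is where \<open>\<Psi>(\<infinity>) = \<infinity>\<close> enters).

  Measurability of the exit time from the open set \<open>D\<close> and the symmetry of \<open>T\<^sub>s\<close> are reduced to
  closed sets by quasi-left-continuity: almost surely a path that has stayed in \<open>D\<close> up to time
  \<open>t\<close> has stayed in a closed inner set.\<close>

section \<open>Path laws determined by increments\<close>

text \<open>No filtration, conditional expectation or strong Markov theorem appears. The Markov
  property and time reversal are equalities of laws on the space of all paths with the product
  sigma-algebra, and a functional of the past is one that does not change when the path after
  \<open>s\<close> is given another continuation. That sigma-algebra sees countably many times only,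
  which shapes the rest: paths are read through a right limit along dyadic points, and killing is
  tested with closed sets at rational multiples of the horizon. Such a test survives reversal,
  although the reversed path is left-continuous; for the open set \<open>D\<close> it costs an
  almost sure statement about paths that approach the boundary.

  The second formula is not a limit under the expectation. Its integrand is that of the first
  divided by the value of \<open>\<phi>\<close> at the hitting point, and that value lies between
  bounds of \<open>\<phi>\<close> on a small closed ball, so continuity of \<open>\<phi>\<close> at
  \<open>xhat\<close> squeezes the expectation. The point \<open>x = xhat\<close> lies in every ball
  and is treated apart; its hitting time is 0.\<close>

abbreviation path_algebra :: "(real \<Rightarrow> 'v::euclidean_space) measure" where
  "path_algebra \<equiv> PiM UNIV (\<lambda>_. borel)"

definition rcont :: "(real \<Rightarrow> 'v::topological_space) \<Rightarrow> bool" where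
  "rcont p \<longleftrightarrow> (\<forall>r. (p \<longlongrightarrow> p r) (at_right r))"

text \<open>Evaluation of a path at a variable time is not measurable for the product sigma-algebra.
  This limit along dyadic points strictly to the right of \<open>r\<close> reads countably many
  coordinates only, so it is jointly measurable in path and time, and it returns \<open>p r\<close>
  when \<open>p\<close> is right-continuous at \<open>r\<close>.\<close>

definition right_ext :: "(real \<Rightarrow> 'v::euclidean_space) \<Rightarrow> real \<Rightarrow> 'v" where
  "right_ext p r = lim (\<lambda>n. p ((of_int \<lfloor>2 ^ n * r\<rfloor> + 1) / 2 ^ n))"

lemma dyadic_above:
  fixes r :: real
  shows "r < (of_int \<lfloor>2 ^ n * r\<rfloor> + 1) / 2 ^ n" "(of_int \<lfloor>2 ^ n * r\<rfloor> + 1) / 2 ^ n \<le> r + (1/2) ^ n"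
proof -
  have "2 ^ n * r < of_int \<lfloor>2 ^ n * r\<rfloor> + 1" by linarith
  then show "r < (of_int \<lfloor>2 ^ n * r\<rfloor> + 1) / 2 ^ n" by (simp add: field_simps)
  have "of_int \<lfloor>2 ^ n * r\<rfloor> + 1 \<le> 2 ^ n * r + 1" by linarith
  then show "(of_int \<lfloor>2 ^ n * r\<rfloor> + 1) / 2 ^ n \<le> r + (1/2) ^ n" by (simp add: field_simps)
qed

lemma dyadic_above_tendsto:
  fixes r :: real
  shows "filterlim (\<lambda>n. (of_int \<lfloor>2 ^ n * r\<rfloor> + 1) / 2 ^ n) (at_right r) sequentially"
proof -
  have "(\<lambda>n. r + (1/2) ^ n) \<longlonglongrightarrow> r + 0"
    by (intro tendsto_intros) auto
  then have upper: "(\<lambda>n. r + (1/2) ^ n) \<longlonglongrightarrow> r" by simp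
  have "(\<lambda>n. (of_int \<lfloor>2 ^ n * r\<rfloor> + 1) / 2 ^ n) \<longlonglongrightarrow> r"
    by (rule tendsto_sandwich[OF _ _ tendsto_const[of r] upper]; rule always_eventually; rule allI)
       (rule less_imp_le[OF dyadic_above(1)] dyadic_above(2))+
  then show ?thesis
    unfolding filterlim_at using dyadic_above(1)[of r] by (simp add: less_imp_neq[symmetric] less_imp_neq)
qed

lemma right_ext_eq: "(p \<longlongrightarrow> p r) (at_right r) \<Longrightarrow> right_ext p r = p r"
  unfolding right_ext_def
  by (rule limI) (rule filterlim_compose[OF _ dyadic_above_tendsto])

lemma right_ext_rcont [simp]: "rcont p \<Longrightarrow> right_ext p = p"
  by (auto simp: rcont_def right_ext_eq)

lemma measurable_right_ext [measurable (raw)]: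
  assumes [measurable]: "f \<in> N \<rightarrow>\<^sub>M (path_algebra :: (real \<Rightarrow> 'v::euclidean_space) measure)" "g \<in> borel_measurable N"
  shows "(\<lambda>x. right_ext (f x) (g x)) \<in> borel_measurable N"
  unfolding right_ext_def
proof (rule borel_measurable_lim_metric)
  fix n :: nat
  \<comment> \<open>The approximating times take countably many values, one for each integer
    \<open>i\<close>, so measurability follows by cases on the floor.\<close>
  have *: "(\<lambda>x. f x ((of_int i + 1) / 2 ^ n)) \<in> borel_measurable N" for i :: int
    using measurable_compose[OF assms(1) measurable_component_singleton[of "(of_int i + 1) / 2 ^ n" UNIV]] by simp
  have "(\<lambda>x. \<lfloor>2 ^ n * g x\<rfloor>) \<in> measurable N (count_space UNIV)" by measurable
  from measurable_compose_countable[OF * this]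
  show "(\<lambda>x. f x ((of_int \<lfloor>2 ^ n * g x\<rfloor> + 1) / 2 ^ n)) \<in> borel_measurable N" .
qed

lemma measurable_path: "(\<And>t. Z t \<in> borel_measurable N) \<Longrightarrow> (\<lambda>\<omega> t. Z t \<omega>) \<in> N \<rightarrow>\<^sub>M path_algebra"
  by (rule measurable_PiM_single') (auto simp: space_PiM)

lemma measurable_path_component:
  "f \<in> N \<rightarrow>\<^sub>M path_algebra \<Longrightarrow> (\<lambda>x. f x t) \<in> borel_measurable N"
  using measurable_compose[OF _ measurable_component_singleton[of t UNIV "\<lambda>_. borel"], of f N] by simp

text \<open>Only grids through \<open>s\<close> are tested, so that increments of a path glued at time \<open>s\<close> need never
  be split.\<close>

definition increment_law ::
  "real \<Rightarrow> 'w measure \<Rightarrow> (real \<Rightarrow> 'w \<Rightarrow> 'v::euclidean_space) \<Rightarrow> (real \<Rightarrow> real \<Rightarrow> 'v measure) \<Rightarrow> bool" where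
  "increment_law s N Z \<nu> \<longleftrightarrow>
     (\<forall>n (t :: nat \<Rightarrow> real) A. mono t \<and> s \<in> t ` {..n} \<and> (\<forall>i. A i \<in> sets borel) \<longrightarrow>
        emeasure N {\<omega> \<in> space N. \<forall>i<n. Z (t (Suc i)) \<omega> - Z (t i) \<omega> \<in> A i} =
        (\<Prod>i<n. emeasure (\<nu> (t i) (t (Suc i))) (A i)))"

text \<open>A sorted grid through the times of \<open>J\<close>, through \<open>s\<close> and
  through a point where both processes still vanish writes every value as a partial sum of
  increments. The law of the increments therefore fixes all finite-dimensional laws, and these
  determine the law on path space.\<close>

lemma increment_law_unique:
  fixes Z :: "real \<Rightarrow> 'w \<Rightarrow> 'v::euclidean_space" and Z' :: "real \<Rightarrow> 'u \<Rightarrow> 'v"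
  assumes N: "prob_space N" and N': "prob_space N'"
    and Z[measurable]: "\<And>t. Z t \<in> borel_measurable N" and Z'[measurable]: "\<And>t. Z' t \<in> borel_measurable N'"
    and Z0: "\<And>t \<omega>. t \<le> 0 \<Longrightarrow> Z t \<omega> = 0" and Z0': "\<And>t \<omega>. t \<le> 0 \<Longrightarrow> Z' t \<omega> = 0"
    and law: "increment_law s N Z \<nu>" and law': "increment_law s N' Z' \<nu>"
  shows "distr N path_algebra (\<lambda>\<omega> t. Z t \<omega>) = distr N' path_algebra (\<lambda>\<omega> t. Z' t \<omega>)"
proof (rule measure_eqI_PiM_infinite)
  interpret N: prob_space N by fact
  interpret N': prob_space N' by fact
  note mp = measurable_path[OF Z] measurable_path[OF Z']
  show "finite_measure (distr N path_algebra (\<lambda>\<omega> t. Z t \<omega>))"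
    by (intro prob_space.finite_measure N.prob_space_distr mp)
  fix A :: "real \<Rightarrow> 'v set" and J :: "real set"
  assume J: "finite J" and A: "\<And>i. i \<in> J \<Longrightarrow> A i \<in> sets borel"
  \<comment> \<open>Subtracting 1 puts the first grid point strictly below \<open>J\<close>,
    \<open>s\<close> and time 0, where both processes are 0.\<close>
  define m where "m = Min (insert 0 (insert s J)) - 1"
  define xs where "xs = sorted_list_of_set (insert m (insert s J))"
  define n where "n = length xs - 1"
  \<comment> \<open>\<open>min i n\<close> freezes the grid after its last point, so that
    \<open>t\<close> is monotone on all natural numbers, as \<open>increment_law\<close>
    requires.\<close>
  define t where "t i = xs ! (min i n)" for i
  have fin: "finite (insert m (insert s J))" using J by auto
  have set_xs: "set xs = insert m (insert s J)" unfolding xs_def by (rule set_sorted_list_of_set[OF fin])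
  have sorted: "sorted xs" "xs \<noteq> []"
    using set_xs by (auto simp: xs_def)
  have len: "length xs = Suc n" using sorted(2) by (simp add: n_def)
  have mono_t: "mono t" unfolding t_def mono_def
    by (auto intro!: sorted_nth_mono[OF sorted(1)] simp: len)
  have t_img: "t ` {..n} = insert m (insert s J)"
  proof -
    have "t ` {..n} = (!) xs ` {..n}" unfolding t_def by (intro image_cong) auto
    also have "\<dots> = set xs" using len by (simp add: set_conv_nth image_def) (metis less_Suc_eq_le atMost_iff)
    finally show ?thesis using set_xs by simp
  qed
  have m0: "m \<le> 0" "\<And>j. j \<in> J \<Longrightarrow> m < j" "m < s"
  proof -
    have *: "Min (insert 0 (insert s J)) \<le> x" if "x \<in> insert 0 (insert s J)" for x
      using J that by (intro Min_le) auto
    show "m \<le> 0" using *[of 0] by (auto simp: m_def)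
    show "\<And>j. j \<in> J \<Longrightarrow> m < j" using * by (force simp: m_def)
    show "m < s" using *[of s] by (auto simp: m_def)
  qed
  have t0: "t 0 \<le> 0"
  proof -
    obtain k where "t k = m" using t_img by (metis imageE insertI1)
    then show ?thesis using monoD[OF mono_t, of 0 k] m0(1) by simp
  qed
  define B where "B = PiM {..<n} (\<lambda>_. borel :: 'v measure)"
  define \<Delta> where "\<Delta> Y \<omega> = (\<lambda>i\<in>{..<n}. Y (t (Suc i)) \<omega> - Y (t i) \<omega>)"
    for Y :: "real \<Rightarrow> 'w \<Rightarrow> 'v" and \<omega> :: 'w
  define \<Delta>' where "\<Delta>' Y \<omega> = (\<lambda>i\<in>{..<n}. Y (t (Suc i)) \<omega> - Y (t i) \<omega>)"
    for Y :: "real \<Rightarrow> 'u \<Rightarrow> 'v" and \<omega> :: 'u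
  have \<Delta>_meas[measurable]: "\<Delta> Z \<in> N \<rightarrow>\<^sub>M B" unfolding \<Delta>_def B_def by measurable
  have \<Delta>'_meas[measurable]: "\<Delta>' Z' \<in> N' \<rightarrow>\<^sub>M B" unfolding \<Delta>'_def B_def by measurable
  have s_in: "s \<in> t ` {..n}" using t_img by auto
  have eq: "distr N B (\<Delta> Z) = distr N' B (\<Delta>' Z')"
  proof (unfold B_def, rule measure_eqI_PiM_finite[where A="\<lambda>_. Pi\<^sub>E {..<n} (\<lambda>_. UNIV)" and M="\<lambda>_. borel"])
    fix C :: "nat \<Rightarrow> 'v set" assume C: "\<And>i. i \<in> {..<n} \<Longrightarrow> C i \<in> sets borel"
    define C' where "C' i = (if i < n then C i else {})" for i
    have C': "\<forall>i. C' i \<in> sets borel" using C by (auto simp: C'_def)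
    have m: "Pi\<^sub>E {..<n} C \<in> sets B" unfolding B_def using C by (intro sets_PiM_I_finite) auto
    have "emeasure (distr N B (\<Delta> Z)) (Pi\<^sub>E {..<n} C) =
       emeasure N {\<omega> \<in> space N. \<forall>i<n. Z (t (Suc i)) \<omega> - Z (t i) \<omega> \<in> C' i}"
    proof -
      have "\<Delta> Z -` Pi\<^sub>E {..<n} C \<inter> space N =
        {\<omega> \<in> space N. \<forall>i<n. Z (t (Suc i)) \<omega> - Z (t i) \<omega> \<in> C' i}"
        unfolding \<Delta>_def C'_def vimage_def restrict_PiE_iff by auto
      then show ?thesis by (simp only: emeasure_distr[OF \<Delta>_meas m])
    qed
    also have "\<dots> = emeasure N' {\<omega> \<in> space N'. \<forall>i<n. Z' (t (Suc i)) \<omega> - Z' (t i) \<omega> \<in> C' i}"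
      using law[unfolded increment_law_def, THEN spec[of _ n], THEN spec[of _ t], THEN spec[of _ C']]
        law'[unfolded increment_law_def, THEN spec[of _ n], THEN spec[of _ t], THEN spec[of _ C']]
        mono_t s_in C' by simp
    also have "\<dots> = emeasure (distr N' B (\<Delta>' Z')) (Pi\<^sub>E {..<n} C)"
    proof -
      have "\<Delta>' Z' -` Pi\<^sub>E {..<n} C \<inter> space N' =
        {\<omega> \<in> space N'. \<forall>i<n. Z' (t (Suc i)) \<omega> - Z' (t i) \<omega> \<in> C' i}"
        unfolding \<Delta>'_def C'_def vimage_def restrict_PiE_iff by auto
      then show ?thesis by (simp only: emeasure_distr[OF \<Delta>'_meas m])
    qed
    finally show "emeasure (distr N (PiM {..<n} (\<lambda>_. borel)) (\<Delta> Z)) (Pi\<^sub>E {..<n} C) =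
      emeasure (distr N' (PiM {..<n} (\<lambda>_. borel)) (\<Delta>' Z')) (Pi\<^sub>E {..<n} C)" by (simp add: B_def)
  next
    interpret D: prob_space "distr N (PiM {..<n} (\<lambda>_. borel)) (\<Delta> Z)"
      using \<Delta>_meas unfolding B_def by (rule N.prob_space_distr)
    show "emeasure (distr N (Pi\<^sub>M {..<n} (\<lambda>_. borel)) (\<Delta> Z)) (Pi\<^sub>E {..<n} (\<lambda>_. UNIV)) \<noteq> \<infinity>" for i :: nat
      by simp
  qed (auto simp: space_PiM intro!: prod_algebraI_finite)
  have tel: "Y (t j) = (\<Sum>i<j. Y (t (Suc i)) - Y (t i))" if "j \<le> n" "Y (t 0) = 0"
    for j and Y :: "real \<Rightarrow> 'v"
    using sum_lessThan_telescope[of "\<lambda>i. Y (t i)" j] that by simp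
  \<comment> \<open>The cylinder event over \<open>J\<close>, expressed through the increments
    alone.\<close>
  define E where "E = {d \<in> space B. \<forall>j\<le>n. t j \<in> J \<longrightarrow> (\<Sum>i<j. d i) \<in> A (t j)}"
  have E: "E \<in> sets B"
  proof -
    have *: "(\<lambda>d. \<Sum>i<j. d i) \<in> borel_measurable B" if "j \<le> n" for j
      unfolding B_def using that by (intro borel_measurable_sum measurable_component_singleton) auto
    have "{d \<in> space B. (\<Sum>i<j. d i) \<in> A (t j)} \<in> sets B" if "j \<le> n" "t j \<in> J" for j
      using measurable_sets_Collect[OF *[OF that(1)]] A[OF that(2)] by auto
    then have 1: "{d \<in> space B. t j \<in> J \<longrightarrow> (\<Sum>i<j. d i) \<in> A (t j)} \<in> sets B" if "j \<le> n" for j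
      using that by (cases "t j \<in> J") simp_all
    have "E = (\<Inter>j\<in>{..n}. {d \<in> space B. t j \<in> J \<longrightarrow> (\<Sum>i<j. d i) \<in> A (t j)})"
      unfolding E_def by blast
    also have "\<dots> \<in> sets B" using 1 by (intro sets.finite_INT) auto
    finally show ?thesis .
  qed
  have *: "(\<forall>j\<in>J. Y j \<in> A j) \<longleftrightarrow> (\<lambda>i\<in>{..<n}. Y (t (Suc i)) - Y (t i)) \<in> E" if "Y (t 0) = 0" for Y
  proof -
    have "(\<forall>j\<in>J. Y j \<in> A j) \<longleftrightarrow> (\<forall>i\<le>n. t i \<in> J \<longrightarrow> Y (t i) \<in> A (t i))"
    proof (intro iffI ballI)
      fix j assume "\<forall>i\<le>n. t i \<in> J \<longrightarrow> Y (t i) \<in> A (t i)" "j \<in> J"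
      moreover obtain i where "i \<le> n" "j = t i" using t_img \<open>j \<in> J\<close> by blast
      ultimately show "Y j \<in> A j" by blast
    qed blast
    also have "\<dots> \<longleftrightarrow> (\<forall>j\<le>n. t j \<in> J \<longrightarrow> (\<Sum>i<j. (\<lambda>i\<in>{..<n}. Y (t (Suc i)) - Y (t i)) i) \<in> A (t j))"
    proof -
      have "(\<Sum>i<j. (\<lambda>i\<in>{..<n}. Y (t (Suc i)) - Y (t i)) i) = Y (t j)" if "j \<le> n" for j
        unfolding tel[of j Y, OF that \<open>Y (t 0) = 0\<close>] using that by (intro sum.cong) auto
      then show ?thesis by auto
    qed
    finally show ?thesis by (auto simp: E_def B_def space_PiM)
  qed
  have emb: "prod_emb UNIV (\<lambda>_. borel) J (Pi\<^sub>E J A) = {p :: real \<Rightarrow> 'v. \<forall>j\<in>J. p j \<in> A j}"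
    by (auto simp: prod_emb_def space_PiM PiE_def Pi_def)
  have sets_emb: "prod_emb UNIV (\<lambda>_. borel) J (Pi\<^sub>E J A) \<in> sets path_algebra"
    using J A by (intro sets_PiM_I) auto
  have "emeasure (distr N path_algebra (\<lambda>\<omega> t. Z t \<omega>)) (prod_emb UNIV (\<lambda>_. borel) J (Pi\<^sub>E J A)) =
        emeasure (distr N B (\<Delta> Z)) E"
  proof -
    have "(\<lambda>\<omega> t. Z t \<omega>) -` prod_emb UNIV (\<lambda>_. borel) J (Pi\<^sub>E J A) \<inter> space N = \<Delta> Z -` E \<inter> space N"
    proof -
      have "(\<forall>j\<in>J. Z j \<omega> \<in> A j) \<longleftrightarrow> \<Delta> Z \<omega> \<in> E" for \<omega>
        unfolding \<Delta>_def by (rule *[of "\<lambda>t. Z t \<omega>"]) (rule Z0[OF t0])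
      then show ?thesis by (auto simp: emb)
    qed
    then show ?thesis by (simp only: emeasure_distr[OF mp(1) sets_emb] emeasure_distr[OF \<Delta>_meas E])
  qed
  also have "\<dots> = emeasure (distr N' B (\<Delta>' Z')) E" by (simp add: eq)
  also have "\<dots> = emeasure (distr N' path_algebra (\<lambda>\<omega> t. Z' t \<omega>)) (prod_emb UNIV (\<lambda>_. borel) J (Pi\<^sub>E J A))"
  proof -
    have "(\<lambda>\<omega> t. Z' t \<omega>) -` prod_emb UNIV (\<lambda>_. borel) J (Pi\<^sub>E J A) \<inter> space N' = \<Delta>' Z' -` E \<inter> space N'"
    proof -
      have "(\<forall>j\<in>J. Z' j \<omega> \<in> A j) \<longleftrightarrow> \<Delta>' Z' \<omega> \<in> E" for \<omega>
        unfolding \<Delta>'_def by (rule *[of "\<lambda>t. Z' t \<omega>"]) (rule Z0'[OF t0])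
      then show ?thesis by (auto simp: emb)
    qed
    then show ?thesis by (simp only: emeasure_distr[OF mp(2) sets_emb] emeasure_distr[OF \<Delta>'_meas E])
  qed
  finally show "emeasure (distr N path_algebra (\<lambda>\<omega> t. Z t \<omega>)) (prod_emb UNIV (\<lambda>_. borel) J (Pi\<^sub>E J A)) =
    emeasure (distr N' path_algebra (\<lambda>\<omega> t. Z' t \<omega>)) (prod_emb UNIV (\<lambda>_. borel) J (Pi\<^sub>E J A))" .
qed auto

section \<open>Symmetric Levy processes\<close>

text \<open>The path properties hold for every sample point, and at negative times the path is 0, so
  that shifts and truncations of time need no exceptional cases. Completeness is there because the
  event of staying in an open set throughout an interval is reached only up to null sets. Of the
  Gaussian origin, symmetry and absolute continuity at positive times are kept.\<close>

locale sym_levy = prob_space M for M :: "'w measure" +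
  fixes X :: "real \<Rightarrow> 'w \<Rightarrow> 'v::euclidean_space"
  assumes complete: "complete_measure M"
    and X_meas [measurable]: "\<And>t. X t \<in> borel_measurable M"
    and X_nonpos: "\<And>t \<omega>. t \<le> 0 \<Longrightarrow> X t \<omega> = 0"
    and X_rcont: "\<And>\<omega>. rcont (\<lambda>t. X t \<omega>)"
    and X_increments: "\<And>n t A. mono t \<Longrightarrow> 0 \<le> t 0 \<Longrightarrow> (\<And>i. A i \<in> sets borel) \<Longrightarrow>
      emeasure M {\<omega> \<in> space M. \<forall>i<n::nat. X (t (Suc i)) \<omega> - X (t i) \<omega> \<in> A i} =
      (\<Prod>i<n. emeasure (distr M borel (X (t (Suc i) - t i))) (A i))"
    and X_symmetric: "\<And>t A. 0 \<le> t \<Longrightarrow> A \<in> sets borel \<Longrightarrow>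
      emeasure (distr M borel (X t)) (uminus -` A) = emeasure (distr M borel (X t)) A"
    and X_ac: "\<And>t A. 0 < t \<Longrightarrow> A \<in> null_sets lborel \<Longrightarrow> emeasure (distr M borel (X t)) A = 0"
begin

lemma path_meas [measurable]: "(\<lambda>\<omega> t. X t \<omega>) \<in> M \<rightarrow>\<^sub>M path_algebra"
  by (rule measurable_path) simp

lemma X_increments_real:
  assumes t: "mono t" and A: "\<And>i. A i \<in> sets borel"
  shows "emeasure M {\<omega> \<in> space M. \<forall>i<n::nat. X (t (Suc i)) \<omega> - X (t i) \<omega> \<in> A i} =
    (\<Prod>i<n. emeasure (distr M borel (X (max (t (Suc i)) 0 - max (t i) 0))) (A i))"
proof -
  have *: "X r \<omega> = X (max r 0) \<omega>" for r \<omega> using X_nonpos[of r \<omega>] X_nonpos[of 0 \<omega>] by (cases "r \<le> 0") auto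
  have "mono (\<lambda>i. max (t i) 0)" using t unfolding mono_def by (meson max.mono order_refl)
  from X_increments[OF this _ A, of n] show ?thesis
    by (simp only: *[symmetric])
qed

lemma law_UNIV [simp]: "emeasure (distr M borel (X t)) UNIV = 1"
  using prob_space.emeasure_space_1[OF prob_space_distr[OF X_meas[of t]]] by simp

text \<open>Grids through \<open>s\<close> split no increment: each one belongs to the past factor
  or to the independent copy, so the probabilities multiply. The outcome is the simple Markov
  property as an equality of path laws.\<close>

lemma splice_law:
  assumes s: "0 \<le> s"
  shows "distr (M \<Otimes>\<^sub>M M) path_algebra (\<lambda>w t. X (min t s) (fst w) + X (t - s) (snd w)) =
    distr M path_algebra (\<lambda>\<omega> t. X t \<omega>)"
proof (rule increment_law_unique[where s=s and \<nu>="\<lambda>a b. distr M borel (X (max b 0 - max a 0))"])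
  interpret MM: pair_prob_space M M ..
  show "prob_space (M \<Otimes>\<^sub>M M)" "prob_space M" by unfold_locales
  show "increment_law s M X (\<lambda>a b. distr M borel (X (max b 0 - max a 0)))"
    unfolding increment_law_def using X_increments_real by blast
  show "increment_law s (M \<Otimes>\<^sub>M M) (\<lambda>t w. X (min t s) (fst w) + X (t - s) (snd w))
     (\<lambda>a b. distr M borel (X (max b 0 - max a 0)))"
    unfolding increment_law_def
  proof (intro allI impI, elim conjE)
    fix n :: nat and t :: "nat \<Rightarrow> real" and A :: "nat \<Rightarrow> 'v set"
    assume t: "mono t" and "s \<in> t ` {..n}" and A: "\<forall>i. A i \<in> sets borel"
    then obtain m where m: "s = t m" "m \<le> n" by auto
    \<comment> \<open>Padding with \<open>UNIV\<close> lets both factors run over the same index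
      set; a padded term contributes the factor 1.\<close>
    define A1 where "A1 i = (if i < m then A i else UNIV)" for i
    define A2 where "A2 i = (if i < m then UNIV else A i)" for i
    have [measurable]: "A1 i \<in> sets borel" "A2 i \<in> sets borel" for i
      using A by (auto simp: A1_def A2_def)
    define E1 where "E1 = {\<omega> \<in> space M. \<forall>i<n. X (t (Suc i)) \<omega> - X (t i) \<omega> \<in> A1 i}"
    define E2 where "E2 = {\<omega> \<in> space M. \<forall>i<n. X (t (Suc i) - s) \<omega> - X (t i - s) \<omega> \<in> A2 i}"
    have [measurable]: "E1 \<in> sets M" "E2 \<in> sets M" unfolding E1_def E2_def by measurable
    have inc: "X (min (t (Suc i)) s) \<omega> + X (t (Suc i) - s) \<omega>' - (X (min (t i) s) \<omega> + X (t i - s) \<omega>') =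
        (if i < m then X (t (Suc i)) \<omega> - X (t i) \<omega> else X (t (Suc i) - s) \<omega>' - X (t i - s) \<omega>')" for i \<omega> \<omega>'
    proof (cases "i < m")
      case True
      then have "t (Suc i) \<le> s" "t i \<le> s" using t m by (auto simp: mono_def)
      then show ?thesis using True by (simp add: X_nonpos)
    next
      case False
      then have "s \<le> t (Suc i)" "s \<le> t i" using t m by (auto simp: mono_def)
      then show ?thesis using False by (simp add: min_absorb2)
    qed
    have "{w \<in> space (M \<Otimes>\<^sub>M M). \<forall>i<n. X (min (t (Suc i)) s) (fst w) + X (t (Suc i) - s) (snd w) -
        (X (min (t i) s) (fst w) + X (t i - s) (snd w)) \<in> A i} = E1 \<times> E2"
      unfolding inc by (auto simp: space_pair_measure E1_def E2_def A1_def A2_def split: if_splits)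
    then have "emeasure (M \<Otimes>\<^sub>M M) {w \<in> space (M \<Otimes>\<^sub>M M). \<forall>i<n. X (min (t (Suc i)) s) (fst w) +
        X (t (Suc i) - s) (snd w) - (X (min (t i) s) (fst w) + X (t i - s) (snd w)) \<in> A i} =
        emeasure M E1 * emeasure M E2"
      by (simp add: emeasure_pair_measure_Times)
    also have "emeasure M E1 = (\<Prod>i<n. emeasure (distr M borel (X (max (t (Suc i)) 0 - max (t i) 0))) (A1 i))"
      unfolding E1_def by (rule X_increments_real[OF t]) simp
    also have "emeasure M E2 = (\<Prod>i<n. emeasure (distr M borel (X (max (t (Suc i) - s) 0 - max (t i - s) 0))) (A2 i))"
      unfolding E2_def using t by (intro X_increments_real) (auto simp: mono_def)
    also have "(\<Prod>i<n. emeasure (distr M borel (X (max (t (Suc i)) 0 - max (t i) 0))) (A1 i)) *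
       (\<Prod>i<n. emeasure (distr M borel (X (max (t (Suc i) - s) 0 - max (t i - s) 0))) (A2 i)) =
       (\<Prod>i<n. emeasure (distr M borel (X (max (t (Suc i)) 0 - max (t i) 0))) (A i))"
      unfolding prod.distrib[symmetric]
    proof (intro prod.cong refl)
      fix i
      show "emeasure (distr M borel (X (max (t (Suc i)) 0 - max (t i) 0))) (A1 i) *
        emeasure (distr M borel (X (max (t (Suc i) - s) 0 - max (t i - s) 0))) (A2 i) =
        emeasure (distr M borel (X (max (t (Suc i)) 0 - max (t i) 0))) (A i)"
      proof (cases "i < m")
        case True then show ?thesis by (simp add: A1_def A2_def)
      next
        case False
        then have "s \<le> t (Suc i)" "s \<le> t i" using t m by (auto simp: mono_def)
        then have "max (t (Suc i) - s) 0 - max (t i - s) 0 = max (t (Suc i)) 0 - max (t i) 0"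
          using s by auto
        then show ?thesis using False by (simp add: A1_def A2_def)
      qed
    qed
    finally show "emeasure (M \<Otimes>\<^sub>M M) {w \<in> space (M \<Otimes>\<^sub>M M). \<forall>i<n. X (min (t (Suc i)) s) (fst w) +
        X (t (Suc i) - s) (snd w) - (X (min (t i) s) (fst w) + X (t i - s) (snd w)) \<in> A i} =
       (\<Prod>i<n. emeasure (distr M borel (X (max (t (Suc i)) 0 - max (t i) 0))) (A i))" .
  qed
qed (use s in \<open>auto simp: X_nonpos\<close>)

text \<open>Increments of the reversed path are the negated increments of the original in reverse
  order; symmetry removes the sign and the product formula does not see the order. Truncating time
  to the interval from 0 to \<open>s\<close> makes both sides paths on the whole line.\<close>

lemma reversal_law:
  assumes s: "0 \<le> s"
  shows "distr M path_algebra (\<lambda>\<omega> t. X (s - max 0 (min t s)) \<omega> - X s \<omega>) =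
    distr M path_algebra (\<lambda>\<omega> t. X (min t s) \<omega>)"
proof (rule increment_law_unique[where s=s and
      \<nu>="\<lambda>a b. distr M borel (X (max 0 (min b s) - max 0 (min a s)))"])
  show "prob_space M" "prob_space M" by unfold_locales
  define c where "c t = max 0 (min t s)" for t
  have c_mono: "a \<le> b \<Longrightarrow> c a \<le> c b" for a b unfolding c_def by auto
  have c_s: "c t \<le> s" "0 \<le> c t" for t using s by (auto simp: c_def)
  show "increment_law s M (\<lambda>t. X (min t s)) (\<lambda>a b. distr M borel (X (max 0 (min b s) - max 0 (min a s))))"
    unfolding increment_law_def
  proof (intro allI impI, elim conjE)
    fix n :: nat and t :: "nat \<Rightarrow> real" and A :: "nat \<Rightarrow> 'v set"
    assume t: "mono t" and A: "\<forall>i. A i \<in> sets borel"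
    have "mono (\<lambda>i. min (t i) s)" using t unfolding mono_def by (meson min.mono order_refl)
    from X_increments_real[OF this, of A n]
    show "emeasure M {\<omega> \<in> space M. \<forall>i<n. X (min (t (Suc i)) s) \<omega> - X (min (t i) s) \<omega> \<in> A i} =
      (\<Prod>i<n. emeasure (distr M borel (X (max 0 (min (t (Suc i)) s) - max 0 (min (t i) s)))) (A i))"
      using A by (simp add: max.commute)
  qed
  show "increment_law s M (\<lambda>t \<omega>. X (s - max 0 (min t s)) \<omega> - X s \<omega>)
     (\<lambda>a b. distr M borel (X (max 0 (min b s) - max 0 (min a s))))"
    unfolding increment_law_def c_def[symmetric]
  proof (intro allI impI, elim conjE)
    fix n :: nat and t :: "nat \<Rightarrow> real" and A :: "nat \<Rightarrow> 'v set"
    assume t: "mono t" and A: "\<forall>i. A i \<in> sets borel"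
    \<comment> \<open>The grid reflected at \<open>s\<close>; truncated subtraction of naturals
      keeps it constant after index \<open>n\<close>.\<close>
    define t' where "t' i = s - c (t (n - i))" for i
    have t': "mono t'" "0 \<le> t' 0"
      using t c_s unfolding t'_def mono_def by (auto intro!: c_mono)
    have neg: "uminus -` A i \<in> sets borel" for i
      using measurable_sets_borel[OF borel_measurable_uminus[OF measurable_ident] A[rule_format, of i]]
      by (simp add: vimage_def)
    have "(\<forall>i<n. X (s - c (t (Suc i))) \<omega> - X s \<omega> - (X (s - c (t i)) \<omega> - X s \<omega>) \<in> A i) \<longleftrightarrow>
       (\<forall>i<n. X (t' (Suc i)) \<omega> - X (t' i) \<omega> \<in> uminus -` A (n - Suc i))" for \<omega>
    proof (intro iffI allI impI)
      fix i assume *: "\<forall>i<n. X (s - c (t (Suc i))) \<omega> - X s \<omega> - (X (s - c (t i)) \<omega> - X s \<omega>) \<in> A i" and i: "i < n"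
      have "Suc (n - Suc i) = n - i" using i by auto
      then show "X (t' (Suc i)) \<omega> - X (t' i) \<omega> \<in> uminus -` A (n - Suc i)"
        using *[rule_format, of "n - Suc i"] i by (simp add: t'_def)
    next
      fix i assume *: "\<forall>i<n. X (t' (Suc i)) \<omega> - X (t' i) \<omega> \<in> uminus -` A (n - Suc i)" and i: "i < n"
      have "n - (n - Suc i) = Suc i" "n - Suc (n - Suc i) = i" using i by auto
      then show "X (s - c (t (Suc i))) \<omega> - X s \<omega> - (X (s - c (t i)) \<omega> - X s \<omega>) \<in> A i"
        using *[rule_format, of "n - Suc i"] i by (simp add: t'_def)
    qed
    then have "emeasure M {\<omega> \<in> space M. \<forall>i<n. X (s - c (t (Suc i))) \<omega> - X s \<omega> - (X (s - c (t i)) \<omega> - X s \<omega>) \<in> A i} =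
       emeasure M {\<omega> \<in> space M. \<forall>i<n. X (t' (Suc i)) \<omega> - X (t' i) \<omega> \<in> uminus -` A (n - Suc i)}"
      by (intro arg_cong2[where f=emeasure] refl) auto
    also have "\<dots> = (\<Prod>i<n. emeasure (distr M borel (X (t' (Suc i) - t' i))) (uminus -` A (n - Suc i)))"
      by (rule X_increments[OF t' neg])
    also have "\<dots> = (\<Prod>i<n. emeasure (distr M borel (X (t' (Suc i) - t' i))) (A (n - Suc i)))"
      using t' A by (intro prod.cong refl X_symmetric) (auto simp: mono_def)
    also have "\<dots> = (\<Prod>i<n. emeasure (distr M borel (X (c (t (Suc (n - Suc i))) - c (t (n - Suc i))))) (A (n - Suc i)))"
    proof (intro prod.cong refl)
      fix i assume "i \<in> {..<n}"
      then have "Suc (n - Suc i) = n - i" by auto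
      then show "emeasure (distr M borel (X (t' (Suc i) - t' i))) (A (n - Suc i)) =
        emeasure (distr M borel (X (c (t (Suc (n - Suc i))) - c (t (n - Suc i))))) (A (n - Suc i))"
        by (simp add: t'_def)
    qed
    also have "\<dots> = (\<Prod>i<n. emeasure (distr M borel (X (c (t (Suc i)) - c (t i)))) (A i))"
      by (rule prod.nat_diff_reindex)
    finally show "emeasure M {\<omega> \<in> space M. \<forall>i<n. X (s - c (t (Suc i))) \<omega> - X s \<omega> - (X (s - c (t i)) \<omega> - X s \<omega>) \<in> A i} =
      (\<Prod>i<n. emeasure (distr M borel (X (c (t (Suc i)) - c (t i)))) (A i))" .
  qed
qed (use s in \<open>auto simp: X_nonpos\<close>)

lemma nn_integral_splice:
  assumes s: "0 \<le> s" and [measurable]: "\<Phi> \<in> borel_measurable path_algebra"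
  shows "(\<integral>\<^sup>+\<omega>. \<Phi> (\<lambda>t. X t \<omega>) \<partial>M) = (\<integral>\<^sup>+\<omega>. \<integral>\<^sup>+\<omega>'. \<Phi> (\<lambda>t. X (min t s) \<omega> + X (t - s) \<omega>') \<partial>M \<partial>M)"
proof -
  interpret MM: pair_prob_space M M ..
  have m: "(\<lambda>w t. X (min t s) (fst w) + X (t - s) (snd w)) \<in> M \<Otimes>\<^sub>M M \<rightarrow>\<^sub>M path_algebra"
    by (rule measurable_path) simp
  have "(\<integral>\<^sup>+\<omega>. \<Phi> (\<lambda>t. X t \<omega>) \<partial>M) = (\<integral>\<^sup>+p. \<Phi> p \<partial>distr M path_algebra (\<lambda>\<omega> t. X t \<omega>))"
    by (subst nn_integral_distr) auto
  also have "\<dots> = (\<integral>\<^sup>+w. \<Phi> (\<lambda>t. X (min t s) (fst w) + X (t - s) (snd w)) \<partial>(M \<Otimes>\<^sub>M M))"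
    unfolding splice_law[OF s, symmetric] by (rule nn_integral_distr[OF m]) simp
  also have "\<dots> = (\<integral>\<^sup>+\<omega>. \<integral>\<^sup>+\<omega>'. \<Phi> (\<lambda>t. X (min t s) \<omega> + X (t - s) \<omega>') \<partial>M \<partial>M)"
    using measurable_compose[OF m assms(2)] by (subst nn_integral_fst[symmetric]) simp_all
  finally show ?thesis .
qed

end

section \<open>Feynman-Kac functionals\<close>

lemma rcont_open:
  fixes p :: "real \<Rightarrow> 'v::real_normed_vector"
  assumes "rcont p" "open U" "x + p r \<in> U"
  obtains b where "b > r" "\<And>r'. r \<le> r' \<Longrightarrow> r' < b \<Longrightarrow> x + p r' \<in> U"
proof -
  have "((\<lambda>r. x + p r) \<longlongrightarrow> x + p r) (at_right r)"
    using assms(1) by (intro tendsto_intros) (auto simp: rcont_def)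
  then have "eventually (\<lambda>r'. x + p r' \<in> U) (at_right r)"
    using assms(2,3) by (rule topological_tendstoD)
  then obtain b where "b > r" "\<And>r'. r < r' \<Longrightarrow> r' < b \<Longrightarrow> x + p r' \<in> U"
    unfolding eventually_at_right_field by auto
  then show ?thesis using that[of b] assms(3) by (metis order_le_less)
qed

text \<open>Rational multiples of \<open>s\<close> replace rational times so that the right end
  point is a test point itself: for \<open>r = s\<close> no later time is available and
  \<open>q = 1\<close> does the job. Otherwise right-continuity leaves room for a rational factor
  above \<open>r / s\<close>. The set of factors is also symmetric under \<open>q\<close> to
  \<open>1 - q\<close>, which time reversal will use.\<close>

lemma rcont_hits_open_rational:
  fixes p :: "real \<Rightarrow> 'v::real_normed_vector"
  assumes p: "rcont p" and U: "open U" and r: "0 \<le> r" "r \<le> s" "x + p r \<in> U"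
  obtains q where "q \<in> \<rat>" "0 \<le> q" "q \<le> 1" "r > 0 \<Longrightarrow> q > 0" "x + p (q * s) \<in> U"
proof (cases "r = s")
  case True
  then show ?thesis using that[of 1] r by auto
next
  case False
  then have s: "s > 0" "r < s" using r by auto
  obtain b where b: "b > r" "\<And>r'. r \<le> r' \<Longrightarrow> r' < b \<Longrightarrow> x + p r' \<in> U"
    using rcont_open[OF p U r(3)] by blast
  have "r / s < min (b / s) 1" using b s by (simp add: divide_strict_right_mono)
  then obtain q where q: "q \<in> \<rat>" "r / s < q" "q < min (b / s) 1"
    using Rats_dense_in_real by blast
  have "0 \<le> r / s" using r s by simp
  then have "0 < q" using q by linarith
  moreover have "r \<le> q * s" "q * s < b" using q s by (auto simp: field_simps)
  ultimately show ?thesis using that[of q] q b(2) by auto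
qed

lemma rcont_closed_rational:
  fixes p :: "real \<Rightarrow> 'v::real_normed_vector"
  assumes p: "rcont p" and K: "closed K" and s: "0 \<le> s"
  shows "(\<forall>q\<in>\<rat> \<inter> {0..1}. x + p (q * s) \<in> K) \<longleftrightarrow> (\<forall>r\<in>{0..s}. x + p r \<in> K)"
proof (intro iffI ballI)
  fix r assume *: "\<forall>q\<in>\<rat> \<inter> {0..1}. x + p (q * s) \<in> K" and r: "r \<in> {0..s}"
  show "x + p r \<in> K"
  proof (rule ccontr)
    assume "x + p r \<notin> K"
    then obtain q where "q \<in> \<rat>" "0 \<le> q" "q \<le> 1" "x + p (q * s) \<in> - K"
      using rcont_hits_open_rational[OF p, of "- K" r s x] K r by (auto simp: open_Compl)
    with * show False by auto
  qed
next
  fix q assume *: "\<forall>r\<in>{0..s}. x + p r \<in> K" and q: "q \<in> \<rat> \<inter> {0..1::real}"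
  have "q * s \<le> 1 * s" using q s by (intro mult_right_mono) auto
  then show "x + p (q * s) \<in> K" using * q s by auto
qed

lemma rcont_measurable: "rcont p \<Longrightarrow> p \<in> borel_measurable borel" for p :: "real \<Rightarrow> 'v::euclidean_space"
proof -
  assume p: "rcont p"
  have "(\<lambda>r. right_ext p r) \<in> borel_measurable borel"
    by (intro measurable_right_ext) (auto simp: space_PiM)
  then show ?thesis using p by simp
qed

lemma rcont_stop: "rcont p \<Longrightarrow> rcont (\<lambda>r. p (min r s))"
  unfolding rcont_def
proof (intro allI)
  fix r assume p: "\<forall>r. (p \<longlongrightarrow> p r) (at_right r)"
  show "((\<lambda>r. p (min r s)) \<longlongrightarrow> p (min r s)) (at_right r)"
  proof (cases "r < s")
    case True
    then have "eventually (\<lambda>r. p (min r s) = p r) (at_right r)"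
      unfolding eventually_at_right_field by (intro exI[of _ s]) auto
    then show ?thesis using p True by (simp add: tendsto_cong)
  next
    case False
    then have "eventually (\<lambda>r. p (min r s) = p s) (at_right r)"
      unfolding eventually_at_right_field by (intro exI[of _ "r+1"]) auto
    then show ?thesis using False by (simp add: tendsto_cong)
  qed
qed

text \<open>The index \<open>n\<close> is chosen once for the whole interval. For closed
  \<open>A n\<close> and right-continuous paths this is a countable union of conditions that are
  decided at rational multiples of \<open>s\<close>, hence measurable.\<close>

definition stays :: "(nat \<Rightarrow> 'v::euclidean_space set) \<Rightarrow> 'v \<Rightarrow> real \<Rightarrow> (real \<Rightarrow> 'v) \<Rightarrow> bool" where
  "stays A x s p \<longleftrightarrow> (\<exists>n. \<forall>r\<in>{0..s}. x + p r \<in> A n)"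

definition stays_rat :: "(nat \<Rightarrow> 'v::euclidean_space set) \<Rightarrow> 'v \<Rightarrow> real \<Rightarrow> (real \<Rightarrow> 'v) \<Rightarrow> bool" where
  "stays_rat A x s p \<longleftrightarrow> (\<exists>n. \<forall>q\<in>\<rat> \<inter> {0..1}. x + p (q * s) \<in> A n)"

lemma stays_rat_eq: "rcont p \<Longrightarrow> (\<And>n. closed (A n)) \<Longrightarrow> 0 \<le> s \<Longrightarrow> stays_rat A x s p = stays A x s p"
  unfolding stays_rat_def stays_def by (simp add: rcont_closed_rational)

locale feynman_kac_levy = sym_levy M X for M :: "'w measure" and X :: "real \<Rightarrow> 'w \<Rightarrow> 'v::euclidean_space" +
  fixes V :: "'v \<Rightarrow> real" and C :: real
  assumes V_meas [measurable]: "V \<in> borel_measurable borel" and V_bound: "\<And>y. \<bar>V y\<bar> \<le> C"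
begin

definition pot :: "'v \<Rightarrow> real \<Rightarrow> (real \<Rightarrow> 'v) \<Rightarrow> real" where
  "pot x s p = (LINT r:{0..s}|lborel. V (x + p r))"

definition weight :: "(nat \<Rightarrow> 'v set) \<Rightarrow> real \<Rightarrow> ('v \<Rightarrow> ennreal) \<Rightarrow> 'v \<Rightarrow> (real \<Rightarrow> 'v) \<Rightarrow> ennreal" where
  "weight A s f x p = (if stays A x s p then ennreal (exp (- pot x s p)) * f (x + p s) else 0)"

text \<open>The twin of \<open>weight\<close> that is measurable on all of path space, where paths
  need not be right-continuous: values pass through \<open>right_ext\<close>, and survival is tested
  at rational multiples of \<open>s\<close>.\<close>

definition weight_rat :: "(nat \<Rightarrow> 'v set) \<Rightarrow> real \<Rightarrow> ('v \<Rightarrow> ennreal) \<Rightarrow> 'v \<Rightarrow> (real \<Rightarrow> 'v) \<Rightarrow> ennreal" where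
  "weight_rat A s f x p = (if stays_rat A x s (right_ext p) then
     ennreal (exp (- pot x s (right_ext p))) * f (x + right_ext p s) else 0)"

definition semigroup :: "(nat \<Rightarrow> 'v set) \<Rightarrow> real \<Rightarrow> ('v \<Rightarrow> ennreal) \<Rightarrow> 'v \<Rightarrow> ennreal" where
  "semigroup A s f x = (\<integral>\<^sup>+\<omega>. weight A s f x (\<lambda>t. X t \<omega>) \<partial>M)"

lemma weight_rat_eq:
  "rcont p \<Longrightarrow> (\<And>n. closed (A n)) \<Longrightarrow> 0 \<le> s \<Longrightarrow> weight_rat A s f x p = weight A s f x p"
  unfolding weight_rat_def weight_def by (simp add: stays_rat_eq)

lemma pot_integrable:
  fixes p :: "real \<Rightarrow> 'v"
  assumes "p \<in> borel_measurable borel"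
  shows "set_integrable lborel {a..b} (\<lambda>r. V (x + p r))"
proof -
  note assms[measurable]
  show ?thesis unfolding set_integrable_def
    by (rule integrableI_bounded_set[where A="{a..b}" and B=C])
       (use V_bound in \<open>auto simp: emeasure_lborel_Icc_eq intro!: borel_measurable_times\<close>)
qed

lemma pot_bound:
  fixes p :: "real \<Rightarrow> 'v"
  assumes "p \<in> borel_measurable borel" "0 \<le> s"
  shows "\<bar>pot x s p\<bar> \<le> C * s"
proof -
  have C: "0 \<le> C" using V_bound[of 0] by linarith
  have "\<bar>pot x s p\<bar> \<le> (LINT r:{0..s}|lborel. C)"
    unfolding pot_def set_lebesgue_integral_def real_norm_def[symmetric]
  proof (rule Bochner_Integration.integral_norm_bound_integral)
    show "integrable lborel (\<lambda>r. indicat_real {0..s} r *\<^sub>R V (x + p r))"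
      using pot_integrable[OF assms(1), of 0 s x] by (simp add: set_integrable_def)
    show "integrable lborel (\<lambda>r. indicat_real {0..s} r *\<^sub>R C)"
      by (simp add: emeasure_lborel_Icc_eq)
    show "norm (indicat_real {0..s} r *\<^sub>R V (x + p r)) \<le> indicat_real {0..s} r *\<^sub>R C" for r
      using V_bound by (auto simp: indicator_def)
  qed
  then show ?thesis using assms(2) by (simp add: set_lebesgue_integral_def mult.commute)
qed

lemma measurable_pot [measurable (raw)]:
  assumes [measurable]: "f \<in> borel_measurable N" "g \<in> N \<rightarrow>\<^sub>M path_algebra"
  shows "(\<lambda>z. pot (f z) s (right_ext (g z))) \<in> borel_measurable N"
  unfolding pot_def set_lebesgue_integral_def
  by (rule lborel.borel_measurable_lebesgue_integral) measurable

lemma measurable_weight_rat [measurable (raw)]: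
  assumes [measurable]: "f \<in> borel_measurable N" "g \<in> N \<rightarrow>\<^sub>M path_algebra" "h \<in> borel_measurable borel"
    and A: "\<And>n. closed (A n)"
  shows "(\<lambda>z. weight_rat A s h (f z) (g z)) \<in> borel_measurable N"
proof -
  have [measurable]: "A n \<in> sets borel" for n using A by auto
  have "countable (\<rat> \<inter> {0..1} :: real set)" using countable_rat by blast
  then show ?thesis unfolding weight_rat_def stays_rat_def by measurable
qed

lemma measurable_weight [measurable (raw)]:
  assumes [measurable]: "f \<in> borel_measurable N" "g \<in> N \<rightarrow>\<^sub>M M" "h \<in> borel_measurable borel"
    and A: "\<And>n. closed (A n)" and s: "0 \<le> s"
  shows "(\<lambda>z. weight A s h (f z) (\<lambda>t. X t (g z))) \<in> borel_measurable N"
proof -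
  have "(\<lambda>z. weight_rat A s h (f z) (\<lambda>t. X t (g z))) \<in> borel_measurable N"
    using A by (intro measurable_weight_rat measurable_path) auto
  then show ?thesis by (simp add: weight_rat_eq[OF X_rcont A s])
qed

lemma measurable_semigroup [measurable (raw)]:
  assumes [measurable]: "h \<in> borel_measurable borel" and A: "\<And>n. closed (A n)" and s: "0 \<le> s"
  shows "semigroup A s h \<in> borel_measurable borel"
proof -
  have "(\<lambda>z. weight A s h (fst z) (\<lambda>t. X t (snd z))) \<in> borel_measurable (borel \<Otimes>\<^sub>M M)"
    using A s by (intro measurable_weight) auto
  then show ?thesis unfolding semigroup_def
    by (intro borel_measurable_nn_integral) (simp add: split_beta')
qed

section \<open>Markov property of the killed weights\<close>

lemma pot_splice:
  assumes st: "0 \<le> s" "0 \<le> t"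
    and Z: "\<And>r. 0 \<le> r \<Longrightarrow> r \<le> s \<Longrightarrow> Z r = p r" "\<And>r. s \<le> r \<Longrightarrow> Z r = p s + p' (r - s)"
    and Zm: "Z \<in> borel_measurable borel"
  shows "pot x (s + t) Z = pot x s p + pot (x + p s) t p'"
proof -
  have "{0..s + t} = {0..s} \<union> {s..s + t}" using st by auto
  then have "pot x (s + t) Z = (LINT r:{0..s} \<union> {s..s+t}|lborel. V (x + Z r))" unfolding pot_def by simp
  also have "\<dots> = (LINT r:{0..s}|lborel. V (x + Z r)) + (LINT r:{s..s+t}|lborel. V (x + Z r))"
  proof (rule set_integral_Un_AE)
    show "AE r in lborel. \<not> (r \<in> {0..s} \<and> r \<in> {s..s + t})"
      using AE_lborel_singleton[of s] by eventually_elim auto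
  qed (use pot_integrable[OF Zm] in auto)
  also have "(LINT r:{0..s}|lborel. V (x + Z r)) = pot x s p"
    unfolding pot_def by (intro set_lebesgue_integral_cong) (auto simp: Z)
  also have "(LINT r:{s..s+t}|lborel. V (x + Z r)) = (LINT r|lborel. indicator {s..s+t} (s + 1 * r) *\<^sub>R V (x + Z (s + 1 * r)))"
    unfolding set_lebesgue_integral_def by (subst lborel_integral_real_affine[where c=1 and t=s]) auto
  also have "\<dots> = pot (x + p s) t p'"
    unfolding pot_def set_lebesgue_integral_def
  proof (rule Bochner_Integration.integral_cong[OF refl])
    fix r :: real
    show "indicator {s..s+t} (s + 1 * r) *\<^sub>R V (x + Z (s + 1 * r)) = indicator {0..t} r *\<^sub>R V (x + p s + p' r)"
      using Z(2)[of "s + r"] by (auto simp: indicator_def add.assoc)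
  qed
  finally show ?thesis .
qed

lemma weight_splice:
  assumes st: "0 \<le> s" "0 \<le> t" and A: "\<And>n. closed (A n)" "incseq A"
  shows "weight_rat A (s + t) f x (\<lambda>r. X (min r s) \<omega> + X (r - s) \<omega>') =
    (if stays A x s (\<lambda>r. X r \<omega>) then ennreal (exp (- pot x s (\<lambda>r. X r \<omega>))) *
       weight A t f (x + X s \<omega>) (\<lambda>r. X r \<omega>') else 0)"
proof -
  define Z where "Z r = X (min r s) \<omega> + X (r - s) \<omega>'" for r
  have Z: "\<And>r. r \<le> s \<Longrightarrow> Z r = X r \<omega>" "\<And>r. s \<le> r \<Longrightarrow> Z r = X s \<omega> + X (r - s) \<omega>'"
    unfolding Z_def by (auto simp: X_nonpos)
  have "rcont (\<lambda>r. X (r - s) \<omega>')"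
    unfolding rcont_def
  proof
    fix r
    have "filterlim (\<lambda>r. r - s) (at_right (r - s)) (at_right r)"
      unfolding filterlim_at
      by (auto intro!: tendsto_intros eventually_mono[OF eventually_at_right_less])
    then show "((\<lambda>r. X (r - s) \<omega>') \<longlongrightarrow> X (r - s) \<omega>') (at_right r)"
      using X_rcont[of \<omega>'] unfolding rcont_def by (auto intro: filterlim_compose)
  qed
  then have Zr: "rcont Z"
    using rcont_stop[OF X_rcont[of \<omega>], of s] unfolding Z_def rcont_def by (auto intro: tendsto_add)
  have "pot x (s + t) Z = pot x s (\<lambda>r. X r \<omega>) + pot (x + X s \<omega>) t (\<lambda>r. X r \<omega>')"
    using Z by (intro pot_splice st rcont_measurable[OF Zr]) auto
  then have e: "ennreal (exp (- pot x (s + t) Z)) =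
      ennreal (exp (- pot x s (\<lambda>r. X r \<omega>))) * ennreal (exp (- pot (x + X s \<omega>) t (\<lambda>r. X r \<omega>')))"
    by (simp add: ennreal_mult[symmetric] exp_add[symmetric])
  have "stays A x (s + t) Z \<longleftrightarrow> stays A x s (\<lambda>r. X r \<omega>) \<and> stays A (x + X s \<omega>) t (\<lambda>r. X r \<omega>')"
  proof
    assume "stays A x (s + t) Z"
    then obtain n where n: "\<forall>r\<in>{0..s + t}. x + Z r \<in> A n" by (auto simp: stays_def)
    have "x + X r \<omega> \<in> A n" if "r \<in> {0..s}" for r using n Z(1)[of r] that st by force
    moreover have "x + X s \<omega> + X r \<omega>' \<in> A n" if "r \<in> {0..t}" for r
      using n[rule_format, of "s + r"] Z(2)[of "s + r"] that st by (auto simp: add.assoc)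
    ultimately show "stays A x s (\<lambda>r. X r \<omega>) \<and> stays A (x + X s \<omega>) t (\<lambda>r. X r \<omega>')"
      by (auto simp: stays_def intro!: exI[of _ n])
  next
    assume "stays A x s (\<lambda>r. X r \<omega>) \<and> stays A (x + X s \<omega>) t (\<lambda>r. X r \<omega>')"
    then obtain n m where n: "\<forall>r\<in>{0..s}. x + X r \<omega> \<in> A n" and m: "\<forall>r\<in>{0..t}. x + X s \<omega> + X r \<omega>' \<in> A m"
      by (auto simp: stays_def)
    \<comment> \<open>Each half of the path stays in its own closed set; monotonicity of
      \<open>A\<close> supplies a common one.\<close>
    have "A n \<subseteq> A (max n m)" "A m \<subseteq> A (max n m)" using A(2) by (auto simp: incseq_def)
    moreover have "x + Z r \<in> A n \<or> x + Z r \<in> A m" if "r \<in> {0..s + t}" for r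
      using n[rule_format, of r] m[rule_format, of "r - s"] Z(1)[of r] Z(2)[of r] that
      by (cases "r \<le> s") (auto simp: add.assoc)
    ultimately show "stays A x (s + t) Z" unfolding stays_def by blast
  qed
  then have "weight A (s + t) f x Z = (if stays A x s (\<lambda>r. X r \<omega>) then
      ennreal (exp (- pot x s (\<lambda>r. X r \<omega>))) * weight A t f (x + X s \<omega>) (\<lambda>r. X r \<omega>') else 0)"
    using Z(2)[of "s + t"] st unfolding weight_def e by (auto simp: mult.assoc add.assoc)
  then show ?thesis using weight_rat_eq[OF Zr A(1), of "s + t"] st unfolding Z_def by simp
qed

text \<open>The hypothesis \<open>G_past\<close> says that \<open>G\<close> looks only at the path
  up to \<open>s\<close>, without naming a sigma-algebra of the past. The factor \<open>G\<close>
  will be the indicator that a grid walk first meets the target at a prescribed index.\<close>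

lemma markov:
  assumes st: "0 \<le> s" "0 \<le> t" and A: "\<And>n. closed (A n)" "incseq A" and f[measurable]: "f \<in> borel_measurable borel"
    and G[measurable]: "G \<in> borel_measurable path_algebra"
    and G_past: "\<And>\<omega> \<omega>'. G (\<lambda>r. X (min r s) \<omega> + X (r - s) \<omega>') = G (\<lambda>r. X r \<omega>)"
  shows "(\<integral>\<^sup>+\<omega>. G (\<lambda>r. X r \<omega>) * weight A (s + t) f x (\<lambda>r. X r \<omega>) \<partial>M) =
    (\<integral>\<^sup>+\<omega>. G (\<lambda>r. X r \<omega>) * weight A s (semigroup A t f) x (\<lambda>r. X r \<omega>) \<partial>M)"
proof -
  note mw = measurable_weight_rat[OF _ _ f A(1)]
  have 1: "(\<lambda>p. G p * weight_rat A (s + t) f x p) \<in> borel_measurable path_algebra"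
    by (intro borel_measurable_times_ennreal G mw) auto
  have "(\<integral>\<^sup>+\<omega>. G (\<lambda>r. X r \<omega>) * weight A (s + t) f x (\<lambda>r. X r \<omega>) \<partial>M) =
    (\<integral>\<^sup>+\<omega>. G (\<lambda>r. X r \<omega>) * weight_rat A (s + t) f x (\<lambda>r. X r \<omega>) \<partial>M)"
    using st by (simp add: weight_rat_eq[OF X_rcont A(1)])
  also have "\<dots> = (\<integral>\<^sup>+\<omega>. \<integral>\<^sup>+\<omega>'. G (\<lambda>r. X r \<omega>) * (if stays A x s (\<lambda>r. X r \<omega>) then
       ennreal (exp (- pot x s (\<lambda>r. X r \<omega>))) * weight A t f (x + X s \<omega>) (\<lambda>r. X r \<omega>') else 0) \<partial>M \<partial>M)"
    unfolding nn_integral_splice[OF st(1) 1] by (simp only: weight_splice[OF st A] G_past)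
  also have "\<dots> = (\<integral>\<^sup>+\<omega>. G (\<lambda>r. X r \<omega>) * weight A s (semigroup A t f) x (\<lambda>r. X r \<omega>) \<partial>M)"
  proof (rule nn_integral_cong)
    fix \<omega>
    have "(\<lambda>\<omega>'. weight A t f (x + X s \<omega>) (\<lambda>r. X r \<omega>')) \<in> borel_measurable M"
      using A st by (intro measurable_weight) auto
    then show "(\<integral>\<^sup>+\<omega>'. G (\<lambda>r. X r \<omega>) * (if stays A x s (\<lambda>r. X r \<omega>) then
       ennreal (exp (- pot x s (\<lambda>r. X r \<omega>))) * weight A t f (x + X s \<omega>) (\<lambda>r. X r \<omega>') else 0) \<partial>M) =
       G (\<lambda>r. X r \<omega>) * weight A s (semigroup A t f) x (\<lambda>r. X r \<omega>)"
      by (cases "stays A x s (\<lambda>r. X r \<omega>)")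
         (simp_all add: weight_def[of A s] semigroup_def nn_integral_cmult)
  qed
  finally show ?thesis .
qed

lemma semigroup_add:
  assumes st: "0 \<le> s" "0 \<le> t" and A: "\<And>n. closed (A n)" "incseq A" and f: "f \<in> borel_measurable borel"
  shows "semigroup A (s + t) f x = semigroup A s (semigroup A t f) x"
  using markov[OF st A f, of "\<lambda>_. 1" x] by (simp add: semigroup_def)

section \<open>Time reversal and symmetry of the semigroup\<close>

lemma weight_cong:
  assumes "\<And>r. 0 \<le> r \<Longrightarrow> r \<le> s \<Longrightarrow> p r = p' r" "0 \<le> s"
  shows "weight A s f x p = weight A s f x p'"
proof -
  have "pot x s p = pot x s p'"
    unfolding pot_def set_lebesgue_integral_def
    by (intro Bochner_Integration.integral_cong) (auto simp: indicator_def assms)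
  moreover have "stays A x s p = stays A x s p'"
    unfolding stays_def using assms by simp
  ultimately show ?thesis using assms unfolding weight_def by simp
qed

text \<open>\<open>R\<close> is left-continuous in time, so \<open>right_ext\<close> need not return
  it. It has the law of a right-continuous path, however, which gives agreement almost surely at
  each fixed time and, by Fubini, almost surely at almost every time.\<close>

lemma reversal_AE:
  assumes s: "0 \<le> s"
  defines "R \<equiv> \<lambda>\<omega> t. X (s - max 0 (min t s)) \<omega> - X s \<omega>"
  shows "AE \<omega> in M. right_ext (R \<omega>) r = R \<omega> r"
    and "AE \<omega> in M. AE r in lborel. right_ext (R \<omega>) r = R \<omega> r"
proof -
  interpret MR: pair_sigma_finite M "lborel :: real measure" ..
  have Rm: "(\<lambda>\<omega> t. R \<omega> t) \<in> M \<rightarrow>\<^sub>M path_algebra" unfolding R_def by (rule measurable_path) simp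
  have Sm: "(\<lambda>\<omega> t. X (min t s) \<omega>) \<in> M \<rightarrow>\<^sub>M path_algebra" by (rule measurable_path) simp
  show 1: "AE \<omega> in M. right_ext (R \<omega>) r = R \<omega> r" for r
  proof -
    have "(\<lambda>p. right_ext p r) \<in> borel_measurable path_algebra" by measurable
    then have sets: "{p \<in> space path_algebra. right_ext p r = (p r :: 'v)} \<in> sets path_algebra"
      using measurable_path_component[of "\<lambda>p. p" path_algebra r] by measurable
    have "AE \<omega> in M. right_ext (\<lambda>t. X (min t s) \<omega>) r = X (min r s) \<omega>"
      using rcont_stop[OF X_rcont] by simp
    then have "AE p in distr M path_algebra (\<lambda>\<omega> t. X (min t s) \<omega>). right_ext p r = p r"
      by (subst AE_distr_iff[OF Sm sets])
    then have "AE p in distr M path_algebra (\<lambda>\<omega> t. R \<omega> t). right_ext p r = p r"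
      unfolding R_def reversal_law[OF s] .
    then show ?thesis by (subst (asm) AE_distr_iff[OF Rm sets])
  qed
  have [measurable]: "(\<lambda>w. R (fst w) (snd w)) \<in> borel_measurable (M \<Otimes>\<^sub>M lborel)"
  proof -
    have "(\<lambda>w. right_ext (\<lambda>t. X t (fst w)) (s - max 0 (min (snd w) s)) - X s (fst w))
      \<in> borel_measurable (M \<Otimes>\<^sub>M lborel)"
      by (intro borel_measurable_diff measurable_right_ext measurable_compose[OF measurable_fst path_meas]) measurable
    then show ?thesis unfolding R_def by (simp add: X_rcont)
  qed
  have [measurable]: "(\<lambda>w. right_ext (R (fst w)) (snd w)) \<in> borel_measurable (M \<Otimes>\<^sub>M lborel)"
    by (intro measurable_right_ext measurable_compose[OF measurable_fst Rm]) auto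
  show "AE \<omega> in M. AE r in lborel. right_ext (R \<omega>) r = R \<omega> r"
  proof -
    have "{w \<in> space (M \<Otimes>\<^sub>M lborel). right_ext (R (fst w)) (snd w) = R (fst w) (snd w)} \<in> sets (M \<Otimes>\<^sub>M lborel)"
      by measurable
    then show ?thesis
      using MR.AE_commute[where P="\<lambda>\<omega> r. right_ext (R \<omega>) r = R \<omega> r"] by (simp add: 1)
  qed
qed

text \<open>Under the substitution \<open>x = X s \<omega> + z\<close> the reversed path started at
  \<open>x\<close> runs backwards through the original path started at \<open>z\<close>, which
  exchanges start and end point and with them \<open>f\<close> and \<open>g\<close>. Lebesgue
  measure is invariant under the shift, and survival and potential are invariant under the
  reversal.\<close>

lemma semigroup_symmetric:
  assumes s: "0 \<le> s" and A: "\<And>n. closed (A n)"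
    and f[measurable]: "f \<in> borel_measurable borel" and g[measurable]: "g \<in> borel_measurable borel"
  shows "(\<integral>\<^sup>+x. g x * semigroup A s f x \<partial>lborel) = (\<integral>\<^sup>+x. f x * semigroup A s g x \<partial>lborel)"
proof -
  interpret LM: pair_sigma_finite "lborel :: 'v measure" M ..
  define R where "R \<equiv> \<lambda>\<omega> t. X (s - max 0 (min t s)) \<omega> - X s \<omega>"
  define \<Psi> where "\<Psi> p = (\<integral>\<^sup>+x. g x * weight_rat A s f x p \<partial>lborel)" for p
  have Rm: "(\<lambda>\<omega> t. R \<omega> t) \<in> M \<rightarrow>\<^sub>M path_algebra" unfolding R_def by (rule measurable_path) simp
  have Sm: "(\<lambda>\<omega> t. X (min t s) \<omega>) \<in> M \<rightarrow>\<^sub>M path_algebra" by (rule measurable_path) simp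
  have Wm: "(\<lambda>w. g' (fst w) * weight A s f' (fst w) (\<lambda>t. X t (snd w))) \<in> borel_measurable (lborel \<Otimes>\<^sub>M M)"
    if [measurable]: "f' \<in> borel_measurable borel" "g' \<in> borel_measurable borel" for f' g'
    by (intro borel_measurable_times_ennreal measurable_weight[OF _ _ _ A s]) measurable
  have \<Psi>m: "\<Psi> \<in> borel_measurable path_algebra"
  proof -
    have "(\<lambda>w. g (snd w) * weight_rat A s f (snd w) (fst w)) \<in> borel_measurable (path_algebra \<Otimes>\<^sub>M lborel)"
      by (intro borel_measurable_times_ennreal measurable_weight_rat[OF _ _ _ A]) measurable
    then show ?thesis unfolding \<Psi>_def
      by (intro lborel.borel_measurable_nn_integral) (simp add: split_beta')
  qed
  have swap: "(\<integral>\<^sup>+x. g' x * semigroup A s f' x \<partial>lborel) =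
      (\<integral>\<^sup>+\<omega>. \<integral>\<^sup>+x. g' x * weight A s f' x (\<lambda>t. X t \<omega>) \<partial>lborel \<partial>M)"
    if [measurable]: "f' \<in> borel_measurable borel" "g' \<in> borel_measurable borel" for f' g'
  proof -
    have "(\<integral>\<^sup>+x. g' x * semigroup A s f' x \<partial>lborel) =
       (\<integral>\<^sup>+x. \<integral>\<^sup>+\<omega>. g' x * weight A s f' x (\<lambda>t. X t \<omega>) \<partial>M \<partial>lborel)"
      unfolding semigroup_def
      by (intro nn_integral_cong nn_integral_cmult[symmetric] measurable_weight[OF _ _ _ A s]) auto
    also have "\<dots> = (\<integral>\<^sup>+\<omega>. \<integral>\<^sup>+x. g' x * weight A s f' x (\<lambda>t. X t \<omega>) \<partial>lborel \<partial>M)"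
      using Wm[of f' g'] by (intro LM.Fubini'[symmetric]) (simp add: split_beta')
    finally show ?thesis .
  qed
  have "(\<integral>\<^sup>+x. g x * semigroup A s f x \<partial>lborel) = (\<integral>\<^sup>+\<omega>. \<Psi> (\<lambda>t. X (min t s) \<omega>) \<partial>M)"
    unfolding swap[OF f g] \<Psi>_def
    by (intro nn_integral_cong arg_cong2[where f="(*)"] refl,
        subst weight_rat_eq[OF rcont_stop[OF X_rcont] A s], rule weight_cong[OF _ s]) simp
  also have "\<dots> = (\<integral>\<^sup>+p. \<Psi> p \<partial>distr M path_algebra (\<lambda>\<omega> t. X (min t s) \<omega>))"
    using nn_integral_distr[OF Sm, of \<Psi>] \<Psi>m by simp
  also have "\<dots> = (\<integral>\<^sup>+\<omega>. \<Psi> (R \<omega>) \<partial>M)"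
    unfolding reversal_law[OF s, symmetric] R_def[symmetric] using nn_integral_distr[OF Rm, of \<Psi>] \<Psi>m by simp
  also have "\<dots> = (\<integral>\<^sup>+\<omega>. \<integral>\<^sup>+x. f x * weight A s g x (\<lambda>t. X t \<omega>) \<partial>lborel \<partial>M)"
  proof (rule nn_integral_cong_AE)
    have "AE \<omega> in M. \<forall>q\<in>\<rat> \<inter> {0..1}. right_ext (R \<omega>) (q * s) = R \<omega> (q * s)"
      unfolding R_def using reversal_AE(1)[OF s] countable_rat by (subst AE_ball_countable) auto
    moreover have "AE \<omega> in M. AE r in lborel. right_ext (R \<omega>) r = R \<omega> r"
      unfolding R_def by (rule reversal_AE(2)[OF s])
    ultimately show "AE \<omega> in M. \<Psi> (R \<omega>) = (\<integral>\<^sup>+x. f x * weight A s g x (\<lambda>t. X t \<omega>) \<partial>lborel)"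
    proof eventually_elim
      fix \<omega> assume rat: "\<forall>q\<in>\<rat> \<inter> {0..1}. right_ext (R \<omega>) (q * s) = R \<omega> (q * s)"
        and ae: "AE r in lborel. right_ext (R \<omega>) r = R \<omega> r"
      define c where "c = X s \<omega>"
      have Rq: "right_ext (R \<omega>) (q * s) = X ((1 - q) * s) \<omega> - c" if "q \<in> \<rat>" "0 \<le> q" "q \<le> 1" for q
      proof -
        have "q * s \<le> 1 * s" using that s by (intro mult_right_mono) auto
        then show ?thesis using rat that s by (simp add: R_def c_def algebra_simps)
      qed
      have Rs: "right_ext (R \<omega>) s = - c" using Rq[of 1] by (simp add: X_nonpos)
      have [measurable]: "(\<lambda>t. X t \<omega>) \<in> borel_measurable borel" by (rule rcont_measurable[OF X_rcont])
      have "R \<omega> \<in> space path_algebra" by (simp add: space_PiM)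
      then have [measurable]: "(\<lambda>t. right_ext (R \<omega>) t) \<in> borel_measurable borel" by (intro measurable_right_ext) auto
      have shift: "weight_rat A s f (c + z) (R \<omega>) = (if stays A z s (\<lambda>t. X t \<omega>) then
          ennreal (exp (- pot z s (\<lambda>t. X t \<omega>))) * f z else 0)" for z
      proof -
        \<comment> \<open>For the potential, agreement of \<open>right_ext\<close> with
          \<open>R\<close> at almost every time is enough; the substitution of \<open>s - r\<close>
          for \<open>r\<close> does the rest.\<close>
        have "pot (c + z) s (right_ext (R \<omega>)) = (LINT r:{0..s}|lborel. V (z + X (s - r) \<omega>))"
          unfolding pot_def
        proof (rule set_lebesgue_integral_cong_AE)
          show "AE r\<in>{0..s} in lborel. V (c + z + right_ext (R \<omega>) r) = V (z + X (s - r) \<omega>)"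
            using ae by eventually_elim (auto simp: R_def c_def)
        qed measurable
        also have "\<dots> = pot z s (\<lambda>t. X t \<omega>)"
          unfolding pot_def set_lebesgue_integral_def
          by (subst lborel_integral_real_affine[where c="-1" and t=s])
             (auto intro!: Bochner_Integration.integral_cong simp: indicator_def)
        finally have p: "pot (c + z) s (right_ext (R \<omega>)) = pot z s (\<lambda>t. X t \<omega>)" .
        \<comment> \<open>Both \<open>q\<close> and \<open>1 - q\<close> range over the rational
          factors in the unit interval, so reading the grid backwards tests the same points.\<close>
        have "(\<forall>q\<in>\<rat> \<inter> {0..1}. c + z + right_ext (R \<omega>) (q * s) \<in> K) \<longleftrightarrow>
            (\<forall>q\<in>\<rat> \<inter> {0..1}. z + X (q * s) \<omega> \<in> K)" for K
        proof (intro iffI ballI)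
          fix q assume "\<forall>q\<in>\<rat> \<inter> {0..1}. c + z + right_ext (R \<omega>) (q * s) \<in> K" "q \<in> \<rat> \<inter> {0..1::real}"
          then show "z + X (q * s) \<omega> \<in> K" using Rq[of "1 - q"] by (auto dest: bspec[of _ _ "1 - q"])
        next
          fix q assume "\<forall>q\<in>\<rat> \<inter> {0..1}. z + X (q * s) \<omega> \<in> K" "q \<in> \<rat> \<inter> {0..1::real}"
          then show "c + z + right_ext (R \<omega>) (q * s) \<in> K" using Rq[of q] by (auto dest: bspec[of _ _ "1 - q"])
        qed
        then have "stays_rat A (c + z) s (right_ext (R \<omega>)) = stays A z s (\<lambda>t. X t \<omega>)"
          unfolding stays_rat_eq[OF X_rcont A s, symmetric] stays_rat_def by simp
        then show ?thesis unfolding weight_rat_def p Rs by simp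
      qed
      have "\<Psi> (R \<omega>) = (\<integral>\<^sup>+x. g x * weight_rat A s f x (R \<omega>) \<partial>distr lborel borel ((+) c))"
        unfolding \<Psi>_def lborel_distr_plus ..
      also have "\<dots> = (\<integral>\<^sup>+z. g (c + z) * weight_rat A s f (c + z) (R \<omega>) \<partial>lborel)"
        using \<open>R \<omega> \<in> space path_algebra\<close>
        by (intro nn_integral_distr borel_measurable_times_ennreal measurable_weight_rat[OF _ _ _ A]) measurable
      also have "\<dots> = (\<integral>\<^sup>+z. f z * weight A s g z (\<lambda>t. X t \<omega>) \<partial>lborel)"
        unfolding shift weight_def by (intro nn_integral_cong) (auto simp: c_def add.commute mult_ac)
      finally show "\<Psi> (R \<omega>) = (\<integral>\<^sup>+z. f z * weight A s g z (\<lambda>t. X t \<omega>) \<partial>lborel)" .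
    qed
  qed
  finally show ?thesis unfolding swap[OF g f] .
qed

end

section \<open>Quasi-left-continuity\<close>

text \<open>Fatou's lemma for events: the union is the limit inferior of the
  \<open>A n\<close>.\<close>

lemma emeasure_eventually_le:
  fixes A :: "nat \<Rightarrow> 'a set"
  assumes [measurable]: "\<And>n. A n \<in> sets M" and le: "\<And>n. emeasure M (A n) \<le> c"
  shows "emeasure M (\<Union>N. \<Inter>n\<in>{N..}. A n) \<le> c"
proof -
  have "emeasure M (\<Union>N. \<Inter>n\<in>{N..}. A n) = (SUP N. emeasure M (\<Inter>n\<in>{N..}. A n))"
    by (rule SUP_emeasure_incseq[symmetric]) (auto simp: incseq_def)
  also have "\<dots> \<le> c"
  proof (rule SUP_least)
    fix N
    have "emeasure M (\<Inter>n\<in>{N..}. A n) \<le> emeasure M (A N)" by (rule emeasure_mono) auto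
    also have "\<dots> \<le> c" by (rule le)
    finally show "emeasure M (\<Inter>n\<in>{N..}. A n) \<le> c" .
  qed
  finally show ?thesis .
qed

text \<open>A closed exhaustion of an open set. The distance to the empty set is 0 by convention, so
  for \<open>D = UNIV\<close> all these sets are empty; hence the exclusion of that case
  below.\<close>

definition inner_sets :: "'v::metric_space set \<Rightarrow> nat \<Rightarrow> 'v set" where
  "inner_sets D n = {y. inverse (real (Suc n)) \<le> infdist y (- D)}"

lemma closed_inner_sets: "closed (inner_sets D n)"
  unfolding inner_sets_def by (intro closed_Collect_le continuous_intros)

lemma incseq_inner_sets: "incseq (inner_sets D)"
proof (rule incseq_SucI, rule subsetI)
  fix n y assume "y \<in> inner_sets D n"
  moreover have "inverse (real (Suc (Suc n))) \<le> inverse (real (Suc n))" by (intro le_imp_inverse_le) auto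
  ultimately show "y \<in> inner_sets D (Suc n)" unfolding inner_sets_def mem_Collect_eq by (metis order.trans)
qed

lemma inner_sets_subset: "inner_sets D n \<subseteq> D"
proof
  fix y assume "y \<in> inner_sets D n"
  then have "0 < infdist y (- D)" unfolding inner_sets_def by (auto intro: less_le_trans[rotated])
  then show "y \<in> D" by (cases "y \<in> D") auto
qed

text \<open>The process cannot jump back from the boundary: at the time \<open>\<sigma>\<close> at which the
  distance of the past path to the complement of \<open>D\<close> first becomes \<open>0\<close> while \<open>X\<^sub>\<sigma>\<close> lies in \<open>D\<close>,
  there is a jump of fixed size within an arbitrarily short time after the first exit of the grid
  walk from an inner set, which by the Markov property has arbitrarily small probability.\<close>

lemma (in sym_levy) stays_inner:
  assumes D: "open D" "D \<noteq> UNIV" and s: "0 \<le> s"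
  shows "AE \<omega> in M. (\<forall>r\<in>{0..s}. x + X r \<omega> \<in> D) \<longrightarrow> stays (inner_sets D) x s (\<lambda>t. X t \<omega>)"
proof -
  define d where "d y = infdist y (- D)" for y
  define K where "K = inner_sets D"
  have K: "y \<in> K n \<longleftrightarrow> inverse (real (Suc n)) \<le> d y" for n y by (auto simp: K_def inner_sets_def d_def)
  have [measurable]: "K n \<in> sets borel" for n by (simp add: K_def borel_closed closed_inner_sets)
  have cont_d: "continuous_on UNIV d" unfolding d_def by (intro continuous_intros)
  have d_pos: "d y > 0 \<longleftrightarrow> y \<in> D" for y
    using D in_closed_iff_infdist_zero[of "- D" y] infdist_nonneg[of y "-D"] unfolding d_def
    by (auto simp: less_le)
  have d_lip: "d y \<le> d z + dist y z" for y z unfolding d_def by (rule infdist_triangle)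
  have countQ: "countable (\<rat> \<inter> {0<..<a} :: real set)" for a using countable_rat by blast
  \<comment> \<open>The first exit of the grid walk from \<open>K n\<close>, a large displacement
    shortly after it, and the same displacement counted from time 0. Rational lags keep the events
    measurable and suffice by right-continuity.\<close>
  define Ex where "Ex n k j = {\<omega> \<in> space M. (\<forall>i<j. x + X (real i / 2 ^ k) \<omega> \<in> K n) \<and> x + X (real j / 2 ^ k) \<omega> \<notin> K n}"
    for n k j :: nat
  define Fu where "Fu k m l j = {\<omega> \<in> space M. \<exists>u\<in>\<rat> \<inter> {0<..<inverse (real (Suc m))}.
      inverse (real (Suc l)) < norm (X (real j / 2 ^ k + u) \<omega> - X (real j / 2 ^ k) \<omega>)}" for k m l j :: nat
  define P where "P m l = {\<omega> \<in> space M. \<exists>u\<in>\<rat> \<inter> {0<..<inverse (real (Suc m))}.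
      inverse (real (Suc l)) < norm (X u \<omega>)}" for m l :: nat
  define A where "A m l n k = (\<Union>j. Ex n k j \<inter> Fu k m l j)" for m l n k
  have [measurable]: "Ex n k j \<in> sets M" for n k j unfolding Ex_def by measurable
  have [measurable]: "Fu k m l j \<in> sets M" for k m l j unfolding Fu_def using countQ by measurable
  have [measurable]: "P m l \<in> sets M" for m l unfolding P_def using countQ by measurable
  have [measurable]: "A m l n k \<in> sets M" for m l n k unfolding A_def by measurable
  \<comment> \<open>Markov property at the fixed time \<open>real j / 2 ^ k\<close>: one event is
    decided by grid times up to it, the other by the increments after it.\<close>
  have prod: "emeasure M (Ex n k j \<inter> Fu k m l j) = emeasure M (Ex n k j) * emeasure M (P m l)" for n k m l j
  proof -
    define a where "a = real j / 2 ^ k"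
    have a: "0 \<le> a" by (simp add: a_def)
    define \<Phi> where "\<Phi> p = (if (\<forall>i<j. x + p (real i / 2 ^ k) \<in> K n) \<and> x + p a \<notin> K n \<and>
       (\<exists>u\<in>\<rat> \<inter> {0<..<inverse (real (Suc m))}. inverse (real (Suc l)) < norm (p (a + u) - p a)) then 1 else 0 :: ennreal)"
      for p :: "real \<Rightarrow> 'v"
    have [measurable]: "(\<lambda>p. p r) \<in> borel_measurable path_algebra" for r :: real
      by (rule measurable_path_component) measurable
    have \<Phi>: "\<Phi> \<in> borel_measurable path_algebra" unfolding \<Phi>_def using countQ by measurable
    have "emeasure M (Ex n k j \<inter> Fu k m l j) = (\<integral>\<^sup>+\<omega>. \<Phi> (\<lambda>t. X t \<omega>) \<partial>M)"
    proof -
      have "indicator (Ex n k j \<inter> Fu k m l j) \<omega> = \<Phi> (\<lambda>t. X t \<omega>)" if "\<omega> \<in> space M" for \<omega>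
        by (simp only: \<Phi>_def Ex_def Fu_def a_def indicator_def of_bool_def Int_iff mem_Collect_eq that simp_thms conj_assoc)
      then have "(\<integral>\<^sup>+\<omega>. \<Phi> (\<lambda>t. X t \<omega>) \<partial>M) = (\<integral>\<^sup>+\<omega>. indicator (Ex n k j \<inter> Fu k m l j) \<omega> \<partial>M)"
        by (intro nn_integral_cong) simp
      then show ?thesis by simp
    qed
    also have "\<dots> = (\<integral>\<^sup>+\<omega>. \<integral>\<^sup>+\<omega>'. \<Phi> (\<lambda>t. X (min t a) \<omega> + X (t - a) \<omega>') \<partial>M \<partial>M)"
      by (rule nn_integral_splice[OF a \<Phi>])
    also have "\<dots> = (\<integral>\<^sup>+\<omega>. \<integral>\<^sup>+\<omega>'. indicator (Ex n k j) \<omega> * indicator (P m l) \<omega>' \<partial>M \<partial>M)"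
    proof (intro nn_integral_cong)
      fix \<omega> \<omega>' assume \<omega>: "\<omega> \<in> space M" "\<omega>' \<in> space M"
      have 1: "X (min (real i / 2 ^ k) a) \<omega> + X (real i / 2 ^ k - a) \<omega>' = X (real i / 2 ^ k) \<omega>" if "i < j" for i
      proof -
        have "real i / 2 ^ k \<le> a" using that by (simp add: a_def divide_right_mono)
        then show ?thesis by (simp add: X_nonpos)
      qed
      have 2: "X (min (a + u) a) \<omega> + X (a + u - a) \<omega>' - (X (min a a) \<omega> + X (a - a) \<omega>') = X u \<omega>'"
        if "u \<in> \<rat> \<inter> {0<..<inverse (real (Suc m))}" for u using that by (simp add: X_nonpos)
      have 3: "X (min a a) \<omega> + X (a - a) \<omega>' = X a \<omega>" by (simp add: X_nonpos)
      show "\<Phi> (\<lambda>t. X (min t a) \<omega> + X (t - a) \<omega>') = indicator (Ex n k j) \<omega> * indicator (P m l) \<omega>'"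
      proof -
        have 4: "(\<forall>i<j. x + (X (min (real i / 2 ^ k) a) \<omega> + X (real i / 2 ^ k - a) \<omega>') \<in> K n) \<longleftrightarrow>
            (\<forall>i<j. x + X (real i / 2 ^ k) \<omega> \<in> K n)"
          using 1 by metis
        have 5: "(\<exists>u\<in>\<rat> \<inter> {0<..<inverse (real (Suc m))}. inverse (real (Suc l)) <
              norm (X (min (a + u) a) \<omega> + X (a + u - a) \<omega>' - (X (min a a) \<omega> + X (a - a) \<omega>'))) \<longleftrightarrow>
            (\<exists>u\<in>\<rat> \<inter> {0<..<inverse (real (Suc m))}. inverse (real (Suc l)) < norm (X u \<omega>'))"
          using 2 by (intro bex_cong refl) metis
        have "(\<omega> \<in> Ex n k j) \<longleftrightarrow> (\<forall>i<j. x + X (real i / 2 ^ k) \<omega> \<in> K n) \<and> x + X a \<omega> \<notin> K n"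
          using \<omega> unfolding Ex_def a_def by blast
        moreover have "(\<omega>' \<in> P m l) \<longleftrightarrow> (\<exists>u\<in>\<rat> \<inter> {0<..<inverse (real (Suc m))}. inverse (real (Suc l)) < norm (X u \<omega>'))"
          using \<omega> unfolding P_def by blast
        ultimately show ?thesis unfolding \<Phi>_def 4 5 3 indicator_def by simp
      qed
    qed
    also have "\<dots> = emeasure M (Ex n k j) * emeasure M (P m l)"
      by (simp add: nn_integral_cmult nn_integral_multc)
    finally show ?thesis .
  qed
  have A_le: "emeasure M (A m l n k) \<le> emeasure M (P m l)" for m l n k
  proof -
    \<comment> \<open>A walk has at most one first exit index, so the probabilities of the
      \<open>Ex n k j\<close> add up to at most 1.\<close>
    have disj: "disjoint_family (Ex n k)"
      unfolding disjoint_family_on_def Ex_def by (auto, metis linorder_neqE_nat)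
    have "emeasure M (A m l n k) \<le> (\<Sum>j. emeasure M (Ex n k j \<inter> Fu k m l j))"
      unfolding A_def by (rule emeasure_subadditive_countably) auto
    also have "\<dots> = (\<Sum>j. emeasure M (Ex n k j)) * emeasure M (P m l)" by (simp add: prod)
    also have "(\<Sum>j. emeasure M (Ex n k j)) = emeasure M (\<Union>j. Ex n k j)"
      by (rule suminf_emeasure) (use disj in auto)
    also have "\<dots> * emeasure M (P m l) \<le> 1 * emeasure M (P m l)"
      by (intro mult_right_mono emeasure_le_1) auto
    finally show ?thesis by simp
  qed
  have P_lim: "(\<lambda>m. emeasure M (P m l)) \<longlonglongrightarrow> 0" for l
  proof -
    have "decseq (\<lambda>m. P m l)"
    proof (rule decseq_SucI)
      fix m
      have "inverse (real (Suc (Suc m))) \<le> inverse (real (Suc m))" by (intro le_imp_inverse_le) auto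
      then show "P (Suc m) l \<subseteq> P m l" unfolding P_def by (fastforce intro: less_le_trans)
    qed
    then have "(\<lambda>m. emeasure M (P m l)) \<longlonglongrightarrow> emeasure M (\<Inter>m. P m l)"
      by (intro Lim_emeasure_decseq) auto
    \<comment> \<open>A displacement of fixed size at arbitrarily small times contradicts
      right-continuity at 0.\<close>
    moreover have "(\<Inter>m. P m l) = {}"
    proof (rule ccontr)
      assume "(\<Inter>m. P m l) \<noteq> {}"
      then obtain \<omega> where \<omega>: "\<And>m. \<omega> \<in> P m l" by blast
      have "0 + X 0 \<omega> \<in> ball 0 (inverse (real (Suc l)))" by (simp add: X_nonpos)
      then obtain b where b: "b > 0" "\<And>r. 0 \<le> r \<Longrightarrow> r < b \<Longrightarrow> 0 + X r \<omega> \<in> ball 0 (inverse (real (Suc l)))"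
        using rcont_open[OF X_rcont[of \<omega>] open_ball] by blast
      obtain m where "inverse (real (Suc m)) < b" using reals_Archimedean[OF b(1)] by auto
      moreover obtain u where "0 < u" "u < inverse (real (Suc m))" "inverse (real (Suc l)) < norm (X u \<omega>)"
        using \<omega>[of m] unfolding P_def by auto
      ultimately show False using b(2)[of u] by (simp add: less_imp_le)
    qed
    ultimately show ?thesis by simp
  qed
  \<comment> \<open>The order matters: the size \<open>l\<close> is fixed before the time window
    \<open>m\<close> shrinks, while \<open>n\<close> and \<open>k\<close> need only be large. The
    two nested limits inferior then stay below the probability of \<open>P m l\<close> for each
    \<open>m\<close>.\<close>
  define Bad where "Bad = (\<Union>l. \<Inter>m. \<Union>N. \<Inter>n\<in>{N..}. \<Union>k0. \<Inter>k\<in>{k0..}. A m l n k)"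
  have [measurable]: "(\<Union>k0. \<Inter>k\<in>{k0..}. A m l n k) \<in> sets M" for m l n by measurable
  have [measurable]: "(\<Union>N. \<Inter>n\<in>{N..}. \<Union>k0. \<Inter>k\<in>{k0..}. A m l n k) \<in> sets M" for m l by measurable
  have "Bad \<in> null_sets M"
    unfolding Bad_def
  proof (rule null_sets_UN)
    fix l :: nat
    have "emeasure M (\<Inter>m. \<Union>N. \<Inter>n\<in>{N..}. \<Union>k0. \<Inter>k\<in>{k0..}. A m l n k) \<le> emeasure M (P m l)" for m
    proof -
      have "emeasure M (\<Inter>m. \<Union>N. \<Inter>n\<in>{N..}. \<Union>k0. \<Inter>k\<in>{k0..}. A m l n k) \<le>
          emeasure M (\<Union>N. \<Inter>n\<in>{N..}. \<Union>k0. \<Inter>k\<in>{k0..}. A m l n k)" by (rule emeasure_mono) auto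
      also have "\<dots> \<le> emeasure M (P m l)" by (intro emeasure_eventually_le A_le) auto
      finally show ?thesis .
    qed
    then have "emeasure M (\<Inter>m. \<Union>N. \<Inter>n\<in>{N..}. \<Union>k0. \<Inter>k\<in>{k0..}. A m l n k) \<le> 0"
      by (intro LIMSEQ_le_const[OF P_lim[of l]]) auto
    then show "(\<Inter>m. \<Union>N. \<Inter>n\<in>{N..}. \<Union>k0. \<Inter>k\<in>{k0..}. A m l n k) \<in> null_sets M"
      by (intro null_setsI) auto
  qed
  moreover have "{\<omega> \<in> space M. \<not> ((\<forall>r\<in>{0..s}. x + X r \<omega> \<in> D) \<longrightarrow> stays K x s (\<lambda>t. X t \<omega>))} \<subseteq> Bad"
  proof
    fix \<omega> assume "\<omega> \<in> {\<omega> \<in> space M. \<not> ((\<forall>r\<in>{0..s}. x + X r \<omega> \<in> D) \<longrightarrow> stays K x s (\<lambda>t. X t \<omega>))}"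
    then have \<omega>: "\<omega> \<in> space M" and inD: "\<And>r. 0 \<le> r \<Longrightarrow> r \<le> s \<Longrightarrow> x + X r \<omega> \<in> D"
      and out: "\<And>n. \<exists>r\<in>{0..s}. x + X r \<omega> \<notin> K n" by (auto simp: stays_def)
    define S where "S n = {r. 0 \<le> r \<and> x + X r \<omega> \<notin> K n}" for n
    define \<sigma>n where "\<sigma>n n = Inf (S n)" for n
    have bddS: "bdd_below (S n)" for n by (rule bdd_belowI[of _ 0]) (auto simp: S_def)
    have S_ne: "S n \<noteq> {}" for n using out[of n] by (auto simp: S_def)
    have \<sigma>n_s: "\<sigma>n n \<le> s" for n
    proof -
      obtain r where "r \<in> {0..s}" "x + X r \<omega> \<notin> K n" using out by blast
      then show ?thesis unfolding \<sigma>n_def by (intro cInf_lower2[OF _ _ bddS]) (auto simp: S_def)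
    qed
    have \<sigma>n0: "0 \<le> \<sigma>n n" for n unfolding \<sigma>n_def by (rule cInf_greatest[OF S_ne]) (auto simp: S_def)
    have inc: "incseq \<sigma>n"
    proof (rule incseq_SucI)
      fix n
      have "S (Suc n) \<subseteq> S n" using incseq_SucD[OF incseq_inner_sets[of D]] by (auto simp: S_def K_def)
      then show "\<sigma>n n \<le> \<sigma>n (Suc n)" unfolding \<sigma>n_def by (intro cInf_superset_mono S_ne bddS)
    qed
    have bddR: "bdd_above (range \<sigma>n)" by (rule bdd_aboveI[of _ s]) (use \<sigma>n_s in auto)
    define \<sigma> where "\<sigma> = (SUP n. \<sigma>n n)"
    have lim: "\<sigma>n \<longlonglongrightarrow> \<sigma>" unfolding \<sigma>_def by (rule LIMSEQ_incseq_SUP[OF bddR inc])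
    have \<sigma>_ge: "\<sigma>n n \<le> \<sigma>" for n unfolding \<sigma>_def by (rule cSUP_upper[OF _ bddR]) auto
    have \<sigma>: "0 \<le> \<sigma>" "\<sigma> \<le> s" using \<sigma>_ge[of 0] \<sigma>n0[of 0] \<sigma>n_s
      by (auto simp: \<sigma>_def intro!: cSUP_least order.trans[OF \<sigma>n0[of 0]])
    \<comment> \<open>Half of the distance at time \<open>\<sigma>\<close>: a point that is closer
      than \<open>e\<close> to the complement of \<open>D\<close> is more than \<open>e\<close> away
      from \<open>x + X \<sigma> \<omega>\<close>.\<close>
    define e where "e = d (x + X \<sigma> \<omega>) / 2"
    have e: "e > 0" using d_pos inD[OF \<sigma>] by (simp add: e_def)
    obtain l where l: "inverse (real (Suc l)) < e" using reals_Archimedean[OF e] by auto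
    have "\<omega> \<in> (\<Union>N. \<Inter>n\<in>{N..}. \<Union>k0. \<Inter>k\<in>{k0..}. A m l n k)" for m
    proof -
      have "eventually (\<lambda>n. \<sigma> - inverse (real (Suc m)) < \<sigma>n n) sequentially"
        by (rule order_tendstoD(1)[OF lim]) simp
      moreover have "eventually (\<lambda>n. inverse (real (Suc n)) < e) sequentially"
        by (rule order_tendstoD(2)[OF LIMSEQ_inverse_real_of_nat e])
      ultimately have "eventually (\<lambda>n. \<sigma> - inverse (real (Suc m)) < \<sigma>n n \<and> inverse (real (Suc n)) < e) sequentially"
        by (rule eventually_conj)
      then obtain N where N: "\<And>n. n \<ge> N \<Longrightarrow> \<sigma> - inverse (real (Suc m)) < \<sigma>n n"
          "\<And>n. n \<ge> N \<Longrightarrow> inverse (real (Suc n)) < e"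
        unfolding eventually_sequentially by blast
      have "\<omega> \<in> (\<Union>k0. \<Inter>k\<in>{k0..}. A m l n k)" if n: "n \<ge> N" for n
      proof -
        have Sd: "d (x + X r \<omega>) < e" if "r \<in> S n" for r
          using that N(2)[OF n] K[of "x + X r \<omega>" n] by (auto simp: S_def)
        have "open {y. e < d y}" using cont_d by (intro open_Collect_less) auto
        moreover have "x + X \<sigma> \<omega> \<in> {y. e < d y}" using e by (simp add: e_def)
        ultimately obtain b where b: "b > \<sigma>" "\<And>r. \<sigma> \<le> r \<Longrightarrow> r < b \<Longrightarrow> x + X r \<omega> \<in> {y. e < d y}"
          using rcont_open[OF X_rcont[of \<omega>]] by blast
        obtain r where r: "r \<in> S n" "r < b"
          using b(1) \<sigma>_ge[of n] S_ne bddS unfolding \<sigma>n_def by (metis cInf_less_iff le_less_trans)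
        \<comment> \<open>From \<open>\<sigma>\<close> until \<open>b\<close> the path is further
          than \<open>e\<close> from the complement, so a time before \<open>b\<close> at which it
          is outside \<open>K n\<close> must precede \<open>\<sigma>\<close>.\<close>
        have r\<sigma>: "r < \<sigma>" using Sd[OF r(1)] b(2)[of r] r(2) by (cases "r < \<sigma>") auto
        have "open (- K n)" using closed_inner_sets by (auto simp: K_def)
        moreover have "x + X r \<omega> \<in> - K n" using r(1) by (simp add: S_def)
        ultimately obtain b' where b': "b' > r" "\<And>r'. r \<le> r' \<Longrightarrow> r' < b' \<Longrightarrow> x + X r' \<omega> \<in> - K n"
          using rcont_open[OF X_rcont[of \<omega>]] by blast
        define c where "c = min b' \<sigma> - r"
        have c: "c > 0" using b'(1) r\<sigma> by (simp add: c_def)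
        have "(\<lambda>k. (1/2::real) ^ k) \<longlonglongrightarrow> 0" by (rule LIMSEQ_power_zero) auto
        from order_tendstoD(2)[OF this c] obtain k0 where k0: "\<And>k. k \<ge> k0 \<Longrightarrow> (1/2) ^ k < c"
          unfolding eventually_sequentially by auto
        have "\<omega> \<in> A m l n k" if k: "k \<ge> k0" for k
        proof -
          have r0: "0 \<le> r" using r(1) by (simp add: S_def)
          define j' where "j' = nat (\<lfloor>2 ^ k * r\<rfloor> + 1)"
          have "0 \<le> \<lfloor>2 ^ k * r\<rfloor>" using r0 by simp
          then have j'_eq: "real j' / 2 ^ k = (of_int \<lfloor>2 ^ k * r\<rfloor> + 1) / 2 ^ k" unfolding j'_def by simp
          have "r < real j' / 2 ^ k" "real j' / 2 ^ k \<le> r + (1/2) ^ k"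
            unfolding j'_eq by (rule dyadic_above)+
          then have j': "r \<le> real j' / 2 ^ k" "real j' / 2 ^ k < b'" "real j' / 2 ^ k < \<sigma>"
            using k0[OF k] by (auto simp: c_def)
          \<comment> \<open>The first grid exit need not be close to \<open>r\<close>. It lies
            between \<open>\<sigma>n n\<close> and \<open>\<sigma>\<close>, and this already places
            it within \<open>inverse (real (Suc m))\<close> of \<open>\<sigma>\<close>.\<close>
          define j where "j = (LEAST j. x + X (real j / 2 ^ k) \<omega> \<notin> K n)"
          have "x + X (real j' / 2 ^ k) \<omega> \<notin> K n" using b'(2)[OF j'(1,2)] by simp
          then have j: "x + X (real j / 2 ^ k) \<omega> \<notin> K n" "j \<le> j'" "\<And>i. i < j \<Longrightarrow> x + X (real i / 2 ^ k) \<omega> \<in> K n"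
            using LeastI[of "\<lambda>j. x + X (real j / 2 ^ k) \<omega> \<notin> K n" j'] Least_le[of "\<lambda>j. x + X (real j / 2 ^ k) \<omega> \<notin> K n" j']
              not_less_Least[of _ "\<lambda>j. x + X (real j / 2 ^ k) \<omega> \<notin> K n"]
            unfolding j_def by blast+
          define a where "a = real j / 2 ^ k"
          have "a \<le> real j' / 2 ^ k" using j(2) by (simp add: a_def divide_right_mono)
          then have a\<sigma>: "a < \<sigma>" using j'(3) by simp
          have aS: "a \<in> S n" using j(1) by (simp add: S_def a_def)
          then have "\<sigma>n n \<le> a" unfolding \<sigma>n_def by (rule cInf_lower[OF _ bddS])
          then have am: "\<sigma> - a < inverse (real (Suc m))" using N(1)[OF n] by simp
          have "2 * e \<le> d (x + X a \<omega>) + dist (x + X \<sigma> \<omega>) (x + X a \<omega>)"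
            using d_lip[of "x + X \<sigma> \<omega>" "x + X a \<omega>"] by (simp add: e_def)
          then have "inverse (real (Suc l)) < norm (X \<sigma> \<omega> - X a \<omega>)"
            using Sd[OF aS] l by (simp add: dist_norm)
          then have "- X a \<omega> + X \<sigma> \<omega> \<in> {y. inverse (real (Suc l)) < norm y}" by simp
          moreover have "open {y :: 'v. inverse (real (Suc l)) < norm y}"
            by (intro open_Collect_less continuous_intros)
          ultimately obtain b'' where b'': "b'' > \<sigma>"
              "\<And>r. \<sigma> \<le> r \<Longrightarrow> r < b'' \<Longrightarrow> - X a \<omega> + X r \<omega> \<in> {y. inverse (real (Suc l)) < norm y}"
            using rcont_open[OF X_rcont[of \<omega>]] by blast
          \<comment> \<open>The displacement is present at time \<open>\<sigma>\<close>;
            right-continuity there moves it to a rational lag \<open>u\<close> slightly larger than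
            \<open>\<sigma> - a\<close>.\<close>
          have "\<sigma> - a < min (b'' - a) (inverse (real (Suc m)))" using am b''(1) by simp
          then obtain u where u: "u \<in> \<rat>" "\<sigma> - a < u" "u < min (b'' - a) (inverse (real (Suc m)))"
            using Rats_dense_in_real by blast
          have "\<omega> \<in> Fu k m l j"
            unfolding Fu_def a_def[symmetric] using u a\<sigma> \<omega> b''(2)[of "a + u"]
            by (auto intro!: bexI[of _ u] simp: add.commute)
          moreover have "\<omega> \<in> Ex n k j" unfolding Ex_def using j \<omega> by simp
          ultimately show ?thesis unfolding A_def by blast
        qed
        then show ?thesis by blast
      qed
      then show ?thesis by blast
    qed
    then show "\<omega> \<in> Bad" unfolding Bad_def by blast
  qed
  ultimately show ?thesis unfolding K_def by (rule AE_I')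
qed

section \<open>Extinction of the semigroup killed in the ball\<close>

lemma nn_integral_le_imp_AE_eq:
  assumes [measurable]: "f \<in> borel_measurable M" "g \<in> borel_measurable M"
    and le: "\<And>x. f x \<le> g x" and int: "(\<integral>\<^sup>+x. g x \<partial>M) \<le> (\<integral>\<^sup>+x. f x \<partial>M)" and fin: "(\<integral>\<^sup>+x. f x \<partial>M) < \<infinity>"
  shows "AE x in M. f x = g x"
proof -
  have "(\<integral>\<^sup>+x. g x - f x \<partial>M) = (\<integral>\<^sup>+x. g x \<partial>M) - (\<integral>\<^sup>+x. f x \<partial>M)"
    using le fin by (intro nn_integral_diff) auto
  also have "\<dots> = 0" using int fin by (auto simp: diff_eq_0_iff_ennreal intro: le_less_trans)
  finally have "AE x in M. g x - f x = 0" by (subst (asm) nn_integral_0_iff_AE) auto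
  moreover have "AE x in M. f x \<noteq> \<infinity>" using fin by (intro nn_integral_noteq_infinite) auto
  ultimately show ?thesis
  proof eventually_elim
    fix x assume "g x - f x = 0" "f x \<noteq> \<infinity>"
    then show "f x = g x" using le[of x] by (metis add.right_neutral diff_add_cancel_ennreal add.commute)
  qed
qed

context feynman_kac_levy
begin

section \<open>Order and null sets under the semigroups\<close>

lemma weight_mono: "(\<And>y. f y \<le> g y) \<Longrightarrow> weight A s f x p \<le> weight A s g x p"
  unfolding weight_def by (auto intro: mult_left_mono)

lemma semigroup_mono: "(\<And>y. f y \<le> g y) \<Longrightarrow> semigroup A s f x \<le> semigroup A s g x"
  unfolding semigroup_def by (intro nn_integral_mono weight_mono) auto

lemma weight_mono_sets: "(\<And>n. A n \<subseteq> A' n) \<Longrightarrow> weight A s f x p \<le> weight A' s f x p"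
  unfolding weight_def stays_def by (auto, blast)

lemma semigroup_mono_sets: "(\<And>n. A n \<subseteq> A' n) \<Longrightarrow> semigroup A s f x \<le> semigroup A' s f x"
  unfolding semigroup_def by (intro nn_integral_mono weight_mono_sets) auto

lemma semigroup_cmult:
  assumes [measurable]: "f \<in> borel_measurable borel" and A: "\<And>n. closed (A n)" and s: "0 \<le> s"
  shows "semigroup A s (\<lambda>y. c * f y) x = c * semigroup A s f x"
proof -
  have "(\<lambda>\<omega>. weight A s f x (\<lambda>t. X t \<omega>)) \<in> borel_measurable M"
    using A s by (intro measurable_weight) auto
  then show ?thesis unfolding semigroup_def
    by (subst nn_integral_cmult[symmetric]) (auto intro!: nn_integral_cong simp: weight_def mult_ac)
qed

lemma not_stays: "(\<And>n. x \<notin> A n) \<Longrightarrow> 0 \<le> s \<Longrightarrow> \<not> stays A x s (\<lambda>t. X t \<omega>)"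
  unfolding stays_def by (auto intro!: bexI[of _ 0] simp: X_nonpos)

lemma semigroup_outside: "(\<And>n. x \<notin> A n) \<Longrightarrow> 0 \<le> s \<Longrightarrow> semigroup A s f x = 0"
  unfolding semigroup_def weight_def by (simp add: not_stays)

lemma AE_not_in_null:
  assumes "N \<in> null_sets lborel" "0 < s"
  shows "AE \<omega> in M. x + X s \<omega> \<notin> N"
proof -
  have [measurable]: "N \<in> sets borel" using assms(1) by auto
  have m: "{y. x + y \<in> N} \<in> sets borel" by measurable
  have "emeasure lborel {y. x + y \<in> N} = emeasure (distr lborel borel ((+) x)) N"
    by (subst emeasure_distr) (auto simp: vimage_def)
  then have "{y. x + y \<in> N} \<in> null_sets lborel" using assms(1) m by (intro null_setsI) (auto simp: lborel_distr_plus)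
  from X_ac[OF assms(2) this] have "emeasure M {\<omega> \<in> space M. x + X s \<omega> \<in> N} = 0"
    by (subst (asm) emeasure_distr) (use m in \<open>auto simp: vimage_def Int_def conj_commute\<close>)
  then show ?thesis by (intro AE_I[where N="{\<omega> \<in> space M. x + X s \<omega> \<in> N}"]) auto
qed

text \<open>Absolute continuity of the law of \<open>X s\<close> turns an almost everywhere
  statement about \<open>f\<close> into a statement about every starting point.\<close>

lemma semigroup_null:
  assumes [measurable]: "f \<in> borel_measurable borel" and f: "AE y in lborel. f y = 0" and s: "0 < s"
  shows "semigroup A s f x = 0"
proof -
  have "{y. f y \<noteq> 0} \<in> null_sets lborel"
  proof -
    have "{y. f y \<noteq> 0} \<in> sets lborel" by measurable
    then show ?thesis using f by (subst AE_iff_null_sets) auto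
  qed
  from AE_not_in_null[OF this s] have "AE \<omega> in M. weight A s f x (\<lambda>t. X t \<omega>) = 0"
    by eventually_elim (auto simp: weight_def)
  then show ?thesis unfolding semigroup_def by (simp add: nn_integral_0_iff_AE cong: nn_integral_cong_AE)
qed

lemma semigroup_bounded:
  assumes f: "\<And>y. f y \<le> ennreal K" and s: "0 \<le> s"
  shows "semigroup A s f x < \<infinity>"
proof -
  have "semigroup A s f x \<le> (\<integral>\<^sup>+\<omega>. ennreal (exp (C * s)) * ennreal K \<partial>M)"
    unfolding semigroup_def
  proof (rule nn_integral_mono)
    fix \<omega>
    have "- pot x s (\<lambda>t. X t \<omega>) \<le> C * s"
      using pot_bound[OF rcont_measurable[OF X_rcont[of \<omega>]] s, of x] by linarith
    then show "weight A s f x (\<lambda>t. X t \<omega>) \<le> ennreal (exp (C * s)) * ennreal K"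
      unfolding weight_def by (auto intro!: mult_mono f ennreal_leI)
  qed
  also have "\<dots> < \<infinity>" by (simp add: emeasure_space_1 ennreal_mult_less_top)
  finally show ?thesis .
qed

end

text \<open>An interface that speaks of the semigroup only. Simplicity is asked for functions
  between 0 and \<open>\<phi>\<close>, the range of the limit to which it will be applied; such
  functions are bounded and vanish outside \<open>D\<close>, hence are square integrable.\<close>

locale ground_state = feynman_kac_levy M X V C
  for M :: "'w measure" and X :: "real \<Rightarrow> 'w \<Rightarrow> 'v::euclidean_space" and V C +
  fixes D :: "'v set" and \<phi> :: "'v \<Rightarrow> real" and lam :: real
  assumes D: "open D" "bounded D"
    and \<phi>_cont: "continuous_on UNIV \<phi>" and \<phi>_out: "\<And>x. x \<notin> D \<Longrightarrow> \<phi> x = 0" and \<phi>_pos: "\<And>x. x \<in> D \<Longrightarrow> 0 < \<phi> x"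
    and \<phi>_eigen: "\<And>t x. 0 < t \<Longrightarrow> x \<in> D \<Longrightarrow> semigroup (inner_sets D) t (\<lambda>y. ennreal (\<phi> y)) x = ennreal (exp (- lam * t) * \<phi> x)"
    and simple: "\<And>u. u \<in> borel_measurable borel \<Longrightarrow> (\<And>x. 0 \<le> u x) \<Longrightarrow> (\<And>x. u x \<le> \<phi> x) \<Longrightarrow>
       (\<And>t. 0 < t \<Longrightarrow> AE x in lborel. x \<in> D \<longrightarrow>
          semigroup (inner_sets D) t (\<lambda>y. ennreal (u y)) x = ennreal (exp (- lam * t) * u x)) \<Longrightarrow>
       \<exists>c. AE x in lborel. x \<in> D \<longrightarrow> u x = c * \<phi> x"
begin

abbreviation "T \<equiv> semigroup (inner_sets D)"

lemma \<phi>_nonneg: "0 \<le> \<phi> x"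
  using \<phi>_out[of x] \<phi>_pos[of x] by (cases "x \<in> D") auto

lemma \<phi>_meas [measurable]: "\<phi> \<in> borel_measurable borel"
  using \<phi>_cont by (rule borel_measurable_continuous_onI)

lemma \<phi>_bounded: obtains K where "0 \<le> K" "\<And>y. \<phi> y \<le> K"
proof -
  have "compact (\<phi> ` closure D)"
    using D by (intro compact_continuous_image continuous_on_subset[OF \<phi>_cont]) (auto simp: compact_closure)
  then obtain K where K: "\<And>y. y \<in> closure D \<Longrightarrow> norm (\<phi> y) \<le> K"
    using compact_imp_bounded bounded_iff by (metis imageI)
  have "\<phi> y \<le> max K 0" for y
    using K[of y] \<phi>_out[of y] closure_subset[of D] by (cases "y \<in> D") force+
  then show ?thesis using that[of "max K 0"] by auto
qed

lemma T_\<phi>: "0 < t \<Longrightarrow> ennreal (exp (lam * t)) * T t (\<lambda>y. ennreal (\<phi> y)) x = ennreal (\<phi> x)"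
proof (cases "x \<in> D")
  case True
  assume t: "0 < t"
  have "exp (lam * t) * (exp (- (lam * t)) * \<phi> x) = \<phi> x" by (simp add: exp_minus)
  then show ?thesis using \<phi>_eigen[OF t True] \<phi>_nonneg[of x] by (simp add: ennreal_mult[symmetric])
next
  case False
  assume t: "0 < t"
  have "T t (\<lambda>y. ennreal (\<phi> y)) x = 0"
    using False inner_sets_subset[of D] t by (intro semigroup_outside) auto
  then show ?thesis using \<phi>_out[OF False] by simp
qed

lemma T_\<phi>_le: "0 \<le> t \<Longrightarrow> ennreal (exp (lam * t)) * T t (\<lambda>y. ennreal (\<phi> y)) x \<le> ennreal (\<phi> x)"
proof (cases "t = 0")
  case True
  have "T 0 (\<lambda>y. ennreal (\<phi> y)) x \<le> (\<integral>\<^sup>+\<omega>. ennreal (\<phi> x) \<partial>M)"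
    unfolding semigroup_def
  proof (rule nn_integral_mono)
    fix \<omega>
    have "\<bar>pot x 0 (\<lambda>t. X t \<omega>)\<bar> \<le> C * 0" by (rule pot_bound[OF rcont_measurable[OF X_rcont]]) simp
    then show "weight (inner_sets D) 0 (\<lambda>y. ennreal (\<phi> y)) x (\<lambda>t. X t \<omega>) \<le> ennreal (\<phi> x)"
      unfolding weight_def by (simp add: X_nonpos)
  qed
  then show ?thesis using True by (simp add: emeasure_space_1)
qed (use T_\<phi>[of t x] in simp)

end

locale ground_state_target = ground_state M X V C D \<phi> lam
  for M :: "'w measure" and X :: "real \<Rightarrow> 'w \<Rightarrow> 'v::euclidean_space" and V C D \<phi> lam +
  fixes B :: "'v set"
  assumes B: "open B" "B \<inter> D \<noteq> {}"
begin

abbreviation "TB \<equiv> semigroup (\<lambda>n. inner_sets D n - B)"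

definition u :: "real \<Rightarrow> 'v \<Rightarrow> ennreal" where
  "u t x = ennreal (exp (lam * t)) * TB t (\<lambda>y. ennreal (\<phi> y)) x"

lemma closed_target: "closed (inner_sets D n - B)"
  using closed_inner_sets B(1) by (intro closed_Diff)

lemma incseq_target: "incseq (\<lambda>n. inner_sets D n - B)"
  using incseq_inner_sets[of D] unfolding incseq_def by blast

lemma u_meas [measurable]: "0 \<le> t \<Longrightarrow> u t \<in> borel_measurable borel"
  unfolding u_def by (intro borel_measurable_times_ennreal measurable_semigroup closed_target) auto

lemma u_le_\<phi>: "0 \<le> t \<Longrightarrow> u t x \<le> ennreal (\<phi> x)"
proof -
  assume t: "0 \<le> t"
  have "u t x \<le> ennreal (exp (lam * t)) * T t (\<lambda>y. ennreal (\<phi> y)) x"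
    unfolding u_def by (intro mult_left_mono semigroup_mono_sets) auto
  also have "\<dots> \<le> ennreal (\<phi> x)" by (rule T_\<phi>_le[OF t])
  finally show ?thesis .
qed

lemma u_add:
  assumes "0 \<le> s" "0 \<le> t"
  shows "u (s + t) x = ennreal (exp (lam * s)) * TB s (u t) x"
proof -
  have "TB s (u t) x = ennreal (exp (lam * t)) * TB (s + t) (\<lambda>y. ennreal (\<phi> y)) x"
    unfolding u_def[abs_def] semigroup_add[OF assms closed_target incseq_target, of "\<lambda>y. ennreal (\<phi> y)" x, simplified]
    using assms by (intro semigroup_cmult measurable_semigroup closed_target) auto
  then show ?thesis unfolding u_def
    by (simp add: distrib_left exp_add ennreal_mult mult.assoc)
qed

text \<open>The function \<open>u (t - s)\<close> is at most \<open>\<phi>\<close>. Applying the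
  killed semigroup for time \<open>s\<close>, with its exponential factor, preserves the order and
  yields \<open>u t\<close> and \<open>u s\<close>.\<close>

lemma u_antimono:
  assumes "0 \<le> s" "s \<le> t"
  shows "u t x \<le> u s x"
proof -
  have "u (s + (t - s)) x = ennreal (exp (lam * s)) * TB s (u (t - s)) x"
    using assms by (intro u_add) auto
  also have "\<dots> \<le> u s x"
    unfolding u_def[of s] using assms by (intro mult_left_mono semigroup_mono u_le_\<phi>) auto
  finally have "u (s + (t - s)) x \<le> u s x" .
  then show ?thesis by simp
qed

definition u_lim :: "'v \<Rightarrow> ennreal" where
  "u_lim x = (INF n. u (real n) x)"

lemma u_lim_meas [measurable]: "u_lim \<in> borel_measurable borel"
  unfolding u_lim_def[abs_def] by measurable

lemma u_tendsto: "(\<lambda>n. u (real n) x) \<longlonglongrightarrow> u_lim x"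
  unfolding u_lim_def by (intro LIMSEQ_INF decseq_SucI u_antimono) auto

lemma u_lim_le: "0 \<le> t \<Longrightarrow> u_lim x \<le> u t x"
proof -
  assume t: "0 \<le> t"
  have "u_lim x \<le> u (real (nat \<lceil>t\<rceil>)) x" unfolding u_lim_def by (rule INF_lower) auto
  also have "\<dots> \<le> u t x" using t by (intro u_antimono) auto
  finally show ?thesis .
qed

lemma u_lim_le_\<phi>: "u_lim x \<le> ennreal (\<phi> x)"
  using u_lim_le[of 0 x] u_le_\<phi>[of 0 x] by simp

lemma u_lim_le_TB:
  assumes s: "0 \<le> s"
  shows "u_lim x \<le> ennreal (exp (lam * s)) * TB s u_lim x"
proof -
  obtain K where K: "0 \<le> K" "\<And>y. \<phi> y \<le> K" using \<phi>_bounded by blast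
  have "(\<lambda>n. TB s (u (real n)) x) \<longlonglongrightarrow> TB s u_lim x"
    unfolding semigroup_def
  proof (rule nn_integral_dominated_convergence[where w="\<lambda>\<omega>. weight (\<lambda>n. inner_sets D n - B) s (\<lambda>y. ennreal (\<phi> y)) x (\<lambda>t. X t \<omega>)"])
    show "(\<integral>\<^sup>+\<omega>. weight (\<lambda>n. inner_sets D n - B) s (\<lambda>y. ennreal (\<phi> y)) x (\<lambda>t. X t \<omega>) \<partial>M) < \<infinity>"
      using semigroup_bounded[of "\<lambda>y. ennreal (\<phi> y)" K s "\<lambda>n. inner_sets D n - B" x] K(2) s unfolding semigroup_def by (auto intro: ennreal_leI)
    show "AE \<omega> in M. (\<lambda>n. weight (\<lambda>n. inner_sets D n - B) s (u (real n)) x (\<lambda>t. X t \<omega>)) \<longlonglongrightarrow>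
       weight (\<lambda>n. inner_sets D n - B) s u_lim x (\<lambda>t. X t \<omega>)"
      unfolding weight_def by (intro AE_I2) (auto intro!: ennreal_tendsto_cmult u_tendsto)
    show "AE \<omega> in M. weight (\<lambda>n. inner_sets D n - B) s (u (real j)) x (\<lambda>t. X t \<omega>) \<le>
       weight (\<lambda>n. inner_sets D n - B) s (\<lambda>y. ennreal (\<phi> y)) x (\<lambda>t. X t \<omega>)" for j
      by (intro AE_I2 weight_mono u_le_\<phi>) auto
  qed (use s in \<open>auto intro!: measurable_weight closed_target\<close>)
  then have "(\<lambda>n. ennreal (exp (lam * s)) * TB s (u (real n)) x) \<longlonglongrightarrow> ennreal (exp (lam * s)) * TB s u_lim x"
    by (intro ennreal_tendsto_cmult) auto
  then show ?thesis
  proof (rule LIMSEQ_le_const)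
    have "u_lim x \<le> ennreal (exp (lam * s)) * TB s (u (real n)) x" for n
      using u_lim_le[of "s + real n" x] s by (simp add: u_add)
    then show "\<exists>N. \<forall>n\<ge>N. u_lim x \<le> ennreal (exp (lam * s)) * TB s (u (real n)) x" by blast
  qed
qed

lemma u_lim_eigen:
  assumes s: "0 < s"
  shows "AE x in lborel. x \<in> D \<longrightarrow> ennreal (exp (lam * s)) * T s u_lim x = u_lim x"
proof -
  obtain K where K: "0 \<le> K" "\<And>y. \<phi> y \<le> K" using \<phi>_bounded by blast
  have Tm: "T s u_lim \<in> borel_measurable borel"
    using s by (intro measurable_semigroup closed_inner_sets) auto
  have le: "u_lim x \<le> ennreal (exp (lam * s)) * T s u_lim x" for x
  proof -
    have "u_lim x \<le> ennreal (exp (lam * s)) * TB s u_lim x" by (rule u_lim_le_TB) (use s in auto)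
    also have "\<dots> \<le> ennreal (exp (lam * s)) * T s u_lim x"
      by (intro mult_left_mono semigroup_mono_sets) auto
    finally show ?thesis .
  qed
  \<comment> \<open>The two sides are ordered by \<open>le\<close>, and the weight
    \<open>\<phi>\<close> bounds the integral of the larger by that of the smaller. Finiteness is
    needed to get from there to equality almost everywhere; positivity of \<open>\<phi>\<close> on
    \<open>D\<close> then allows cancelling it.\<close>
  have "AE x in lborel. ennreal (\<phi> x) * u_lim x = ennreal (\<phi> x) * (ennreal (exp (lam * s)) * T s u_lim x)"
  proof (rule nn_integral_le_imp_AE_eq)
    show "ennreal (\<phi> x) * u_lim x \<le> ennreal (\<phi> x) * (ennreal (exp (lam * s)) * T s u_lim x)" for x
      by (intro mult_left_mono le) auto
    have "(\<integral>\<^sup>+x. ennreal (\<phi> x) * (ennreal (exp (lam * s)) * T s u_lim x) \<partial>lborel) =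
       ennreal (exp (lam * s)) * (\<integral>\<^sup>+x. ennreal (\<phi> x) * T s u_lim x \<partial>lborel)"
      using Tm by (subst nn_integral_cmult[symmetric]) (auto intro!: nn_integral_cong simp: mult_ac)
    also have "(\<integral>\<^sup>+x. ennreal (\<phi> x) * T s u_lim x \<partial>lborel) = (\<integral>\<^sup>+x. u_lim x * T s (\<lambda>y. ennreal (\<phi> y)) x \<partial>lborel)"
      using s by (intro semigroup_symmetric closed_inner_sets) auto
    also have "ennreal (exp (lam * s)) * \<dots> = (\<integral>\<^sup>+x. ennreal (\<phi> x) * u_lim x \<partial>lborel)"
    proof -
      have "T s (\<lambda>y. ennreal (\<phi> y)) \<in> borel_measurable borel"
        using s by (intro measurable_semigroup closed_inner_sets) auto
      then have "ennreal (exp (lam * s)) * (\<integral>\<^sup>+x. u_lim x * T s (\<lambda>y. ennreal (\<phi> y)) x \<partial>lborel) =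
         (\<integral>\<^sup>+x. u_lim x * (ennreal (exp (lam * s)) * T s (\<lambda>y. ennreal (\<phi> y)) x) \<partial>lborel)"
        by (subst nn_integral_cmult[symmetric]) (auto intro!: nn_integral_cong simp: mult_ac)
      then show ?thesis by (simp add: T_\<phi>[OF s] mult.commute)
    qed
    finally show "(\<integral>\<^sup>+x. ennreal (\<phi> x) * (ennreal (exp (lam * s)) * T s u_lim x) \<partial>lborel) \<le>
      (\<integral>\<^sup>+x. ennreal (\<phi> x) * u_lim x \<partial>lborel)" by simp
    have "(\<integral>\<^sup>+x. ennreal (\<phi> x) * u_lim x \<partial>lborel) \<le> (\<integral>\<^sup>+x. ennreal K * ennreal K * indicator D x \<partial>lborel)"
    proof (rule nn_integral_mono)
      fix x
      have "u_lim x \<le> ennreal K" using u_lim_le_\<phi>[of x] K(2)[of x] by (meson ennreal_leI order.trans)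
      then show "ennreal (\<phi> x) * u_lim x \<le> ennreal K * ennreal K * indicator D x"
        using K(2)[of x] \<phi>_out[of x] by (cases "x \<in> D") (auto intro!: mult_mono ennreal_leI)
    qed
    also have "\<dots> = ennreal K * ennreal K * emeasure lborel D" using D(1) by (simp add: nn_integral_cmult_indicator)
    also have "\<dots> < \<infinity>" using emeasure_bounded_finite[OF D(2)] by (simp add: ennreal_mult_less_top)
    finally show "(\<integral>\<^sup>+x. ennreal (\<phi> x) * u_lim x \<partial>lborel) < \<infinity>" .
  qed (use Tm in auto)
  then show ?thesis
  proof eventually_elim
    fix x assume *: "ennreal (\<phi> x) * u_lim x = ennreal (\<phi> x) * (ennreal (exp (lam * s)) * T s u_lim x)"
    show "x \<in> D \<longrightarrow> ennreal (exp (lam * s)) * T s u_lim x = u_lim x"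
      using * \<phi>_pos[of x] by (auto simp: ennreal_mult_cancel_left)
  qed
qed

lemma u_lim_zero: "u_lim x = 0"
proof -
  define v where "v x = enn2real (u_lim x)" for x
  have fin: "u_lim x < \<top>" for x using u_lim_le_\<phi>[of x] by (rule le_less_trans) simp
  then have v: "ennreal (v x) = u_lim x" for x by (simp add: v_def)
  have vm[measurable]: "v \<in> borel_measurable borel" unfolding v_def[abs_def] by measurable
  have "\<exists>c. AE x in lborel. x \<in> D \<longrightarrow> v x = c * \<phi> x"
  proof (rule simple)
    show "v x \<le> \<phi> x" for x
      using u_lim_le_\<phi>[of x] \<phi>_nonneg[of x] unfolding v_def by (simp add: enn2real_leI)
    fix t :: real assume t: "0 < t"
    show "AE x in lborel. x \<in> D \<longrightarrow> T t (\<lambda>y. ennreal (v y)) x = ennreal (exp (- lam * t) * v x)"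
      using u_lim_eigen[OF t]
    proof eventually_elim
      fix x assume *: "x \<in> D \<longrightarrow> ennreal (exp (lam * t)) * T t u_lim x = u_lim x"
      have "ennreal (exp (- lam * t)) * (ennreal (exp (lam * t)) * T t u_lim x) = T t u_lim x"
        unfolding mult.assoc[symmetric] by (simp add: ennreal_mult[symmetric] exp_add[symmetric])
      then show "x \<in> D \<longrightarrow> T t (\<lambda>y. ennreal (v y)) x = ennreal (exp (- lam * t) * v x)"
        using * by (auto simp: ennreal_mult' v)
    qed
  qed (auto simp: v_def)
  then obtain c where c: "AE x in lborel. x \<in> D \<longrightarrow> v x = c * \<phi> x" by blast
  have "c = 0"
  proof (rule ccontr)
    assume "c \<noteq> 0"
    \<comment> \<open>From a starting point in \<open>B\<close> the path is killed at time 0, so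
      \<open>u 0\<close> and with it \<open>v\<close> vanish there, whereas
      \<open>c * \<phi>\<close> has no zero in \<open>D\<close>.\<close>
    have "AE x in lborel. x \<notin> B \<inter> D"
      using c
    proof eventually_elim
      fix x assume *: "x \<in> D \<longrightarrow> v x = c * \<phi> x"
      show "x \<notin> B \<inter> D"
      proof
        assume x: "x \<in> B \<inter> D"
        then have "u 0 x = 0" unfolding u_def by (subst semigroup_outside) auto
        then have "v x = 0" using u_lim_le[of 0 x] by (simp add: v_def)
        then show False using * x \<phi>_pos[of x] \<open>c \<noteq> 0\<close> by auto
      qed
    qed
    then have "emeasure lborel (B \<inter> D) = 0"
      using B(1) D(1) by (subst (asm) AE_iff_null_sets[symmetric]) (auto simp: null_sets_def)
    then have "negligible (B \<inter> D)"
      using B(1) D(1) by (simp add: negligible_iff_null_sets null_sets_completionI null_sets_def open_Int)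
    then show False using B D(1) open_not_negligible by blast
  qed
  with c have "AE x in lborel. u_lim x = 0"
  proof (elim AE_mp, intro AE_I2 impI)
    fix x assume *: "x \<in> D \<longrightarrow> v x = c * \<phi> x"
    show "u_lim x = 0"
    proof (cases "x \<in> D")
      case True
      then show ?thesis using * \<open>c = 0\<close> v[of x] by simp
    next
      case False
      then show ?thesis using u_lim_le_\<phi>[of x] \<phi>_out by simp
    qed
  qed
  \<comment> \<open>So far \<open>u_lim\<close> is 0 almost everywhere; one application of the
    killed semigroup removes the exceptional set.\<close>
  then have "TB 1 u_lim x = 0" by (intro semigroup_null) auto
  then show ?thesis using u_lim_le_TB[of 1 x] by simp
qed

lemma u_tendsto_0: "(\<lambda>n. u (real n) x) \<longlonglongrightarrow> 0"
  using u_tendsto[of x] by (simp add: u_lim_zero)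

end

section \<open>Stopping at the hitting time\<close>

text \<open>Functionals that ask for staying in the open set \<open>D\<close> at all times become
  measurable in this way: they agree almost surely with a measurable one.\<close>

lemma complete_measurable_AE_eq:
  assumes M: "complete_measure M" and g: "g \<in> M \<rightarrow>\<^sub>M N" and eq: "AE x in M. f x = g x"
    and f: "\<And>x. x \<in> space M \<Longrightarrow> f x \<in> space N"
  shows "f \<in> M \<rightarrow>\<^sub>M N"
proof (rule measurableI)
  fix S assume S: "S \<in> sets N"
  from eq obtain Z where Z: "Z \<in> null_sets M" "{x \<in> space M. f x \<noteq> g x} \<subseteq> Z"
    unfolding eventually_ae_filter by auto
  have "f -` S \<inter> Z \<inter> space M \<in> sets M"
    using complete_measure.complete[OF M, of "f -` S \<inter> Z \<inter> space M" Z] Z(1) by auto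
  moreover have "g -` S \<inter> space M - Z \<in> sets M" using measurable_sets[OF g S] Z(1) by auto
  moreover have "f -` S \<inter> space M = (g -` S \<inter> space M - Z) \<union> (f -` S \<inter> Z \<inter> space M)"
    using Z(2) by auto
  ultimately show "f -` S \<inter> space M \<in> sets M" by simp
qed (use f in auto)

text \<open>The sequence may take the value \<open>a\<close>, which the filter
  \<open>at_right a\<close> excludes; a grid time can coincide with the time that it
  approximates.\<close>

lemma tendsto_at_right_seq:
  fixes f :: "real \<Rightarrow> 'a::topological_space"
  assumes f: "(f \<longlongrightarrow> f a) (at_right a)" and s: "s \<longlonglongrightarrow> a" "\<And>k. a \<le> s k"
  shows "(\<lambda>k. f (s k)) \<longlonglongrightarrow> f a"
proof (rule topological_tendstoI)
  fix S assume S: "open S" "f a \<in> S"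
  from topological_tendstoD[OF f S] obtain b where b: "b > a" "\<And>y. a < y \<Longrightarrow> y < b \<Longrightarrow> f y \<in> S"
    unfolding eventually_at_right_field by auto
  from order_tendstoD(2)[OF s(1) b(1)] show "eventually (\<lambda>k. f (s k) \<in> S) sequentially"
  proof eventually_elim
    fix k assume "s k < b"
    then show "f (s k) \<in> S" using b(2)[of "s k"] s(2)[of k] S(2) by (cases "s k = a") auto
  qed
qed

lemma rcont_shift: "rcont p \<Longrightarrow> rcont (\<lambda>r. p (a + r) - c)" for p :: "real \<Rightarrow> 'v::real_normed_vector"
  unfolding rcont_def
proof
  fix r assume p: "\<forall>r. (p \<longlongrightarrow> p r) (at_right r)"
  have "filterlim (\<lambda>r. a + r) (at_right (a + r)) (at_right r)"
    unfolding filterlim_at by (auto intro!: tendsto_intros eventually_mono[OF eventually_at_right_less])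
  then have "((\<lambda>r. p (a + r)) \<longlongrightarrow> p (a + r)) (at_right r)"
    using p by (auto intro: filterlim_compose)
  then show "((\<lambda>r. p (a + r) - c) \<longlongrightarrow> p (a + r) - c) (at_right r)" by (intro tendsto_intros)
qed

section \<open>Hitting times and their dyadic approximation\<close>

definition hits :: "'v::plus set \<Rightarrow> 'v \<Rightarrow> real \<Rightarrow> (real \<Rightarrow> 'v) \<Rightarrow> bool" where
  "hits B x t p \<longleftrightarrow> (\<exists>r. 0 < r \<and> r \<le> t \<and> x + p r \<in> B)"

definition hit_time :: "'v::plus set \<Rightarrow> 'v \<Rightarrow> (real \<Rightarrow> 'v) \<Rightarrow> real" where
  "hit_time B x p = Inf {r. 0 < r \<and> x + p r \<in> B}"

definition stopped :: "'v::plus set \<Rightarrow> 'v \<Rightarrow> real \<Rightarrow> (real \<Rightarrow> 'v) \<Rightarrow> real" where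
  "stopped B x t p = (if hits B x t p then hit_time B x p else t)"

text \<open>The alternative \<open>j = 2 ^ k\<close> truncates at time \<open>t\<close> and
  guarantees that a least index exists; starting from 1 matches hitting times, which ignore time
  0.\<close>

definition grid_index :: "'v::plus set \<Rightarrow> 'v \<Rightarrow> real \<Rightarrow> nat \<Rightarrow> (real \<Rightarrow> 'v) \<Rightarrow> nat" where
  "grid_index B x t k p = (LEAST j. 1 \<le> j \<and> (x + p (real j * (t / 2 ^ k)) \<in> B \<or> j = 2 ^ k))"

lemma grid_index:
  "1 \<le> grid_index B x t k p" "grid_index B x t k p \<le> 2 ^ k"
  "x + p (real (grid_index B x t k p) * (t / 2 ^ k)) \<in> B \<or> grid_index B x t k p = 2 ^ k"
  "\<And>j. 1 \<le> j \<Longrightarrow> x + p (real j * (t / 2 ^ k)) \<in> B \<Longrightarrow> grid_index B x t k p \<le> j"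
proof -
  let ?P = "\<lambda>j. 1 \<le> j \<and> (x + p (real j * (t / 2 ^ k)) \<in> B \<or> j = 2 ^ k)"
  have P: "?P (2 ^ k)" by simp
  from LeastI[of ?P, OF P] show "1 \<le> grid_index B x t k p"
    "x + p (real (grid_index B x t k p) * (t / 2 ^ k)) \<in> B \<or> grid_index B x t k p = 2 ^ k"
    unfolding grid_index_def by blast+
  show "grid_index B x t k p \<le> 2 ^ k" unfolding grid_index_def using P by (rule Least_le)
  show "grid_index B x t k p \<le> j" if "1 \<le> j" "x + p (real j * (t / 2 ^ k)) \<in> B" for j
    unfolding grid_index_def using that by (intro Least_le) auto
qed

text \<open>Exhibits the event as one decided by grid times up to index \<open>j\<close>, so that
  its indicator is a functional of the past.\<close>

lemma grid_index_eq_iff: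
  assumes "1 \<le> j" "j \<le> 2 ^ k"
  shows "grid_index B x t k p = j \<longleftrightarrow>
    (\<forall>i\<in>{1..<j}. x + p (real i * (t / 2 ^ k)) \<notin> B) \<and> (x + p (real j * (t / 2 ^ k)) \<in> B \<or> j = 2 ^ k)"
proof
  assume "grid_index B x t k p = j"
  then show "(\<forall>i\<in>{1..<j}. x + p (real i * (t / 2 ^ k)) \<notin> B) \<and> (x + p (real j * (t / 2 ^ k)) \<in> B \<or> j = 2 ^ k)"
    using grid_index(3)[of x p B t k] grid_index(4)[of _ x p t k B] by fastforce
next
  assume *: "(\<forall>i\<in>{1..<j}. x + p (real i * (t / 2 ^ k)) \<notin> B) \<and> (x + p (real j * (t / 2 ^ k)) \<in> B \<or> j = 2 ^ k)"
  show "grid_index B x t k p = j" unfolding grid_index_def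
  proof (rule Least_equality)
    fix y assume y: "1 \<le> y \<and> (x + p (real y * (t / 2 ^ k)) \<in> B \<or> y = 2 ^ k)"
    show "j \<le> y"
    proof (rule ccontr)
      assume "\<not> j \<le> y"
      then have "y \<in> {1..<j}" "y \<noteq> 2 ^ k" using y assms by auto
      with * y show False by blast
    qed
  qed (use * assms in auto)
qed

lemma grid_time_le: "0 \<le> t \<Longrightarrow> j \<le> 2 ^ k \<Longrightarrow> real j * (t / 2 ^ k) \<le> t"
proof -
  assume t: "0 \<le> t" and j: "j \<le> 2 ^ k"
  have "real j \<le> real (2 ^ k)" using j by (rule of_nat_mono)
  then have "real j * (t / 2 ^ k) \<le> 2 ^ k * (t / 2 ^ k)"
    using t by (intro mult_right_mono) auto
  then show ?thesis by simp
qed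

lemma hit_time_props:
  assumes "hits B x t p"
  shows "0 \<le> hit_time B x p" "hit_time B x p \<le> t"
    "\<And>r. 0 < r \<Longrightarrow> x + p r \<in> B \<Longrightarrow> hit_time B x p \<le> r"
proof -
  have bdd: "bdd_below {r. 0 < r \<and> x + p r \<in> B}" by (rule bdd_belowI[of _ 0]) auto
  obtain r where r: "0 < r" "r \<le> t" "x + p r \<in> B" using assms by (auto simp: hits_def)
  show "0 \<le> hit_time B x p" unfolding hit_time_def using r by (intro cInf_greatest) auto
  show le: "\<And>r. 0 < r \<Longrightarrow> x + p r \<in> B \<Longrightarrow> hit_time B x p \<le> r"
    unfolding hit_time_def using bdd by (intro cInf_lower) auto
  show "hit_time B x p \<le> t" using le[OF r(1,3)] r(2) by simp
qed

lemma stopped_bounds: "0 \<le> t \<Longrightarrow> 0 \<le> stopped B x t p \<and> stopped B x t p \<le> t"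
  unfolding stopped_def using hit_time_props(1,2)[of B x t p] by auto

text \<open>Every grid hit is a hit, which gives the lower bound. Conversely a hit at
  \<open>r\<close> persists for a while after \<open>r\<close>, since \<open>B\<close> is open and
  the path right-continuous, and a fine grid meets that interval.\<close>

lemma grid_stopped:
  fixes p :: "real \<Rightarrow> 'v::real_normed_vector"
  assumes p: "rcont p" and B: "open B" and t: "0 < t"
  shows "stopped B x t p \<le> real (grid_index B x t k p) * (t / 2 ^ k)"
    and "(\<lambda>k. real (grid_index B x t k p) * (t / 2 ^ k)) \<longlonglongrightarrow> stopped B x t p"
proof -
  define g where "g k = real (grid_index B x t k p) * (t / 2 ^ k)" for k
  have g_pos: "0 < g k" for k using grid_index(1)[of B x t k p] t by (simp add: g_def)
  have g_le: "g k \<le> t" for k unfolding g_def using grid_index(2) t by (intro grid_time_le) auto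
  have g_alt: "x + p (g k) \<in> B \<or> g k = t" for k using grid_index(3)[of x p B t k] by (auto simp: g_def)
  have ge: "stopped B x t p \<le> g k" for k
  proof (cases "hits B x t p")
    case True
    have "hit_time B x p \<le> g k"
      using g_alt[of k] hit_time_props(3)[OF True g_pos, of k] hit_time_props(2)[OF True] by auto
    then show ?thesis using True by (simp add: stopped_def)
  next
    case False
    then have "x + p (g k) \<notin> B" using g_pos[of k] g_le[of k] by (auto simp: hits_def)
    then show ?thesis using False g_alt[of k] by (auto simp: stopped_def)
  qed
  then show "stopped B x t p \<le> real (grid_index B x t k p) * (t / 2 ^ k)" by (simp add: g_def)
  have "g \<longlonglongrightarrow> stopped B x t p"
  proof (rule order_tendstoI)
    fix c assume "c < stopped B x t p"
    then show "eventually (\<lambda>k. c < g k) sequentially" using ge by (auto intro: always_eventually less_le_trans)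
  next
    fix c assume c: "stopped B x t p < c"
    show "eventually (\<lambda>k. g k < c) sequentially"
    proof (cases "stopped B x t p = t")
      case True
      then show ?thesis using c g_le by (auto intro!: always_eventually intro: le_less_trans)
    next
      case False
      then have h: "hits B x t p" and st: "stopped B x t p = hit_time B x p" by (auto simp: stopped_def split: if_splits)
      have lt: "hit_time B x p < min c t" using False c st hit_time_props(2)[OF h] by auto
      have "{r. 0 < r \<and> x + p r \<in> B} \<noteq> {}" using h by (auto simp: hits_def)
      then obtain r where r: "0 < r" "x + p r \<in> B" "r < min c t"
        using cInf_lessD[of "{r. 0 < r \<and> x + p r \<in> B}"] lt unfolding hit_time_def by blast
      obtain b where b: "b > r" "\<And>r'. r \<le> r' \<Longrightarrow> r' < b \<Longrightarrow> x + p r' \<in> B"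
        using rcont_open[OF p B r(2)] by blast
      \<comment> \<open>Division by \<open>t\<close>, because the grid is \<open>t\<close> times a
        dyadic one.\<close>
      define d where "d = (min b (min c t) - r) / t"
      have d: "d > 0" using b(1) r(3) t by (simp add: d_def)
      have "(\<lambda>k. (1/2::real) ^ k) \<longlonglongrightarrow> 0" by (rule LIMSEQ_power_zero) auto
      from order_tendstoD(2)[OF this d] show ?thesis
      proof eventually_elim
        fix k assume k: "(1/2) ^ k < d"
        define j where "j = nat (\<lfloor>2 ^ k * (r / t)\<rfloor> + 1)"
        have fl: "0 \<le> \<lfloor>2 ^ k * (r / t)\<rfloor>" using r(1) t by simp
        have "1 \<le> j" using fl unfolding j_def by linarith
        moreover have "real j / 2 ^ k = (of_int \<lfloor>2 ^ k * (r / t)\<rfloor> + 1) / 2 ^ k" using fl unfolding j_def by simp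
        ultimately have j: "1 \<le> j" "real j / 2 ^ k = (of_int \<lfloor>2 ^ k * (r / t)\<rfloor> + 1) / 2 ^ k" .
        have "r / t < real j / 2 ^ k" "real j / 2 ^ k \<le> r / t + (1/2) ^ k"
          unfolding j(2) by (rule dyadic_above)+
        then have "r / t < real j / 2 ^ k" "real j / 2 ^ k < r / t + d" using k by auto
        then have jr: "r < real j * (t / 2 ^ k)" "real j * (t / 2 ^ k) < min b (min c t)"
          using t by (auto simp: d_def field_simps)
        then have "grid_index B x t k p \<le> j" using j(1) b(2) by (intro grid_index(4)) auto
        then have "g k \<le> real j * (t / 2 ^ k)" unfolding g_def using t by (intro mult_right_mono) auto
        then show "g k < c" using jr(2) by simp
      qed
    qed
  qed
  then show "(\<lambda>k. real (grid_index B x t k p) * (t / 2 ^ k)) \<longlonglongrightarrow> stopped B x t p" unfolding g_def[abs_def] .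
qed

section \<open>The martingale of the ground state\<close>

context ground_state
begin

definition mart :: "'v \<Rightarrow> real \<Rightarrow> (real \<Rightarrow> 'v) \<Rightarrow> real" where
  "mart x r p = (if \<forall>r'\<in>{0..r}. x + p r' \<in> D then exp (lam * r - pot x r p) * \<phi> (x + p r) else 0)"

lemma mart_nonneg: "0 \<le> mart x r p"
  unfolding mart_def by (simp add: \<phi>_nonneg)

lemma mart_bound:
  assumes p: "rcont p" and r: "0 \<le> r" "r \<le> t" and K: "0 \<le> K" "\<And>y. \<phi> y \<le> K"
  shows "mart x r p \<le> exp ((\<bar>lam\<bar> + C) * t) * K"
proof -
  have C: "0 \<le> C" using V_bound[of 0] by linarith
  have "lam * r \<le> \<bar>lam\<bar> * r" using r by (intro mult_right_mono) auto
  also have "\<dots> \<le> \<bar>lam\<bar> * t" using r by (intro mult_left_mono) auto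
  finally have "lam * r \<le> \<bar>lam\<bar> * t" .
  moreover have "- pot x r p \<le> C * t"
    using pot_bound[OF rcont_measurable[OF p] r(1), of x] mult_left_mono[OF r(2) C] by linarith
  ultimately have "lam * r - pot x r p \<le> (\<bar>lam\<bar> + C) * t" by (simp add: distrib_right)
  then have "exp (lam * r - pot x r p) * \<phi> (x + p r) \<le> exp ((\<bar>lam\<bar> + C) * t) * K"
    by (intro mult_mono K \<phi>_nonneg) auto
  then show ?thesis using K(1) unfolding mart_def by simp
qed

text \<open>A path inside the open set \<open>D\<close> remains there for a while, and the potential
  term is Lipschitz in time because \<open>V\<close> is bounded. Once the path has left
  \<open>D\<close>, the functional is 0 for good.\<close>

lemma mart_rcont:
  assumes p: "rcont p" and r: "0 \<le> r"
  shows "((\<lambda>r. mart x r p) \<longlongrightarrow> mart x r p) (at_right r)"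
proof (cases "\<forall>r'\<in>{0..r}. x + p r' \<in> D")
  case True
  obtain b where b: "b > r" "\<And>r'. r \<le> r' \<Longrightarrow> r' < b \<Longrightarrow> x + p r' \<in> D"
    using rcont_open[OF p D(1), of x r] True r by auto
  have "eventually (\<lambda>r'. mart x r' p = exp (lam * r' - pot x r' p) * \<phi> (x + p r')) (at_right r)"
    unfolding eventually_at_right_field
  proof (intro exI[of _ b] conjI b(1) allI impI)
    fix r' assume r': "r < r'" "r' < b"
    have "\<forall>y\<in>{0..r'}. x + p y \<in> D"
    proof
      fix y assume "y \<in> {0..r'}"
      then show "x + p y \<in> D" using True b(2)[of y] r' by (cases "y \<le> r") auto
    qed
    then show "mart x r' p = exp (lam * r' - pot x r' p) * \<phi> (x + p r')" by (simp add: mart_def)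
  qed
  moreover have "((\<lambda>r'. exp (lam * r' - pot x r' p) * \<phi> (x + p r')) \<longlongrightarrow> exp (lam * r - pot x r p) * \<phi> (x + p r)) (at_right r)"
  proof (intro tendsto_intros)
    have "((\<lambda>r. x + p r) \<longlongrightarrow> x + p r) (at_right r)"
      using p by (intro tendsto_intros) (auto simp: rcont_def)
    moreover have "isCont \<phi> (x + p r)" using \<phi>_cont by (simp add: continuous_on_eq_continuous_at)
    ultimately show "((\<lambda>r. \<phi> (x + p r)) \<longlongrightarrow> \<phi> (x + p r)) (at_right r)" by (rule isCont_tendsto_compose[rotated])
    have bound: "eventually (\<lambda>r'. norm (pot x r' p - pot x r p) \<le> C * (r' - r)) (at_right r)"
      using eventually_at_right_less[of r]
    proof eventually_elim
      fix r' assume r': "r < r'"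
      define p' where "p' y = p (r + y) - p r" for y
      have p': "rcont p'" unfolding p'_def by (rule rcont_shift[OF p])
      have "pot x (r + (r' - r)) p = pot x r p + pot (x + p r) (r' - r) p'"
        using r r' by (intro pot_splice rcont_measurable[OF p]) (auto simp: p'_def)
      moreover have "\<bar>pot (x + p r) (r' - r) p'\<bar> \<le> C * (r' - r)"
        using r' by (intro pot_bound rcont_measurable[OF p']) auto
      ultimately show "norm (pot x r' p - pot x r p) \<le> C * (r' - r)" by simp
    qed
    have "((\<lambda>r'. C * (r' - r)) \<longlongrightarrow> C * (r - r)) (at_right r)" by (intro tendsto_intros)
    then have "((\<lambda>r'. C * (r' - r)) \<longlongrightarrow> 0) (at_right r)" by simp
    from Lim_null_comparison[OF bound this]
    have "((\<lambda>r'. pot x r' p - pot x r p) \<longlongrightarrow> 0) (at_right r)" .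
    then show "((\<lambda>r'. pot x r' p) \<longlongrightarrow> pot x r p) (at_right r)" by (simp add: LIM_zero_iff)
  qed
  ultimately show ?thesis using True by (simp add: mart_def[of x r] tendsto_cong)
next
  case False
  then have "mart x r' p = 0" if "r \<le> r'" for r' using that r unfolding mart_def by auto
  then have "eventually (\<lambda>r'. mart x r' p = 0) (at_right r)" "mart x r p = 0"
    by (auto intro: eventually_mono[OF eventually_at_right_less])
  then show ?thesis by (simp add: tendsto_cong)
qed

lemma D_not_UNIV: "D \<noteq> UNIV"
  using D(2) not_bounded_UNIV by auto

text \<open>Quasi-left-continuity joins the two notions of survival: staying in \<open>D\<close>,
  which the exit time measures, and staying in one closed inner set, which the semigroup
  uses.\<close>

lemma mart_weight_AE:
  assumes r: "0 \<le> r"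
  shows "AE \<omega> in M. ennreal (mart x r (\<lambda>t. X t \<omega>)) =
    ennreal (exp (lam * r)) * weight (inner_sets D) r (\<lambda>y. ennreal (\<phi> y)) x (\<lambda>t. X t \<omega>)"
  using stays_inner[OF D(1) D_not_UNIV r, of x]
proof eventually_elim
  fix \<omega> assume "(\<forall>r'\<in>{0..r}. x + X r' \<omega> \<in> D) \<longrightarrow> stays (inner_sets D) x r (\<lambda>t. X t \<omega>)"
  moreover have "stays (inner_sets D) x r (\<lambda>t. X t \<omega>) \<Longrightarrow> \<forall>r'\<in>{0..r}. x + X r' \<omega> \<in> D"
    using inner_sets_subset[of D] unfolding stays_def by blast
  ultimately have "(\<forall>r'\<in>{0..r}. x + X r' \<omega> \<in> D) = stays (inner_sets D) x r (\<lambda>t. X t \<omega>)" by blast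
  then show "ennreal (mart x r (\<lambda>t. X t \<omega>)) =
    ennreal (exp (lam * r)) * weight (inner_sets D) r (\<lambda>y. ennreal (\<phi> y)) x (\<lambda>t. X t \<omega>)"
    unfolding mart_def weight_def
    by (simp add: ennreal_mult[symmetric] \<phi>_nonneg mult.assoc[symmetric] exp_add[symmetric])
qed

lemma mart_meas: "0 \<le> r \<Longrightarrow> (\<lambda>\<omega>. mart x r (\<lambda>t. X t \<omega>)) \<in> borel_measurable M"
proof (rule complete_measurable_AE_eq[OF complete])
  assume r: "0 \<le> r"
  show "(\<lambda>\<omega>. enn2real (ennreal (exp (lam * r)) * weight (inner_sets D) r (\<lambda>y. ennreal (\<phi> y)) x (\<lambda>t. X t \<omega>))) \<in> borel_measurable M"
    using r by (intro borel_measurable_enn2real borel_measurable_times_ennreal measurable_weight closed_inner_sets) auto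
  show "AE \<omega> in M. mart x r (\<lambda>t. X t \<omega>) =
      enn2real (ennreal (exp (lam * r)) * weight (inner_sets D) r (\<lambda>y. ennreal (\<phi> y)) x (\<lambda>t. X t \<omega>))"
    using mart_weight_AE[OF r, of x]
    by eventually_elim (metis enn2real_ennreal mart_nonneg)
qed auto

text \<open>The eigenvalue equation over the remaining time \<open>t - s\<close>, inserted into the
  Markov property. Testing against functionals of the past takes the place of conditional
  expectations.\<close>

lemma mart_past:
  assumes s: "0 \<le> s" "s \<le> t" and G[measurable]: "G \<in> borel_measurable path_algebra"
    and G_past: "\<And>\<omega> \<omega>'. G (\<lambda>r. X (min r s) \<omega> + X (r - s) \<omega>') = G (\<lambda>r. X r \<omega>)"
  shows "(\<integral>\<^sup>+\<omega>. G (\<lambda>r. X r \<omega>) * ennreal (mart x t (\<lambda>r. X r \<omega>)) \<partial>M) =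
    (\<integral>\<^sup>+\<omega>. G (\<lambda>r. X r \<omega>) * ennreal (mart x s (\<lambda>r. X r \<omega>)) \<partial>M)"
\<comment> \<open>The eigenvalue equation is available for positive times only.\<close>
proof (cases "s = t")
  case False
  then have st: "0 < t - s" using s by simp
  have T: "T (t - s) (\<lambda>y. ennreal (\<phi> y)) y = ennreal (exp (- lam * (t - s))) * ennreal (\<phi> y)" for y
  proof (cases "y \<in> D")
    case True
    then show ?thesis using \<phi>_eigen[OF st True] \<phi>_nonneg by (simp add: ennreal_mult)
  next
    case False
    then have "y \<notin> inner_sets D n" for n using inner_sets_subset by blast
    then have "T (t - s) (\<lambda>y. ennreal (\<phi> y)) y = 0" using st by (intro semigroup_outside) auto
    then show ?thesis using \<phi>_out[OF False] by simp
  qed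
  have wm: "(\<lambda>\<omega>. weight (inner_sets D) r (\<lambda>y. ennreal (\<phi> y)) x (\<lambda>t. X t \<omega>)) \<in> borel_measurable M" if "0 \<le> r" for r
    using that by (intro measurable_weight closed_inner_sets) auto
  have Gm: "(\<lambda>\<omega>. G (\<lambda>r. X r \<omega>)) \<in> borel_measurable M" by measurable
  have swap: "(\<integral>\<^sup>+\<omega>. G (\<lambda>r. X r \<omega>) * ennreal (mart x a (\<lambda>r. X r \<omega>)) \<partial>M) = ennreal (exp (lam * a)) *
      (\<integral>\<^sup>+\<omega>. G (\<lambda>r. X r \<omega>) * weight (inner_sets D) a (\<lambda>y. ennreal (\<phi> y)) x (\<lambda>r. X r \<omega>) \<partial>M)" if "0 \<le> a" for a
  proof -
    have "(\<integral>\<^sup>+\<omega>. G (\<lambda>r. X r \<omega>) * ennreal (mart x a (\<lambda>r. X r \<omega>)) \<partial>M) =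
      (\<integral>\<^sup>+\<omega>. ennreal (exp (lam * a)) * (G (\<lambda>r. X r \<omega>) * weight (inner_sets D) a (\<lambda>y. ennreal (\<phi> y)) x (\<lambda>r. X r \<omega>)) \<partial>M)"
      using mart_weight_AE[OF that, of x] by (intro nn_integral_cong_AE) (auto elim!: eventually_mono simp: mult_ac)
    then show ?thesis using Gm wm[OF that] by (simp add: nn_integral_cmult)
  qed
  have "(\<integral>\<^sup>+\<omega>. G (\<lambda>r. X r \<omega>) * weight (inner_sets D) (s + (t - s)) (\<lambda>y. ennreal (\<phi> y)) x (\<lambda>r. X r \<omega>) \<partial>M) =
    (\<integral>\<^sup>+\<omega>. G (\<lambda>r. X r \<omega>) * weight (inner_sets D) s (T (t - s) (\<lambda>y. ennreal (\<phi> y))) x (\<lambda>r. X r \<omega>) \<partial>M)"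
    using s by (intro markov closed_inner_sets incseq_inner_sets G G_past) auto
  also have "\<dots> = (\<integral>\<^sup>+\<omega>. ennreal (exp (- lam * (t - s))) *
       (G (\<lambda>r. X r \<omega>) * weight (inner_sets D) s (\<lambda>y. ennreal (\<phi> y)) x (\<lambda>r. X r \<omega>)) \<partial>M)"
    by (intro nn_integral_cong) (simp add: weight_def T mult_ac)
  also have "\<dots> = ennreal (exp (- lam * (t - s))) *
       (\<integral>\<^sup>+\<omega>. G (\<lambda>r. X r \<omega>) * weight (inner_sets D) s (\<lambda>y. ennreal (\<phi> y)) x (\<lambda>r. X r \<omega>) \<partial>M)"
    using Gm wm[OF s(1)] by (simp add: nn_integral_cmult)
  finally show ?thesis
    using s unfolding swap[OF s(1)] by (subst swap)
      (auto simp: mult.assoc[symmetric] ennreal_mult[symmetric] exp_add[symmetric] algebra_simps)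
qed simp

lemma mart_expectation:
  assumes "x \<in> D" "0 < t"
  shows "(\<integral>\<^sup>+\<omega>. ennreal (mart x t (\<lambda>r. X r \<omega>)) \<partial>M) = ennreal (\<phi> x)"
proof -
  have wm: "(\<lambda>\<omega>. weight (inner_sets D) t (\<lambda>y. ennreal (\<phi> y)) x (\<lambda>t. X t \<omega>)) \<in> borel_measurable M"
    using assms by (intro measurable_weight closed_inner_sets) auto
  have "(\<integral>\<^sup>+\<omega>. ennreal (mart x t (\<lambda>r. X r \<omega>)) \<partial>M) =
     (\<integral>\<^sup>+\<omega>. ennreal (exp (lam * t)) * weight (inner_sets D) t (\<lambda>y. ennreal (\<phi> y)) x (\<lambda>t. X t \<omega>) \<partial>M)"
    using assms by (intro nn_integral_cong_AE mart_weight_AE) auto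
  also have "\<dots> = ennreal (exp (lam * t)) * T t (\<lambda>y. ennreal (\<phi> y)) x"
    using wm by (simp add: nn_integral_cmult semigroup_def)
  finally show ?thesis using T_\<phi>[OF assms(2)] by simp
qed

text \<open>Optional stopping at a time with finitely many values. The event that the index equals
  \<open>j\<close> belongs to the past, so on it the stopped value may be exchanged for the value at
  the final time \<open>t\<close>; the indicators of these events then add up to 1.\<close>

lemma mart_grid:
  fixes k :: nat
  assumes x: "x \<in> D" and t: "0 < t" and B: "open B"
  defines "\<sigma> \<equiv> \<lambda>\<omega>. real (grid_index B x t k (\<lambda>r. X r \<omega>)) * (t / 2 ^ k)"
  shows "(\<lambda>\<omega>. mart x (\<sigma> \<omega>) (\<lambda>r. X r \<omega>)) \<in> borel_measurable M"
    and "(\<integral>\<^sup>+\<omega>. ennreal (mart x (\<sigma> \<omega>) (\<lambda>r. X r \<omega>)) \<partial>M) = ennreal (\<phi> x)"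
proof -
  have [measurable]: "B \<in> sets borel" using B by simp
  have [measurable]: "(\<lambda>p. p r) \<in> borel_measurable (path_algebra :: (real \<Rightarrow> 'v) measure)" for r :: real
    by (rule measurable_path_component) measurable
  define ev where "ev j p \<longleftrightarrow> (\<forall>i\<in>{1..<j}. x + p (real i * (t / 2 ^ k)) \<notin> B) \<and> (x + p (real j * (t / 2 ^ k)) \<in> B \<or> j = 2 ^ k)"
    for j and p :: "real \<Rightarrow> 'v"
  define G where "G j p = (if ev j p then 1 else 0 :: real)" for j and p :: "real \<Rightarrow> 'v"
  have Gm[measurable]: "G j \<in> borel_measurable path_algebra" for j unfolding G_def ev_def by measurable
  have idx: "grid_index B x t k (\<lambda>r. X r \<omega>) = j \<longleftrightarrow> ev j (\<lambda>r. X r \<omega>)" if "j \<in> {1..2 ^ k}" for j \<omega>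
    unfolding ev_def using that by (intro grid_index_eq_iff) auto
  have sum: "f (grid_index B x t k (\<lambda>r. X r \<omega>)) = (\<Sum>j\<in>{1..2 ^ k}. G j (\<lambda>r. X r \<omega>) * f j)" for f :: "nat \<Rightarrow> real" and \<omega>
  proof -
    define J where "J = grid_index B x t k (\<lambda>r. X r \<omega>)"
    have J: "J \<in> {1..2 ^ k}" using grid_index(1,2)[of B x t k "\<lambda>r. X r \<omega>"] by (simp add: J_def)
    have "(\<Sum>j\<in>{1..2 ^ k}. G j (\<lambda>r. X r \<omega>) * f j) = (\<Sum>j\<in>{1..2 ^ k}. if j = J then f j else 0)"
      by (intro sum.cong) (auto simp: G_def idx[symmetric] J_def)
    also have "\<dots> = f J" using J by (simp add: sum.delta)
    finally show ?thesis by (simp add: J_def)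
  qed
  have eq: "mart x (\<sigma> \<omega>) (\<lambda>r. X r \<omega>) =
      (\<Sum>j\<in>{1..2 ^ k}. G j (\<lambda>r. X r \<omega>) * mart x (real j * (t / 2 ^ k)) (\<lambda>r. X r \<omega>))" for \<omega>
    unfolding \<sigma>_def by (rule sum[of "\<lambda>j. mart x (real j * (t / 2 ^ k)) (\<lambda>r. X r \<omega>)"])
  have mm: "(\<lambda>\<omega>. G j (\<lambda>r. X r \<omega>) * mart x r (\<lambda>r. X r \<omega>)) \<in> borel_measurable M" if "0 \<le> r" for j r
    using mart_meas[OF that] by measurable
  show "(\<lambda>\<omega>. mart x (\<sigma> \<omega>) (\<lambda>r. X r \<omega>)) \<in> borel_measurable M"
    unfolding eq using t by (intro borel_measurable_sum mm) auto
  have G0: "0 \<le> G j p" for j p by (simp add: G_def)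
  have "(\<integral>\<^sup>+\<omega>. ennreal (mart x (\<sigma> \<omega>) (\<lambda>r. X r \<omega>)) \<partial>M) =
      (\<integral>\<^sup>+\<omega>. (\<Sum>j\<in>{1..2 ^ k}. ennreal (G j (\<lambda>r. X r \<omega>) * mart x (real j * (t / 2 ^ k)) (\<lambda>r. X r \<omega>))) \<partial>M)"
    unfolding eq by (intro nn_integral_cong sum_ennreal[symmetric]) (simp add: G0 mart_nonneg)
  also have "\<dots> = (\<Sum>j\<in>{1..2 ^ k}. \<integral>\<^sup>+\<omega>. ennreal (G j (\<lambda>r. X r \<omega>) * mart x (real j * (t / 2 ^ k)) (\<lambda>r. X r \<omega>)) \<partial>M)"
    using t by (intro nn_integral_sum measurable_compose[OF mm measurable_ennreal]) auto
  also have "\<dots> = (\<Sum>j\<in>{1..2 ^ k}. \<integral>\<^sup>+\<omega>. ennreal (G j (\<lambda>r. X r \<omega>) * mart x t (\<lambda>r. X r \<omega>)) \<partial>M)"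
  proof (intro sum.cong refl)
    fix j :: nat assume j: "j \<in> {1..2 ^ k}"
    define s where "s = real j * (t / 2 ^ k)"
    have s: "0 \<le> s" "s \<le> t" unfolding s_def using j t by (simp, intro grid_time_le, simp_all)
    have past: "X (min (real i * (t / 2 ^ k)) s) \<omega> + X (real i * (t / 2 ^ k) - s) \<omega>' = X (real i * (t / 2 ^ k)) \<omega>"
      if "i \<le> j" for i \<omega> \<omega>'
    proof -
      have "real i * (t / 2 ^ k) \<le> s" unfolding s_def using that t by (intro mult_right_mono) auto
      then show ?thesis by (simp add: X_nonpos)
    qed
    have "ev j (\<lambda>r. X (min r s) \<omega> + X (r - s) \<omega>') = ev j (\<lambda>r. X r \<omega>)" for \<omega> \<omega>'
      unfolding ev_def using past by simp
    then have Gp: "ennreal (G j (\<lambda>r. X (min r s) \<omega> + X (r - s) \<omega>')) = ennreal (G j (\<lambda>r. X r \<omega>))" for \<omega> \<omega>'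
      unfolding G_def by simp
    have "(\<integral>\<^sup>+\<omega>. ennreal (G j (\<lambda>r. X r \<omega>)) * ennreal (mart x t (\<lambda>r. X r \<omega>)) \<partial>M) =
      (\<integral>\<^sup>+\<omega>. ennreal (G j (\<lambda>r. X r \<omega>)) * ennreal (mart x s (\<lambda>r. X r \<omega>)) \<partial>M)"
      by (rule mart_past[OF s, of "\<lambda>p. ennreal (G j p)"]) (use Gp in auto)
    then show "(\<integral>\<^sup>+\<omega>. ennreal (G j (\<lambda>r. X r \<omega>) * mart x (real j * (t / 2 ^ k)) (\<lambda>r. X r \<omega>)) \<partial>M) =
      (\<integral>\<^sup>+\<omega>. ennreal (G j (\<lambda>r. X r \<omega>) * mart x t (\<lambda>r. X r \<omega>)) \<partial>M)"
      unfolding s_def by (simp add: ennreal_mult G0 mart_nonneg)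
  qed
  also have "\<dots> = (\<integral>\<^sup>+\<omega>. (\<Sum>j\<in>{1..2 ^ k}. ennreal (G j (\<lambda>r. X r \<omega>) * mart x t (\<lambda>r. X r \<omega>))) \<partial>M)"
    using t by (intro nn_integral_sum[symmetric] measurable_compose[OF mm measurable_ennreal]) auto
  also have "\<dots> = (\<integral>\<^sup>+\<omega>. ennreal (mart x t (\<lambda>r. X r \<omega>)) \<partial>M)"
  proof (intro nn_integral_cong)
    fix \<omega>
    have "(\<Sum>j\<in>{1..2 ^ k}. ennreal (G j (\<lambda>r. X r \<omega>) * mart x t (\<lambda>r. X r \<omega>))) =
       ennreal (\<Sum>j\<in>{1..2 ^ k}. G j (\<lambda>r. X r \<omega>) * mart x t (\<lambda>r. X r \<omega>))"
      by (rule sum_ennreal) (simp add: G0 mart_nonneg)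
    also have "\<dots> = ennreal (mart x t (\<lambda>r. X r \<omega>))"
      using sum[of "\<lambda>_. mart x t (\<lambda>r. X r \<omega>)" \<omega>] by simp
    finally show "(\<Sum>j\<in>{1..2 ^ k}. ennreal (G j (\<lambda>r. X r \<omega>) * mart x t (\<lambda>r. X r \<omega>))) = ennreal (mart x t (\<lambda>r. X r \<omega>))" .
  qed
  also have "\<dots> = ennreal (\<phi> x)" by (rule mart_expectation[OF x t])
  finally show "(\<integral>\<^sup>+\<omega>. ennreal (mart x (\<sigma> \<omega>) (\<lambda>r. X r \<omega>)) \<partial>M) = ennreal (\<phi> x)" .
qed

text \<open>The grid times approach from above, so right-continuity applies, and a constant bound up
  to time \<open>t\<close> carries the mean value property to the limit.\<close>

lemma mart_stopped:
  assumes x: "x \<in> D" and t: "0 < t" and B: "open B"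
  shows "(\<lambda>\<omega>. mart x (stopped B x t (\<lambda>r. X r \<omega>)) (\<lambda>r. X r \<omega>)) \<in> borel_measurable M"
    and "(\<integral>\<^sup>+\<omega>. ennreal (mart x (stopped B x t (\<lambda>r. X r \<omega>)) (\<lambda>r. X r \<omega>)) \<partial>M) = ennreal (\<phi> x)"
proof -
  define \<sigma> where "\<sigma> k \<omega> = real (grid_index B x t k (\<lambda>r. X r \<omega>)) * (t / 2 ^ k)" for k \<omega>
  have m: "(\<lambda>\<omega>. mart x (\<sigma> k \<omega>) (\<lambda>r. X r \<omega>)) \<in> borel_measurable M" for k
    unfolding \<sigma>_def by (rule mart_grid(1)[OF x t B])
  have lim: "(\<lambda>k. mart x (\<sigma> k \<omega>) (\<lambda>r. X r \<omega>)) \<longlonglongrightarrow> mart x (stopped B x t (\<lambda>r. X r \<omega>)) (\<lambda>r. X r \<omega>)" for \<omega>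
    unfolding \<sigma>_def using t stopped_bounds[of t B x "\<lambda>r. X r \<omega>"]
    by (intro tendsto_at_right_seq[where f="\<lambda>r. mart x r (\<lambda>r. X r \<omega>)"] mart_rcont grid_stopped X_rcont B) auto
  show m': "(\<lambda>\<omega>. mart x (stopped B x t (\<lambda>r. X r \<omega>)) (\<lambda>r. X r \<omega>)) \<in> borel_measurable M"
    by (rule borel_measurable_LIMSEQ_real[OF lim m])
  obtain K where K: "0 \<le> K" "\<And>y. \<phi> y \<le> K" using \<phi>_bounded by blast
  have "(\<lambda>k. \<integral>\<^sup>+\<omega>. ennreal (mart x (\<sigma> k \<omega>) (\<lambda>r. X r \<omega>)) \<partial>M) \<longlonglongrightarrow>
      (\<integral>\<^sup>+\<omega>. ennreal (mart x (stopped B x t (\<lambda>r. X r \<omega>)) (\<lambda>r. X r \<omega>)) \<partial>M)"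
  proof (rule nn_integral_dominated_convergence[where w="\<lambda>_. ennreal (exp ((\<bar>lam\<bar> + C) * t) * K)"])
    show "AE \<omega> in M. ennreal (mart x (\<sigma> k \<omega>) (\<lambda>r. X r \<omega>)) \<le> ennreal (exp ((\<bar>lam\<bar> + C) * t) * K)" for k
      unfolding \<sigma>_def using grid_index(2) t
      by (intro AE_I2 ennreal_leI mart_bound X_rcont K grid_time_le) auto
    show "AE \<omega> in M. (\<lambda>k. ennreal (mart x (\<sigma> k \<omega>) (\<lambda>r. X r \<omega>))) \<longlonglongrightarrow>
        ennreal (mart x (stopped B x t (\<lambda>r. X r \<omega>)) (\<lambda>r. X r \<omega>))"
      using lim by (intro AE_I2 tendsto_ennrealI) auto
  qed (use m m' in \<open>auto simp: emeasure_space_1\<close>)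
  moreover have "(\<integral>\<^sup>+\<omega>. ennreal (mart x (\<sigma> k \<omega>) (\<lambda>r. X r \<omega>)) \<partial>M) = ennreal (\<phi> x)" for k
    unfolding \<sigma>_def by (rule mart_grid(2)[OF x t B])
  ultimately show "(\<integral>\<^sup>+\<omega>. ennreal (mart x (stopped B x t (\<lambda>r. X r \<omega>)) (\<lambda>r. X r \<omega>)) \<partial>M) = ennreal (\<phi> x)"
    by (simp add: LIMSEQ_const_iff)
qed

end

section \<open>Passage to an infinite horizon\<close>

context ground_state_target
begin

lemma hits_meas:
  assumes t: "0 < t"
  shows "{\<omega> \<in> space M. hits B x t (\<lambda>r. X r \<omega>)} \<in> sets M"
proof -
  have [measurable]: "B \<in> sets borel" using B by simp
  have "hits B x t (\<lambda>r. X r \<omega>) \<longleftrightarrow> (\<exists>q\<in>\<rat> \<inter> {0<..1}. x + X (q * t) \<omega> \<in> B)" for \<omega>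
  proof
    assume "hits B x t (\<lambda>r. X r \<omega>)"
    then obtain r where r: "0 < r" "r \<le> t" "x + X r \<omega> \<in> B" by (auto simp: hits_def)
    obtain q where "q \<in> \<rat>" "0 \<le> q" "q \<le> 1" "r > 0 \<Longrightarrow> q > 0" "x + X (q * t) \<omega> \<in> B"
      using rcont_hits_open_rational[OF X_rcont[of \<omega>] B(1) less_imp_le[OF r(1)] r(2,3)] by blast
    then show "\<exists>q\<in>\<rat> \<inter> {0<..1}. x + X (q * t) \<omega> \<in> B" using r(1) by auto
  next
    assume "\<exists>q\<in>\<rat> \<inter> {0<..1}. x + X (q * t) \<omega> \<in> B"
    then obtain q where q: "0 < q" "q \<le> 1" "x + X (q * t) \<omega> \<in> B" by auto
    have "q * t \<le> 1 * t" using q t by (intro mult_right_mono) auto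
    then show "hits B x t (\<lambda>r. X r \<omega>)" unfolding hits_def using q t by (intro exI[of _ "q * t"]) auto
  qed
  moreover have "countable (\<rat> \<inter> {0<..1} :: real set)" using countable_rat by blast
  ultimately show ?thesis by simp
qed

text \<open>At horizon \<open>Suc n\<close> the value \<open>\<phi> x\<close> splits into a part
  \<open>F1\<close> with a hit, which increases to \<open>F\<close>, and a part \<open>F2\<close>
  without one, which is dominated by \<open>u\<close> and therefore dies out.\<close>

lemma hitting_expectation:
  assumes x: "x \<in> D" "x \<notin> B"
  defines "F \<equiv> \<lambda>\<omega>. if \<exists>r>0. x + X r \<omega> \<in> B then mart x (hit_time B x (\<lambda>r. X r \<omega>)) (\<lambda>r. X r \<omega>) else 0"
  shows "F \<in> borel_measurable M" and "(\<integral>\<^sup>+\<omega>. ennreal (F \<omega>) \<partial>M) = ennreal (\<phi> x)"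
proof -
  define H where "H n \<omega> \<longleftrightarrow> hits B x (real (Suc n)) (\<lambda>r. X r \<omega>)" for n \<omega>
  have Hm[measurable]: "Measurable.pred M (H n)" for n
    using hits_meas[of "real (Suc n)" x] unfolding H_def pred_def by simp
  define F1 where "F1 n \<omega> = (if H n \<omega> then mart x (hit_time B x (\<lambda>r. X r \<omega>)) (\<lambda>r. X r \<omega>) else 0)" for n \<omega>
  define F2 where "F2 n \<omega> = (if H n \<omega> then 0 else mart x (real (Suc n)) (\<lambda>r. X r \<omega>))" for n \<omega>
  have st: "mart x (stopped B x (real (Suc n)) (\<lambda>r. X r \<omega>)) (\<lambda>r. X r \<omega>) = F1 n \<omega> + F2 n \<omega>" for n \<omega>
    unfolding stopped_def F1_def F2_def H_def by simp
  have pos: "0 \<le> F1 n \<omega>" "0 \<le> F2 n \<omega>" for n \<omega> by (auto simp: F1_def F2_def mart_nonneg)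
  have F1m[measurable]: "F1 n \<in> borel_measurable M" for n
  proof -
    have [measurable]: "(\<lambda>\<omega>. F1 n \<omega> + F2 n \<omega>) \<in> borel_measurable M"
      using mart_stopped(1)[OF x(1) _ B(1), of "real (Suc n)"] unfolding st by simp
    \<comment> \<open>On \<open>H n\<close> this is the stopped value, already known to be
      measurable; the hitting time itself is not examined.\<close>
    have "F1 n = (\<lambda>\<omega>. if H n \<omega> then F1 n \<omega> + F2 n \<omega> else 0)" by (auto simp: F1_def F2_def fun_eq_iff)
    also have "\<dots> \<in> borel_measurable M" by measurable
    finally show ?thesis .
  qed
  have F2m[measurable]: "F2 n \<in> borel_measurable M" for n
    unfolding F2_def[abs_def] using mart_meas[of "real (Suc n)" x] by measurable
  have sum: "(\<integral>\<^sup>+\<omega>. ennreal (F1 n \<omega>) \<partial>M) + (\<integral>\<^sup>+\<omega>. ennreal (F2 n \<omega>) \<partial>M) = ennreal (\<phi> x)" for n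
    using mart_stopped(2)[OF x(1) _ B(1), of "real (Suc n)"] unfolding st
    by (subst nn_integral_add[symmetric]) (auto simp: pos)
  have F1_lim: "(\<lambda>n. F1 n \<omega>) \<longlonglongrightarrow> F \<omega>" for \<omega>
  proof (cases "\<exists>r>0. x + X r \<omega> \<in> B")
    case True
    then obtain r where r: "r > 0" "x + X r \<omega> \<in> B" by blast
    obtain N where N: "r \<le> real N" using real_arch_simple by blast
    have "H n \<omega>" if "n \<ge> N" for n using r N that unfolding H_def hits_def by (intro exI[of _ r]) auto
    then have "eventually (\<lambda>n. F1 n \<omega> = F \<omega>) sequentially"
      unfolding eventually_sequentially using True by (intro exI[of _ N]) (auto simp: F1_def F_def)
    then show ?thesis by (rule tendsto_eventually)
  next
    case False
    then have "F1 n \<omega> = F \<omega>" for n by (auto simp: F1_def F_def H_def hits_def)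
    then show ?thesis by simp
  qed
  show Fm: "F \<in> borel_measurable M" by (rule borel_measurable_LIMSEQ_real[OF F1_lim F1m])
  have "(\<lambda>n. \<integral>\<^sup>+\<omega>. ennreal (F1 n \<omega>) \<partial>M) \<longlonglongrightarrow> (\<integral>\<^sup>+\<omega>. ennreal (F \<omega>) \<partial>M)"
  proof (rule nn_integral_LIMSEQ)
    show "incseq (\<lambda>n \<omega>. ennreal (F1 n \<omega>))"
    proof (rule incseq_SucI, rule le_funI, rule ennreal_leI)
      fix n \<omega>
      have "H n \<omega> \<Longrightarrow> H (Suc n) \<omega>" unfolding H_def hits_def by force
      then show "F1 n \<omega> \<le> F1 (Suc n) \<omega>" by (auto simp: F1_def mart_nonneg)
    qed
  qed (use F1_lim in \<open>auto intro: tendsto_ennrealI\<close>)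
  moreover have "(\<lambda>n. \<integral>\<^sup>+\<omega>. ennreal (F2 n \<omega>) \<partial>M) \<longlonglongrightarrow> 0"
  proof (rule tendsto_sandwich[OF _ _ tendsto_const LIMSEQ_Suc[OF u_tendsto_0[of x]]])
    have "(\<integral>\<^sup>+\<omega>. ennreal (F2 n \<omega>) \<partial>M) \<le> u (real (Suc n)) x" for n
    proof -
      have wm: "(\<lambda>\<omega>. weight (\<lambda>n. inner_sets D n - B) (real (Suc n)) (\<lambda>y. ennreal (\<phi> y)) x (\<lambda>t. X t \<omega>)) \<in> borel_measurable M"
        by (intro measurable_weight closed_target) auto
      have "(\<integral>\<^sup>+\<omega>. ennreal (F2 n \<omega>) \<partial>M) \<le> (\<integral>\<^sup>+\<omega>. ennreal (exp (lam * real (Suc n))) *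
          weight (\<lambda>n. inner_sets D n - B) (real (Suc n)) (\<lambda>y. ennreal (\<phi> y)) x (\<lambda>t. X t \<omega>) \<partial>M)"
      proof (rule nn_integral_mono_AE)
        have "AE \<omega> in M. ennreal (mart x (real (Suc n)) (\<lambda>t. X t \<omega>)) = ennreal (exp (lam * real (Suc n))) *
           weight (inner_sets D) (real (Suc n)) (\<lambda>y. ennreal (\<phi> y)) x (\<lambda>t. X t \<omega>)"
          by (rule mart_weight_AE) simp
        then show "AE \<omega> in M. ennreal (F2 n \<omega>) \<le> ennreal (exp (lam * real (Suc n))) *
          weight (\<lambda>n. inner_sets D n - B) (real (Suc n)) (\<lambda>y. ennreal (\<phi> y)) x (\<lambda>t. X t \<omega>)"
        proof eventually_elim
          fix \<omega> assume eq: "ennreal (mart x (real (Suc n)) (\<lambda>t. X t \<omega>)) = ennreal (exp (lam * real (Suc n))) *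
            weight (inner_sets D) (real (Suc n)) (\<lambda>y. ennreal (\<phi> y)) x (\<lambda>t. X t \<omega>)"
          show "ennreal (F2 n \<omega>) \<le> ennreal (exp (lam * real (Suc n))) *
            weight (\<lambda>n. inner_sets D n - B) (real (Suc n)) (\<lambda>y. ennreal (\<phi> y)) x (\<lambda>t. X t \<omega>)"
          proof (cases "H n \<omega>")
            case False
            \<comment> \<open>\<open>hits\<close> ignores time 0; the hypothesis
              \<open>x \<notin> B\<close> closes that gap.\<close>
            have "x + X r \<omega> \<notin> B" if "r \<in> {0..real (Suc n)}" for r
            proof (cases "r = 0")
              case True then show ?thesis using x(2) by (simp add: X_nonpos)
            next
              case False
              then have "0 < r" "r \<le> real (Suc n)" using that by auto
              then show ?thesis using \<open>\<not> H n \<omega>\<close> unfolding H_def hits_def by blast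
            qed
            then have "stays (inner_sets D) x (real (Suc n)) (\<lambda>t. X t \<omega>) =
               stays (\<lambda>n. inner_sets D n - B) x (real (Suc n)) (\<lambda>t. X t \<omega>)"
              unfolding stays_def by simp
            then have "weight (inner_sets D) (real (Suc n)) (\<lambda>y. ennreal (\<phi> y)) x (\<lambda>t. X t \<omega>) =
               weight (\<lambda>n. inner_sets D n - B) (real (Suc n)) (\<lambda>y. ennreal (\<phi> y)) x (\<lambda>t. X t \<omega>)"
              unfolding weight_def by simp
            then show ?thesis using False eq by (simp add: F2_def)
          qed (simp add: F2_def)
        qed
      qed
      also have "\<dots> = u (real (Suc n)) x"
        unfolding u_def semigroup_def by (rule nn_integral_cmult[OF wm])
      finally show ?thesis .
    qed
    then show "eventually (\<lambda>n. (\<integral>\<^sup>+\<omega>. ennreal (F2 n \<omega>) \<partial>M) \<le> u (real (Suc n)) x) sequentially"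
      by (intro always_eventually) auto
  qed auto
  ultimately have "(\<lambda>n. (\<integral>\<^sup>+\<omega>. ennreal (F1 n \<omega>) \<partial>M) + (\<integral>\<^sup>+\<omega>. ennreal (F2 n \<omega>) \<partial>M)) \<longlonglongrightarrow>
     (\<integral>\<^sup>+\<omega>. ennreal (F \<omega>) \<partial>M) + 0" by (rule tendsto_add)
  then show "(\<integral>\<^sup>+\<omega>. ennreal (F \<omega>) \<partial>M) = ennreal (\<phi> x)"
    unfolding sum by (simp add: LIMSEQ_const_iff)
qed

end

section \<open>Uniqueness of characteristic functions\<close>

definition std_gauss :: "'v::euclidean_space \<Rightarrow> real" where
  "std_gauss x = (\<Prod>b\<in>Basis. std_normal_density (x \<bullet> b))"

lemma std_gauss_meas [measurable]: "std_gauss \<in> borel_measurable borel"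
  unfolding std_gauss_def[abs_def] by measurable

lemma std_gauss_nonneg: "0 \<le> std_gauss x"
  unfolding std_gauss_def by (intro prod_nonneg) simp

text \<open>Up to the constant \<open>std_gauss 0\<close>, the Gaussian density is the
  characteristic function of the Gaussian law. This self-duality drives the inversion below.\<close>

lemma std_gauss_eq: "std_gauss x = std_gauss (0::'v) * exp (- (norm x)\<^sup>2 / 2)" for x :: "'v::euclidean_space"
proof -
  have "std_normal_density y = std_normal_density 0 * exp (- y\<^sup>2 / 2)" for y
    by (simp add: std_normal_density_def)
  then have "std_gauss x = (\<Prod>b\<in>(Basis::'v set). std_normal_density 0 * exp (- (x \<bullet> b)\<^sup>2 / 2))"
    unfolding std_gauss_def by metis
  also have "\<dots> = std_gauss (0::'v) * exp (\<Sum>b\<in>(Basis::'v set). - (x \<bullet> b)\<^sup>2 / 2)"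
    unfolding prod.distrib std_gauss_def by (simp add: exp_sum)
  also have "(\<Sum>b\<in>(Basis::'v set). - (x \<bullet> b)\<^sup>2 / 2) = - (norm x)\<^sup>2 / 2"
    unfolding power2_norm_eq_inner euclidean_inner[of x x]
    by (simp add: sum_negf sum_divide_distrib power2_eq_square)
  finally show ?thesis .
qed

definition gauss_measure :: "'v::euclidean_space measure" where
  "gauss_measure = density lborel (\<lambda>x. ennreal (std_gauss x))"

lemma sets_gauss [simp, measurable_cong]: "sets gauss_measure = sets borel"
  and space_gauss [simp]: "space gauss_measure = UNIV"
  by (simp_all add: gauss_measure_def)

lemma lborel_eq_PiM:
  "(lborel :: 'v::euclidean_space measure) = distr (PiM Basis (\<lambda>_. lborel)) borel (\<lambda>f. \<Sum>b\<in>Basis. f b *\<^sub>R b)"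
  unfolding lborel_eq_real by (rule lborel_def)

lemma prob_space_gauss: "prob_space (gauss_measure :: 'v::euclidean_space measure)"
proof
  interpret P: product_sigma_finite "\<lambda>_::'v. lborel :: real measure" ..
  have "emeasure gauss_measure (space gauss_measure :: 'v set) = (\<integral>\<^sup>+x. ennreal (std_gauss (x::'v)) \<partial>lborel)"
    by (simp add: gauss_measure_def emeasure_density)
  also have "\<dots> = (\<integral>\<^sup>+f. ennreal (std_gauss (\<Sum>b\<in>Basis. f b *\<^sub>R b :: 'v)) \<partial>PiM Basis (\<lambda>_. lborel))"
    by (subst lborel_eq_PiM, subst nn_integral_distr) auto
  also have "\<dots> = (\<integral>\<^sup>+f. (\<Prod>b\<in>(Basis::'v set). ennreal (std_normal_density (f b))) \<partial>PiM Basis (\<lambda>_. lborel))"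
    by (intro nn_integral_cong) (simp add: std_gauss_def prod_ennreal)
  also have "\<dots> = (\<Prod>b\<in>(Basis::'v set). \<integral>\<^sup>+x. ennreal (std_normal_density x) \<partial>lborel)"
    by (rule P.product_nn_integral_prod) auto
  also have "(\<integral>\<^sup>+x. ennreal (std_normal_density x) \<partial>lborel) = 1"
    using prob_space.emeasure_space_1[OF prob_space_normal_density[of 1 0]] by (simp add: emeasure_density)
  finally show "emeasure gauss_measure (space gauss_measure :: 'v set) = 1" by simp
qed

lemma char_gauss:
  fixes \<xi> :: "'v::euclidean_space"
  shows "(LINT x|gauss_measure. exp (\<i> * complex_of_real (\<xi> \<bullet> x))) = complex_of_real (exp (- (norm \<xi>)\<^sup>2 / 2))"
proof -
  interpret P: product_sigma_finite "\<lambda>_::'v. lborel :: real measure" ..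
  have one: "(LINT y|lborel. of_real (std_normal_density y) * exp (\<i> * complex_of_real (a * y))) =
      complex_of_real (exp (- a\<^sup>2 / 2))"
    and int: "integrable lborel (\<lambda>y. of_real (std_normal_density y) * exp (\<i> * complex_of_real (a * y)))" for a
  proof -
    have "(LINT y|lborel. of_real (std_normal_density y) * exp (\<i> * complex_of_real (a * y))) =
       (LINT y|density lborel std_normal_density. iexp (a * y))"
      by (subst integral_density) (auto simp: scaleR_conv_of_real)
    also have "\<dots> = complex_of_real (exp (- a\<^sup>2 / 2))"
      using char_std_normal_distribution by (simp add: char_def fun_eq_iff)
    finally show "(LINT y|lborel. of_real (std_normal_density y) * exp (\<i> * complex_of_real (a * y))) =
      complex_of_real (exp (- a\<^sup>2 / 2))" .
    show "integrable lborel (\<lambda>y. of_real (std_normal_density y) * exp (\<i> * complex_of_real (a * y)))"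
      by (rule Bochner_Integration.integrable_bound[OF integrable_normal_density[of 1 0]])
         (auto simp: norm_mult)
  qed
  have "(LINT x|gauss_measure. exp (\<i> * complex_of_real (\<xi> \<bullet> x))) =
     (LINT x|lborel. of_real (std_gauss x) * exp (\<i> * complex_of_real (\<xi> \<bullet> x)))"
    unfolding gauss_measure_def by (subst integral_density) (auto simp: scaleR_conv_of_real std_gauss_nonneg)
  also have "\<dots> = (LINT f|PiM Basis (\<lambda>_. lborel). of_real (std_gauss (\<Sum>b\<in>Basis. f b *\<^sub>R b :: 'v)) *
      exp (\<i> * complex_of_real (\<xi> \<bullet> (\<Sum>b\<in>Basis. f b *\<^sub>R b))))"
    by (subst lborel_eq_PiM, subst integral_distr) auto
  also have "\<dots> = (LINT f|PiM Basis (\<lambda>_. lborel).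
      (\<Prod>b\<in>Basis. of_real (std_normal_density (f b)) * exp (\<i> * complex_of_real ((\<xi> \<bullet> b) * f b))))"
  proof (intro Bochner_Integration.integral_cong refl)
    fix f :: "'v \<Rightarrow> real"
    have "\<xi> \<bullet> (\<Sum>b\<in>Basis. f b *\<^sub>R b) = (\<Sum>b\<in>Basis. (\<xi> \<bullet> b) * f b)"
      by (simp add: inner_sum_right mult.commute)
    then show "of_real (std_gauss (\<Sum>b\<in>Basis. f b *\<^sub>R b :: 'v)) * exp (\<i> * complex_of_real (\<xi> \<bullet> (\<Sum>b\<in>Basis. f b *\<^sub>R b))) =
       (\<Prod>b\<in>Basis. of_real (std_normal_density (f b)) * exp (\<i> * complex_of_real ((\<xi> \<bullet> b) * f b)))"
      by (simp add: std_gauss_def prod.distrib exp_sum sum_distrib_left)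
  qed
  also have "\<dots> = (\<Prod>b\<in>Basis. LINT y|lborel. of_real (std_normal_density y) * exp (\<i> * complex_of_real ((\<xi> \<bullet> b) * y)))"
    by (rule P.product_integral_prod, simp, rule int)
  also have "\<dots> = (\<Prod>b\<in>Basis. complex_of_real (exp (- (\<xi> \<bullet> b)\<^sup>2 / 2)))" by (simp only: one)
  also have "\<dots> = complex_of_real (exp (\<Sum>b\<in>Basis. - (\<xi> \<bullet> b)\<^sup>2 / 2))" by (simp add: exp_sum)
  also have "(\<Sum>b\<in>Basis. - (\<xi> \<bullet> b)\<^sup>2 / 2) = - (norm \<xi>)\<^sup>2 / 2"
    unfolding power2_norm_eq_inner euclidean_inner[of \<xi> \<xi>]
    by (simp add: sum_negf sum_divide_distrib power2_eq_square)
  finally show ?thesis .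
qed

text \<open>Smoothing with a Gaussian of width \<open>\<sigma>\<close> produces a density, by the
  substitution \<open>y = x + \<sigma> *\<^sub>R v\<close>. The density depends on
  \<open>\<mu>\<close> only through integrals of the Gaussian kernel.\<close>

lemma nn_integral_smoothed:
  fixes f :: "'v::euclidean_space \<Rightarrow> ennreal"
  assumes \<mu>: "prob_space \<mu>" and [simp, measurable_cong]: "sets \<mu> = sets borel"
    and f[measurable]: "f \<in> borel_measurable borel" and \<sigma>: "0 < \<sigma>"
  shows "(\<integral>\<^sup>+x. \<integral>\<^sup>+v. f (x + \<sigma> *\<^sub>R v) \<partial>gauss_measure \<partial>\<mu>) =
    (\<integral>\<^sup>+y. f y * ennreal ((1 / \<sigma>) ^ DIM('v)) * (\<integral>\<^sup>+x. ennreal (std_gauss ((1 / \<sigma>) *\<^sub>R (y - x))) \<partial>\<mu>) \<partial>lborel)"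
proof -
  interpret \<mu>: prob_space \<mu> by fact
  interpret LM: pair_sigma_finite \<mu> "lborel :: 'v measure" ..
  have "(\<integral>\<^sup>+x. \<integral>\<^sup>+v. f (x + \<sigma> *\<^sub>R v) \<partial>gauss_measure \<partial>\<mu>) =
     (\<integral>\<^sup>+x. \<integral>\<^sup>+y. f y * ennreal ((1 / \<sigma>) ^ DIM('v)) * ennreal (std_gauss ((1 / \<sigma>) *\<^sub>R (y - x))) \<partial>lborel \<partial>\<mu>)"
  proof (rule nn_integral_cong)
    fix x
    have "(\<integral>\<^sup>+v. f (x + \<sigma> *\<^sub>R v) \<partial>gauss_measure) = (\<integral>\<^sup>+v. ennreal (std_gauss v) * f (x + \<sigma> *\<^sub>R v) \<partial>lborel)"
      unfolding gauss_measure_def by (subst nn_integral_density) auto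
    also have "\<dots> = (\<integral>\<^sup>+v. ennreal (std_gauss v) * f (x + \<sigma> *\<^sub>R v)
       \<partial>density (distr lborel borel (\<lambda>y. (- (1 / \<sigma>)) *\<^sub>R x + (1 / \<sigma>) *\<^sub>R y)) (\<lambda>_. ennreal (\<bar>1 / \<sigma>\<bar> ^ DIM('v))))"
      by (subst lborel_affine[of "1 / \<sigma>" "(- (1 / \<sigma>)) *\<^sub>R x"]) (use \<sigma> in auto)
    also have "\<dots> = (\<integral>\<^sup>+y. ennreal (\<bar>1 / \<sigma>\<bar> ^ DIM('v)) * (ennreal (std_gauss ((- (1 / \<sigma>)) *\<^sub>R x + (1 / \<sigma>) *\<^sub>R y)) *
        f (x + \<sigma> *\<^sub>R ((- (1 / \<sigma>)) *\<^sub>R x + (1 / \<sigma>) *\<^sub>R y))) \<partial>lborel)"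
      by (subst nn_integral_density, simp_all, subst nn_integral_distr) auto
    also have "\<dots> = (\<integral>\<^sup>+y. f y * ennreal ((1 / \<sigma>) ^ DIM('v)) * ennreal (std_gauss ((1 / \<sigma>) *\<^sub>R (y - x))) \<partial>lborel)"
    proof (rule nn_integral_cong)
      fix y
      have "x + \<sigma> *\<^sub>R ((- (1 / \<sigma>)) *\<^sub>R x + (1 / \<sigma>) *\<^sub>R y) = y" using \<sigma> by (simp add: scaleR_add_right scaleR_diff_right)
      moreover have "(- (1 / \<sigma>)) *\<^sub>R x + (1 / \<sigma>) *\<^sub>R y = (1 / \<sigma>) *\<^sub>R (y - x)" by (simp add: scaleR_diff_right)
      moreover have "\<bar>1 / \<sigma>\<bar> = 1 / \<sigma>" using \<sigma> by simp
      ultimately show "ennreal (\<bar>1 / \<sigma>\<bar> ^ DIM('v)) * (ennreal (std_gauss ((- (1 / \<sigma>)) *\<^sub>R x + (1 / \<sigma>) *\<^sub>R y)) *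
        f (x + \<sigma> *\<^sub>R ((- (1 / \<sigma>)) *\<^sub>R x + (1 / \<sigma>) *\<^sub>R y))) =
        f y * ennreal ((1 / \<sigma>) ^ DIM('v)) * ennreal (std_gauss ((1 / \<sigma>) *\<^sub>R (y - x)))"
        by (simp only: mult_ac)
    qed
    finally show "(\<integral>\<^sup>+v. f (x + \<sigma> *\<^sub>R v) \<partial>gauss_measure) =
      (\<integral>\<^sup>+y. f y * ennreal ((1 / \<sigma>) ^ DIM('v)) * ennreal (std_gauss ((1 / \<sigma>) *\<^sub>R (y - x))) \<partial>lborel)" .
  qed
  also have "\<dots> = (\<integral>\<^sup>+y. \<integral>\<^sup>+x. f y * ennreal ((1 / \<sigma>) ^ DIM('v)) * ennreal (std_gauss ((1 / \<sigma>) *\<^sub>R (y - x))) \<partial>\<mu> \<partial>lborel)"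
    by (rule LM.Fubini'[symmetric]) measurable
  also have "\<dots> = (\<integral>\<^sup>+y. f y * ennreal ((1 / \<sigma>) ^ DIM('v)) * (\<integral>\<^sup>+x. ennreal (std_gauss ((1 / \<sigma>) *\<^sub>R (y - x))) \<partial>\<mu>) \<partial>lborel)"
    by (intro nn_integral_cong nn_integral_cmult) measurable
  finally show ?thesis .
qed

text \<open>Writing the kernel as a characteristic function and exchanging the integrals leaves the
  characteristic function of \<open>\<mu>\<close> at the points
  \<open>(- c) *\<^sub>R w\<close>.\<close>

lemma integral_gauss_kernel:
  fixes y :: "'v::euclidean_space"
  assumes \<mu>: "prob_space \<mu>" and [simp, measurable_cong]: "sets \<mu> = sets borel"
  shows "complex_of_real (LINT x|\<mu>. std_gauss (c *\<^sub>R (y - x))) = of_real (std_gauss (0::'v)) *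
    (LINT w|gauss_measure. exp (\<i> * of_real (w \<bullet> (c *\<^sub>R y))) * (LINT x|\<mu>. exp (\<i> * of_real (((- c) *\<^sub>R w) \<bullet> x))))"
proof -
  interpret \<mu>: prob_space \<mu> by fact
  interpret G: prob_space "gauss_measure :: 'v measure" by (rule prob_space_gauss)
  interpret GM: pair_prob_space "gauss_measure :: 'v measure" \<mu> ..
  define h where "h w x = exp (\<i> * of_real (w \<bullet> (c *\<^sub>R (y - x))))" for w x :: 'v
  have h_meas: "(\<lambda>p. h (fst p) (snd p)) \<in> borel_measurable (gauss_measure \<Otimes>\<^sub>M \<mu>)"
    unfolding h_def by measurable
  have h_int: "integrable (gauss_measure \<Otimes>\<^sub>M \<mu>) (\<lambda>(w, x). h w x)"
    using h_meas by (intro GM.P.integrable_const_bound[where B=1]) (auto simp: h_def split_beta')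
  have "complex_of_real (std_gauss (c *\<^sub>R (y - x))) = of_real (std_gauss (0::'v)) * (LINT w|gauss_measure. h w x)" for x
    using char_gauss[of "c *\<^sub>R (y - x)"] std_gauss_eq[of "c *\<^sub>R (y - x)"]
    by (simp add: h_def inner_commute)
  then have "complex_of_real (LINT x|\<mu>. std_gauss (c *\<^sub>R (y - x))) =
      of_real (std_gauss (0::'v)) * (LINT x|\<mu>. LINT w|gauss_measure. h w x)"
    by (simp flip: integral_complex_of_real)
  also have "(LINT x|\<mu>. LINT w|gauss_measure. h w x) = (LINT w|gauss_measure. LINT x|\<mu>. h w x)"
    by (rule GM.Fubini_integral[OF h_int])
  also have "\<dots> = (LINT w|gauss_measure. exp (\<i> * of_real (w \<bullet> (c *\<^sub>R y))) * (LINT x|\<mu>. exp (\<i> * of_real (((- c) *\<^sub>R w) \<bullet> x))))"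
  proof (intro Bochner_Integration.integral_cong refl)
    fix w
    have "h w x = exp (\<i> * of_real (w \<bullet> (c *\<^sub>R y))) * exp (\<i> * of_real (((- c) *\<^sub>R w) \<bullet> x))" for x
      unfolding h_def by (simp add: exp_add[symmetric] algebra_simps inner_diff_right)
    then show "(LINT x|\<mu>. h w x) = exp (\<i> * of_real (w \<bullet> (c *\<^sub>R y))) * (LINT x|\<mu>. exp (\<i> * of_real (((- c) *\<^sub>R w) \<bullet> x)))"
      by simp
  qed
  finally show ?thesis .
qed

text \<open>Dominated convergence, first in the Gaussian variable and then under
  \<open>\<mu>\<close>.\<close>

lemma nn_integral_smoothed_tendsto:
  fixes f :: "'v::euclidean_space \<Rightarrow> real"
  assumes \<mu>: "prob_space \<mu>" and [simp, measurable_cong]: "sets \<mu> = sets borel"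
    and f: "continuous_on UNIV f" "\<And>x. 0 \<le> f x" "\<And>x. f x \<le> 1"
  shows "(\<lambda>n. \<integral>\<^sup>+x. \<integral>\<^sup>+v. ennreal (f (x + inverse (real (Suc n)) *\<^sub>R v)) \<partial>gauss_measure \<partial>\<mu>) \<longlonglongrightarrow> (\<integral>\<^sup>+x. ennreal (f x) \<partial>\<mu>)"
proof -
  interpret \<mu>: prob_space \<mu> by fact
  interpret G: prob_space "gauss_measure :: 'v measure" by (rule prob_space_gauss)
  have [measurable]: "f \<in> borel_measurable borel" using f(1) by (rule borel_measurable_continuous_onI)
  have inner: "(\<lambda>n. \<integral>\<^sup>+v. ennreal (f (x + inverse (real (Suc n)) *\<^sub>R v)) \<partial>gauss_measure) \<longlonglongrightarrow> ennreal (f x)" for x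
  proof -
    have "(\<lambda>n. \<integral>\<^sup>+v. ennreal (f (x + inverse (real (Suc n)) *\<^sub>R v)) \<partial>gauss_measure) \<longlonglongrightarrow>
        (\<integral>\<^sup>+v. ennreal (f x) \<partial>(gauss_measure :: 'v measure))"
    proof (rule nn_integral_dominated_convergence[where w="\<lambda>_. 1"])
      have "(\<lambda>n. f (x + inverse (real (Suc n)) *\<^sub>R v)) \<longlonglongrightarrow> f x" for v
      proof (rule isCont_tendsto_compose[of x f])
        show "isCont f x" using f(1) by (simp add: continuous_on_eq_continuous_at)
        have "(\<lambda>n. x + inverse (real (Suc n)) *\<^sub>R v) \<longlonglongrightarrow> x + 0 *\<^sub>R v"
          by (intro tendsto_intros LIMSEQ_inverse_real_of_nat)
        then show "(\<lambda>n. x + inverse (real (Suc n)) *\<^sub>R v) \<longlonglongrightarrow> x" by simp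
      qed
      then show "AE v in (gauss_measure :: 'v measure). (\<lambda>n. ennreal (f (x + inverse (real (Suc n)) *\<^sub>R v))) \<longlonglongrightarrow> ennreal (f x)"
        by (intro AE_I2 tendsto_ennrealI)
    qed (use f in \<open>auto simp: G.emeasure_space_1[simplified]\<close>)
    then show ?thesis using G.emeasure_space_1 by simp
  qed
  show ?thesis
  proof (rule nn_integral_dominated_convergence[where w="\<lambda>_. 1"])
    show "AE x in \<mu>. (\<lambda>n. \<integral>\<^sup>+v. ennreal (f (x + inverse (real (Suc n)) *\<^sub>R v)) \<partial>gauss_measure) \<longlonglongrightarrow> ennreal (f x)"
      using inner by simp
    have "(\<integral>\<^sup>+v. ennreal (f (x + inverse (real (Suc n)) *\<^sub>R v)) \<partial>gauss_measure) \<le> (\<integral>\<^sup>+v. 1 \<partial>(gauss_measure :: 'v measure))" for n x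
      using f(3) by (intro nn_integral_mono) simp
    then show "AE x in \<mu>. (\<integral>\<^sup>+v. ennreal (f (x + inverse (real (Suc n)) *\<^sub>R v)) \<partial>gauss_measure) \<le> 1" for n
      using G.emeasure_space_1 by simp
  qed (auto simp: \<mu>.emeasure_space_1)
qed

text \<open>Equal characteristic functions give equal kernel integrals, hence equal smoothed laws.
  As the smoothing vanishes, integrals of continuous functions agree, then masses of open sets,
  which form a generating pi-system.\<close>

theorem char_unique_euclidean:
  fixes \<mu> \<nu> :: "'v::euclidean_space measure"
  assumes \<mu>: "prob_space \<mu>" and s\<mu>[simp, measurable_cong]: "sets \<mu> = sets borel"
    and \<nu>: "prob_space \<nu>" and s\<nu>[simp, measurable_cong]: "sets \<nu> = sets borel"
    and char: "\<And>\<xi>. (LINT x|\<mu>. exp (\<i> * complex_of_real (\<xi> \<bullet> x))) = (LINT x|\<nu>. exp (\<i> * complex_of_real (\<xi> \<bullet> x)))"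
  shows "\<mu> = \<nu>"
proof -
  interpret \<mu>: prob_space \<mu> by fact
  interpret \<nu>: prob_space \<nu> by fact
  have bnd: "std_gauss z \<le> std_gauss (0::'v)" for z :: 'v
    by (subst std_gauss_eq) (simp add: mult_left_le std_gauss_nonneg)
  have kernel: "(\<integral>\<^sup>+x. ennreal (std_gauss (c *\<^sub>R (y - x))) \<partial>\<mu>) = (\<integral>\<^sup>+x. ennreal (std_gauss (c *\<^sub>R (y - x))) \<partial>\<nu>)" for c and y :: 'v
  proof -
    have "complex_of_real (LINT x|\<mu>. std_gauss (c *\<^sub>R (y - x))) = complex_of_real (LINT x|\<nu>. std_gauss (c *\<^sub>R (y - x)))"
      by (simp only: integral_gauss_kernel[OF \<mu> s\<mu>] integral_gauss_kernel[OF \<nu> s\<nu>] char)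
    then have "(LINT x|\<mu>. std_gauss (c *\<^sub>R (y - x))) = (LINT x|\<nu>. std_gauss (c *\<^sub>R (y - x)))" by simp
    moreover have "integrable \<mu> (\<lambda>x. std_gauss (c *\<^sub>R (y - x)))"
      by (rule \<mu>.integrable_const_bound[where B="std_gauss (0::'v)"]) (auto simp: bnd std_gauss_nonneg)
    moreover have "integrable \<nu> (\<lambda>x. std_gauss (c *\<^sub>R (y - x)))"
      by (rule \<nu>.integrable_const_bound[where B="std_gauss (0::'v)"]) (auto simp: bnd std_gauss_nonneg)
    ultimately show ?thesis by (simp add: nn_integral_eq_integral std_gauss_nonneg)
  qed
  have cont: "(\<integral>\<^sup>+x. ennreal (f x) \<partial>\<mu>) = (\<integral>\<^sup>+x. ennreal (f x) \<partial>\<nu>)"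
    if f: "continuous_on UNIV f" "\<And>x. 0 \<le> f x" "\<And>x. f x \<le> 1" for f
  proof -
    have [measurable]: "f \<in> borel_measurable borel" using f(1) by (rule borel_measurable_continuous_onI)
    have eq: "(\<integral>\<^sup>+x. \<integral>\<^sup>+v. ennreal (f (x + inverse (real (Suc n)) *\<^sub>R v)) \<partial>gauss_measure \<partial>\<mu>) =
       (\<integral>\<^sup>+x. \<integral>\<^sup>+v. ennreal (f (x + inverse (real (Suc n)) *\<^sub>R v)) \<partial>gauss_measure \<partial>\<nu>)" for n
      by (subst (1 2) nn_integral_smoothed[where f="\<lambda>x. ennreal (f x)"]) (auto simp: \<mu> \<nu> kernel simp del: of_nat_Suc)
    show ?thesis
      using nn_integral_smoothed_tendsto[OF \<mu> s\<mu> f] nn_integral_smoothed_tendsto[OF \<nu> s\<nu> f]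
      unfolding eq by (rule LIMSEQ_unique)
  qed
  have open_eq: "emeasure \<mu> U = emeasure \<nu> U" if U: "open U" for U
  \<comment> \<open>For the whole space the distance to the empty complement is 0 and the
    approximating functions below would vanish.\<close>
  proof (cases "U = UNIV")
    case True
    then show ?thesis using \<mu>.emeasure_space_1 \<nu>.emeasure_space_1 sets_eq_imp_space_eq[OF s\<mu>] sets_eq_imp_space_eq[OF s\<nu>] by simp
  next
    case False
    define f where "f n x = min 1 (real n * infdist x (- U))" for n x
    have f: "continuous_on UNIV (f n)" "0 \<le> f n x" "f n x \<le> 1" for n x
      unfolding f_def by (auto intro!: continuous_intros simp: infdist_nonneg)
    have [measurable]: "f n \<in> borel_measurable borel" for n using f(1) by (rule borel_measurable_continuous_onI)
    have lim: "(\<lambda>n. ennreal (f n x)) \<longlonglongrightarrow> indicator U x" for x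
    proof (cases "x \<in> U")
      case True
      then have d: "infdist x (- U) > 0"
        using False U in_closed_iff_infdist_zero[of "- U" x] infdist_nonneg[of x "- U"] by (auto simp: less_le)
      obtain N where N: "1 / infdist x (- U) \<le> real N" using real_arch_simple by blast
      have "f n x = 1" if "n \<ge> N" for n
      proof -
        have "1 / infdist x (- U) \<le> real n" using N that by (meson of_nat_mono order.trans)
        then show ?thesis using d by (simp add: f_def field_simps)
      qed
      then have "eventually (\<lambda>n. ennreal (f n x) = indicator U x) sequentially"
        unfolding eventually_sequentially using True by auto
      then show ?thesis by (rule tendsto_eventually)
    next
      case False
      then show ?thesis by (simp add: f_def)
    qed
    have 1: "(\<lambda>n. \<integral>\<^sup>+x. ennreal (f n x) \<partial>\<mu>) \<longlonglongrightarrow> (\<integral>\<^sup>+x. indicator U x \<partial>\<mu>)"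
      by (rule nn_integral_dominated_convergence[where w="\<lambda>_. 1"])
         (use f U lim in \<open>auto simp: \<mu>.emeasure_space_1 intro!: borel_measurable_indicator\<close>)
    have 2: "(\<lambda>n. \<integral>\<^sup>+x. ennreal (f n x) \<partial>\<nu>) \<longlonglongrightarrow> (\<integral>\<^sup>+x. indicator U x \<partial>\<nu>)"
      by (rule nn_integral_dominated_convergence[where w="\<lambda>_. 1"])
         (use f U lim in \<open>auto simp: \<nu>.emeasure_space_1 intro!: borel_measurable_indicator\<close>)
    have "(\<integral>\<^sup>+x. indicator U x \<partial>\<mu>) = (\<integral>\<^sup>+x. indicator U x \<partial>\<nu>)"
      using 1 2 unfolding cont[OF f] by (rule LIMSEQ_unique)
    then show ?thesis using U by simp
  qed
  show ?thesis
  proof (rule measure_eqI_generator_eq[where E="{U. open U}" and \<Omega>=UNIV and A="\<lambda>_. UNIV"])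
    show "Int_stable {U :: 'v set. open U}" by (auto simp: Int_stable_def)
    show "sets \<mu> = sigma_sets UNIV {U. open U}" "sets \<nu> = sigma_sets UNIV {U. open U}"
      using s\<mu> s\<nu> by (simp_all only: sets_borel)
  qed (simp_all add: open_eq)
qed

section \<open>Subordinate Brownian motion\<close>

lemma rcont_of_continuous_on:
  assumes "continuous_on {0..} p" "\<And>r. r < 0 \<Longrightarrow> p r = p 0"
  shows "rcont (p :: real \<Rightarrow> 'a::topological_space)"
  unfolding rcont_def
proof
  fix r :: real
  show "(p \<longlongrightarrow> p r) (at_right r)"
  proof (cases "r < 0")
    case True
    then have "eventually (\<lambda>y. p y = p r) (at_right r)"
      unfolding eventually_at_right_field using assms(2) by (intro exI[of _ 0]) auto
    then show ?thesis by (rule tendsto_eventually)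
  next
    case False
    then have "(p \<longlongrightarrow> p r) (at r within {0..})" using assms(1) by (simp add: continuous_on_def)
    then show ?thesis by (rule tendsto_within_subset) (use False in auto)
  qed
qed

text \<open>The exponent \<open>- t * (norm \<xi>)\<^sup>2\<close> lacks the factor 1/2 of the
  standard Gaussian, hence the scale \<open>sqrt (2 * t)\<close>. The symmetry holds because the
  characteristic function is even.\<close>

lemma brownian_law:
  fixes B :: "real \<Rightarrow> 'w \<Rightarrow> 'v::euclidean_space"
  assumes B: "brownian_motion M B" and t: "0 \<le> t"
  shows "distr M borel (B t) = distr gauss_measure borel (\<lambda>v. sqrt (2 * t) *\<^sub>R v)"
    and "distr M borel (\<lambda>\<omega>. - B t \<omega>) = distr M borel (B t)"
proof -
  interpret prob_space M using B by (simp add: brownian_motion_def levy_process_def)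
  interpret G: prob_space "gauss_measure :: 'v measure" by (rule prob_space_gauss)
  have [measurable]: "B t \<in> borel_measurable M" using B t by (simp add: brownian_motion_def levy_process_def)
  have char: "(LINT \<omega>|M. exp (\<i> * complex_of_real (\<xi> \<bullet> B t \<omega>))) = complex_of_real (exp (- t * (norm \<xi>)\<^sup>2))" for \<xi>
    using B t by (simp add: brownian_motion_def)
  show "distr M borel (B t) = distr gauss_measure borel (\<lambda>v. sqrt (2 * t) *\<^sub>R v)"
  proof (rule char_unique_euclidean)
    fix \<xi> :: 'v
    have "(LINT x|distr gauss_measure borel (\<lambda>v. sqrt (2 * t) *\<^sub>R v). exp (\<i> * complex_of_real (\<xi> \<bullet> x))) =
       (LINT v|gauss_measure. exp (\<i> * complex_of_real ((sqrt (2 * t) *\<^sub>R \<xi>) \<bullet> v)))"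
      by (subst integral_distr) auto
    also have "\<dots> = complex_of_real (exp (- t * (norm \<xi>)\<^sup>2))"
      unfolding char_gauss using t by (simp add: power_mult_distrib)
    finally show "(LINT x|distr M borel (B t). exp (\<i> * complex_of_real (\<xi> \<bullet> x))) =
      (LINT x|distr gauss_measure borel (\<lambda>v. sqrt (2 * t) *\<^sub>R v). exp (\<i> * complex_of_real (\<xi> \<bullet> x)))"
      using char[of \<xi>] by (subst integral_distr) auto
  qed (auto intro!: prob_space_distr G.prob_space_distr)
  show "distr M borel (\<lambda>\<omega>. - B t \<omega>) = distr M borel (B t)"
  proof (rule char_unique_euclidean)
    fix \<xi> :: 'v
    have "(LINT x|distr M borel (\<lambda>\<omega>. - B t \<omega>). exp (\<i> * complex_of_real (\<xi> \<bullet> x))) =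
       (LINT \<omega>|M. exp (\<i> * complex_of_real ((- \<xi>) \<bullet> B t \<omega>)))"
      by (subst integral_distr) auto
    also have "\<dots> = (LINT \<omega>|M. exp (\<i> * complex_of_real (\<xi> \<bullet> B t \<omega>)))"
      unfolding char by simp
    finally show "(LINT x|distr M borel (\<lambda>\<omega>. - B t \<omega>). exp (\<i> * complex_of_real (\<xi> \<bullet> x))) =
      (LINT x|distr M borel (B t). exp (\<i> * complex_of_real (\<xi> \<bullet> x)))"
      by (subst (2) integral_distr) auto
  qed (auto intro!: prob_space_distr)
qed

lemma brownian_ac:
  fixes B :: "real \<Rightarrow> 'w \<Rightarrow> 'v::euclidean_space"
  assumes B: "brownian_motion M B" and t: "0 < t" and N: "N \<in> null_sets lborel"
  shows "emeasure (distr M borel (B t)) N = 0"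
proof -
  define c where "c = sqrt (2 * t)"
  have c: "c \<noteq> 0" using t by (simp add: c_def)
  have [measurable]: "N \<in> sets borel" using N by auto
  have m: "{v. c *\<^sub>R v \<in> N} \<in> sets borel" by measurable
  \<comment> \<open>Scaling by \<open>c\<close> changes Lebesgue measure by a nonzero constant, so
    preimages of null sets under it are null.\<close>
  have "0 = emeasure (density (distr lborel borel (\<lambda>x. 0 + c *\<^sub>R x)) (\<lambda>_. ennreal (\<bar>c\<bar> ^ DIM('v)))) N"
    using lborel_affine[OF c, of 0] N by (metis null_setsD1)
  also have "\<dots> = ennreal (\<bar>c\<bar> ^ DIM('v)) * emeasure lborel {v. c *\<^sub>R v \<in> N}"
    by (subst emeasure_density_const, simp_all, subst emeasure_distr) (auto simp: vimage_def)
  finally have "emeasure lborel {v. c *\<^sub>R v \<in> N} = 0" using c by auto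
  then have "{v. c *\<^sub>R v \<in> N} \<in> null_sets lborel" using m by auto
  then have "AE v in lborel. v \<notin> {v. c *\<^sub>R v \<in> N}" by (rule AE_not_in)
  then have "(\<integral>\<^sup>+v. ennreal (std_gauss v) * indicator {v. c *\<^sub>R v \<in> N} v \<partial>lborel) = (\<integral>\<^sup>+v. 0 \<partial>(lborel :: 'v measure))"
    by (intro nn_integral_cong_AE) (auto elim!: eventually_mono)
  then have "emeasure gauss_measure {v. c *\<^sub>R v \<in> N} = 0"
    unfolding gauss_measure_def using m by (subst emeasure_density) auto
  then show ?thesis
    unfolding brownian_law(1)[OF B less_imp_le[OF t]] c_def[symmetric]
    by (subst emeasure_distr) (auto simp: vimage_def)
qed

text \<open>The product formula on rectangles determines the joint law; the two variables may take
  values in different spaces.\<close>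

lemma (in prob_space) indep_set_joint_law:
  assumes X[measurable]: "X \<in> M \<rightarrow>\<^sub>M N" and Y[measurable]: "Y \<in> M \<rightarrow>\<^sub>M N'"
    and ind: "\<And>A A'. A \<in> sets N \<Longrightarrow> A' \<in> sets N' \<Longrightarrow>
      prob (X -` A \<inter> space M \<inter> (Y -` A' \<inter> space M)) = prob (X -` A \<inter> space M) * prob (Y -` A' \<inter> space M)"
  shows "distr M N X \<Otimes>\<^sub>M distr M N' Y = distr M (N \<Otimes>\<^sub>M N') (\<lambda>\<omega>. (X \<omega>, Y \<omega>))"
proof -
  interpret PX: prob_space "distr M N X" by (rule prob_space_distr) simp
  interpret PY: prob_space "distr M N' Y" by (rule prob_space_distr) simp
  show ?thesis
  proof (rule pair_measure_eqI)
    fix A A' assume "A \<in> sets (distr M N X)" "A' \<in> sets (distr M N' Y)"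
    then have [measurable]: "A \<in> sets N" "A' \<in> sets N'" by simp_all
    have "emeasure (distr M (N \<Otimes>\<^sub>M N') (\<lambda>\<omega>. (X \<omega>, Y \<omega>))) (A \<times> A') =
       emeasure M (X -` A \<inter> space M \<inter> (Y -` A' \<inter> space M))"
      by (subst emeasure_distr) (auto intro!: arg_cong2[where f=emeasure])
    then show "emeasure (distr M N X) A * emeasure (distr M N' Y) A' =
      emeasure (distr M (N \<Otimes>\<^sub>M N') (\<lambda>\<omega>. (X \<omega>, Y \<omega>))) (A \<times> A')"
      using ind[of A A'] by (simp add: emeasure_distr emeasure_eq_measure ennreal_mult)
  qed (simp_all add: PX.sigma_finite_measure_axioms PY.sigma_finite_measure_axioms cong: sets_pair_measure_cong)
qed

text \<open>\<open>G\<close> gathers the almost sure path properties into one event of full measure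
  on which they all hold at once.\<close>

locale subordination = prob_space M for M :: "'w measure" +
  fixes B :: "real \<Rightarrow> 'w \<Rightarrow> 'v::euclidean_space" and S :: "real \<Rightarrow> 'w \<Rightarrow> real" and \<Psi> :: "real \<Rightarrow> real"
    and G :: "'w set"
  assumes bm: "brownian_motion M B" and sub: "subordinator M S \<Psi>" and hw: "hartman_wintner \<Psi>"
    and indep: "indep_set
       {(\<lambda>\<omega>. \<lambda>t\<in>{0..}. B t \<omega>) -` A \<inter> space M |A. A \<in> sets (PiM {0..} (\<lambda>_. borel :: 'v measure))}
       {(\<lambda>\<omega>. \<lambda>t\<in>{0..}. S t \<omega>) -` A \<inter> space M |A. A \<in> sets (PiM {0..} (\<lambda>_. borel :: real measure))}"
    and G_meas [measurable]: "G \<in> sets M" and G_AE: "AE \<omega> in M. \<omega> \<in> G"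
    and B_cont: "\<And>\<omega>. \<omega> \<in> G \<Longrightarrow> continuous_on {0..} (\<lambda>t. B t \<omega>)" and B_0: "\<And>\<omega>. \<omega> \<in> G \<Longrightarrow> B 0 \<omega> = 0"
    and S_mono: "\<And>\<omega>. \<omega> \<in> G \<Longrightarrow> mono_on {0..} (\<lambda>t. S t \<omega>)" and S_0: "\<And>\<omega>. \<omega> \<in> G \<Longrightarrow> S 0 \<omega> = 0"
    and S_rcont: "\<And>\<omega> t. \<omega> \<in> G \<Longrightarrow> 0 \<le> t \<Longrightarrow> ((\<lambda>t. S t \<omega>) \<longlongrightarrow> S t \<omega>) (at_right t)"
begin

text \<open>Versions that vanish off \<open>G\<close> and at negative times, so that regularity and
  monotonicity hold for every sample point. Almost surely nothing changes at times
  \<open>t \<ge> 0\<close>.\<close>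

definition B' :: "real \<Rightarrow> 'w \<Rightarrow> 'v" where "B' t \<omega> = (if \<omega> \<in> G \<and> 0 \<le> t then B t \<omega> else 0)"
definition S' :: "real \<Rightarrow> 'w \<Rightarrow> real" where "S' t \<omega> = (if \<omega> \<in> G \<and> 0 \<le> t then S t \<omega> else 0)"
definition X' :: "real \<Rightarrow> 'w \<Rightarrow> 'v" where "X' t \<omega> = B' (S' t \<omega>) \<omega>"

lemma B_meas: "0 \<le> t \<Longrightarrow> B t \<in> borel_measurable M"
  using bm by (simp add: brownian_motion_def levy_process_def)

lemma S_meas: "0 \<le> t \<Longrightarrow> S t \<in> borel_measurable M"
  using sub by (simp add: subordinator_def levy_process_def)

lemma B'_meas [measurable]: "B' t \<in> borel_measurable M"
  unfolding B'_def[abs_def] using B_meas[of t] by (cases "0 \<le> t") simp_all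

lemma S'_meas [measurable]: "S' t \<in> borel_measurable M"
  unfolding S'_def[abs_def] using S_meas[of t] by (cases "0 \<le> t") simp_all

lemma B'_nonpos: "t \<le> 0 \<Longrightarrow> B' t \<omega> = 0"
  unfolding B'_def using B_0 by (cases "t = 0") auto

lemma S'_nonpos: "t \<le> 0 \<Longrightarrow> S' t \<omega> = 0"
  unfolding S'_def using S_0 by (cases "t = 0") auto

lemma S'_mono: "s \<le> t \<Longrightarrow> S' s \<omega> \<le> S' t \<omega>"
proof (cases "\<omega> \<in> G \<and> 0 \<le> s")
  case True
  assume "s \<le> t"
  then show ?thesis using True S_mono[of \<omega>] by (auto simp: S'_def mono_on_def)
next
  case False
  assume "s \<le> t"
  show ?thesis
  proof (cases "\<omega> \<in> G \<and> 0 \<le> t")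
    case True
    then have "S 0 \<omega> \<le> S t \<omega>" using S_mono[of \<omega>] by (auto simp: mono_on_def)
    then show ?thesis using False True S_0 by (auto simp: S'_def)
  next
    case F: False
    then show ?thesis using False \<open>s \<le> t\<close> by (auto simp: S'_def)
  qed
qed

lemma S'_nonneg: "0 \<le> S' t \<omega>"
  using S'_mono[of 0 t \<omega>] S'_nonpos[of 0 \<omega>] S'_nonpos[of t \<omega>] by (cases "0 \<le> t") auto

lemma B'_continuous: "continuous_on {0..} (\<lambda>t. B' t \<omega>)"
proof (cases "\<omega> \<in> G")
  case True
  then have "continuous_on {0..} (\<lambda>t. B t \<omega>)" by (rule B_cont)
  then show ?thesis by (rule continuous_on_eq) (use True in \<open>auto simp: B'_def\<close>)
qed (simp add: B'_def)

lemma B'_rcont: "rcont (\<lambda>t. B' t \<omega>)"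
  using B'_continuous by (rule rcont_of_continuous_on) (simp add: B'_nonpos)

lemma S'_rcont: "rcont (\<lambda>t. S' t \<omega>)"
  unfolding rcont_def
proof
  fix r
  have ev: "eventually (\<lambda>t. S' t \<omega> = S t \<omega>) (at_right r)" if "\<omega> \<in> G" "0 \<le> r"
    using eventually_at_right_less[of r] by eventually_elim (use that in \<open>simp add: S'_def\<close>)
  show "((\<lambda>t. S' t \<omega>) \<longlongrightarrow> S' r \<omega>) (at_right r)"
  proof (cases "r < 0")
    case True
    then have "eventually (\<lambda>y. S' y \<omega> = S' r \<omega>) (at_right r)"
      unfolding eventually_at_right_field by (intro exI[of _ 0]) (auto simp: S'_nonpos)
    then show ?thesis by (rule tendsto_eventually)
  next
    case False
    then show ?thesis
      using S_rcont[of \<omega> r] ev by (cases "\<omega> \<in> G") (auto simp: S'_def tendsto_cong)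
  qed
qed

lemma X'_rcont: "rcont (\<lambda>t. X' t \<omega>)"
  unfolding rcont_def X'_def
proof
  fix r
  have "((\<lambda>t. S' t \<omega>) \<longlongrightarrow> S' r \<omega>) (at_right r)" using S'_rcont[of \<omega>] by (simp add: rcont_def)
  from continuous_on_tendsto_compose[OF B'_continuous this]
  show "((\<lambda>t. B' (S' t \<omega>) \<omega>) \<longlongrightarrow> B' (S' r \<omega>) \<omega>) (at_right r)" by (simp add: S'_nonneg)
qed

lemma X'_nonpos: "t \<le> 0 \<Longrightarrow> X' t \<omega> = 0"
  by (simp add: X'_def S'_nonpos B'_nonpos)

lemma B'_path [measurable]: "(\<lambda>\<omega> t. B' t \<omega>) \<in> M \<rightarrow>\<^sub>M path_algebra" by (rule measurable_path) simp
lemma S'_path [measurable]: "(\<lambda>\<omega> t. S' t \<omega>) \<in> M \<rightarrow>\<^sub>M path_algebra" by (rule measurable_path) simp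

text \<open>The composition evaluates a random path at a random time; through
  \<open>right_ext\<close> it becomes measurable.\<close>

lemma X'_eq: "X' t \<omega> = right_ext (\<lambda>r. B' r \<omega>) (S' t \<omega>)"
  by (simp add: X'_def B'_rcont)

lemma X'_meas [measurable]: "X' t \<in> borel_measurable M"
  unfolding X'_eq[abs_def] by measurable

lemma AE_B': "AE \<omega> in M. \<forall>t\<ge>0. B' t \<omega> = B t \<omega>"
  using G_AE by eventually_elim (simp add: B'_def)

lemma AE_S': "AE \<omega> in M. \<forall>t\<ge>0. S' t \<omega> = S t \<omega>"
  using G_AE by eventually_elim (simp add: S'_def)

lemma AE_X': "AE \<omega> in M. \<forall>t\<ge>0. X' t \<omega> = B (S t \<omega>) \<omega>"
  using G_AE
proof eventually_elim
  fix \<omega> assume "\<omega> \<in> G"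
  show "\<forall>t\<ge>0. X' t \<omega> = B (S t \<omega>) \<omega>"
  proof (intro allI impI)
    fix t :: real assume "0 \<le> t"
    then show "X' t \<omega> = B (S t \<omega>) \<omega>"
      using S'_nonneg[of t \<omega>] \<open>\<omega> \<in> G\<close> by (simp add: X'_def B'_def S'_def)
  qed
qed

text \<open>Independence is given for the families on the half line. Extending these by 0 to all
  real times transports it to path space, where the joint law is a product and Fubini applies. The
  extensions agree with \<open>B'\<close> and \<open>S'\<close> on \<open>G\<close>, hence almost
  surely.\<close>

lemma nn_integral_decouple:
  assumes \<Phi>[measurable]: "\<Phi> \<in> borel_measurable (path_algebra \<Otimes>\<^sub>M path_algebra)"
  shows "(\<integral>\<^sup>+\<omega>. \<Phi> (\<lambda>t. B' t \<omega>, \<lambda>t. S' t \<omega>) \<partial>M) = (\<integral>\<^sup>+\<omega>'. \<integral>\<^sup>+\<omega>. \<Phi> (\<lambda>t. B' t \<omega>, \<lambda>t. S' t \<omega>') \<partial>M \<partial>M)"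
proof -
  define b where "b \<omega> = (\<lambda>t\<in>{0..}. B t \<omega>)" for \<omega>
  define s where "s \<omega> = (\<lambda>t\<in>{0..}. S t \<omega>)" for \<omega>
  define e where "e p t = (if 0 \<le> t then p t else 0)" for p :: "real \<Rightarrow> 'v" and t :: real
  define e' where "e' p t = (if 0 \<le> t then p t else 0)" for p :: "real \<Rightarrow> real" and t :: real
  have bm': "b \<in> M \<rightarrow>\<^sub>M PiM {0..} (\<lambda>_. borel)" unfolding b_def by (rule measurable_restrict) (simp add: B_meas)
  have sm': "s \<in> M \<rightarrow>\<^sub>M PiM {0..} (\<lambda>_. borel)" unfolding s_def by (rule measurable_restrict) (simp add: S_meas)
  have em: "e \<in> PiM {0..} (\<lambda>_. borel) \<rightarrow>\<^sub>M path_algebra"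
    unfolding e_def[abs_def]
    by (rule measurable_path, rename_tac t, case_tac "0 \<le> t") (auto intro: measurable_component_singleton)
  have em': "e' \<in> PiM {0..} (\<lambda>_. borel) \<rightarrow>\<^sub>M path_algebra"
    unfolding e'_def[abs_def]
    by (rule measurable_path, rename_tac t, case_tac "0 \<le> t") (auto intro: measurable_component_singleton)
  have [measurable]: "e \<circ> b \<in> M \<rightarrow>\<^sub>M path_algebra" "e' \<circ> s \<in> M \<rightarrow>\<^sub>M path_algebra"
    using bm' sm' em em' by (auto intro: measurable_comp)
  have eqB: "AE \<omega> in M. (e \<circ> b) \<omega> = (\<lambda>t. B' t \<omega>)"
    using G_AE by eventually_elim (auto simp: e_def b_def B'_def fun_eq_iff)
  have eqS: "AE \<omega> in M. (e' \<circ> s) \<omega> = (\<lambda>t. S' t \<omega>)"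
    using G_AE by eventually_elim (auto simp: e'_def s_def S'_def fun_eq_iff)
  interpret PB: prob_space "distr M path_algebra (e \<circ> b)" by (rule prob_space_distr) simp
  interpret PS: prob_space "distr M path_algebra (e' \<circ> s)" by (rule prob_space_distr) simp
  interpret PP: pair_prob_space "distr M path_algebra (e \<circ> b)" "distr M path_algebra (e' \<circ> s)" ..
  have joint: "distr M path_algebra (e \<circ> b) \<Otimes>\<^sub>M distr M path_algebra (e' \<circ> s) =
      distr M (path_algebra \<Otimes>\<^sub>M path_algebra) (\<lambda>\<omega>. ((e \<circ> b) \<omega>, (e' \<circ> s) \<omega>))"
  proof (rule indep_set_joint_law)
    fix A :: "(real \<Rightarrow> 'v) set" and A' :: "(real \<Rightarrow> real) set"
    assume A: "A \<in> sets path_algebra" "A' \<in> sets path_algebra"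
    have 1: "(e \<circ> b) -` A \<inter> space M = b -` (e -` A \<inter> space (PiM {0..} (\<lambda>_. borel))) \<inter> space M"
      using measurable_space[OF bm'] by (auto simp del: space_PiM)
    have 2: "(e' \<circ> s) -` A' \<inter> space M = s -` (e' -` A' \<inter> space (PiM {0..} (\<lambda>_. borel))) \<inter> space M"
      using measurable_space[OF sm'] by (auto simp del: space_PiM)
    show "prob ((e \<circ> b) -` A \<inter> space M \<inter> ((e' \<circ> s) -` A' \<inter> space M)) =
      prob ((e \<circ> b) -` A \<inter> space M) * prob ((e' \<circ> s) -` A' \<inter> space M)"
      unfolding 1 2 b_def s_def
      by (rule indep_setD[OF indep]) (use A measurable_sets[OF em] measurable_sets[OF em'] in blast)+
  qed simp_all
  have "(\<integral>\<^sup>+\<omega>. \<Phi> (\<lambda>t. B' t \<omega>, \<lambda>t. S' t \<omega>) \<partial>M) = (\<integral>\<^sup>+\<omega>. \<Phi> ((e \<circ> b) \<omega>, (e' \<circ> s) \<omega>) \<partial>M)"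
  proof (rule nn_integral_cong_AE)
    show "AE \<omega> in M. \<Phi> (\<lambda>t. B' t \<omega>, \<lambda>t. S' t \<omega>) = \<Phi> ((e \<circ> b) \<omega>, (e' \<circ> s) \<omega>)"
      using eqB eqS by eventually_elim (simp only:)
  qed
  also have "\<dots> = (\<integral>\<^sup>+p. \<Phi> p \<partial>distr M (path_algebra \<Otimes>\<^sub>M path_algebra) (\<lambda>\<omega>. ((e \<circ> b) \<omega>, (e' \<circ> s) \<omega>)))"
    by (rule nn_integral_distr[symmetric]) (auto intro: measurable_Pair simp del: comp_apply)
  also have "\<dots> = (\<integral>\<^sup>+p. \<Phi> p \<partial>(distr M path_algebra (e \<circ> b) \<Otimes>\<^sub>M distr M path_algebra (e' \<circ> s)))"
    unfolding joint ..
  also have "\<dots> = (\<integral>\<^sup>+q. \<integral>\<^sup>+p. \<Phi> (p, q) \<partial>distr M path_algebra (e \<circ> b) \<partial>distr M path_algebra (e' \<circ> s))"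
    by (rule PP.nn_integral_snd[symmetric]) simp
  also have "\<dots> = (\<integral>\<^sup>+\<omega>'. \<integral>\<^sup>+p. \<Phi> (p, (e' \<circ> s) \<omega>') \<partial>distr M path_algebra (e \<circ> b) \<partial>M)"
  proof (rule nn_integral_distr)
    show "(\<lambda>q. \<integral>\<^sup>+p. \<Phi> (p, q) \<partial>distr M path_algebra (e \<circ> b)) \<in> borel_measurable (distr M path_algebra (e' \<circ> s))"
      by measurable
  qed simp
  also have "\<dots> = (\<integral>\<^sup>+\<omega>'. \<integral>\<^sup>+\<omega>. \<Phi> ((e \<circ> b) \<omega>, (e' \<circ> s) \<omega>') \<partial>M \<partial>M)"
  proof (intro nn_integral_cong nn_integral_distr)
    fix \<omega>' assume "\<omega>' \<in> space M"
    have "(e' \<circ> s) \<omega>' \<in> space path_algebra" by (simp add: space_PiM)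
    then show "(\<lambda>p. \<Phi> (p, (e' \<circ> s) \<omega>')) \<in> borel_measurable (distr M path_algebra (e \<circ> b))"
      by (simp del: comp_apply) measurable
  qed simp
  also have "\<dots> = (\<integral>\<^sup>+\<omega>'. \<integral>\<^sup>+\<omega>. \<Phi> (\<lambda>t. B' t \<omega>, \<lambda>t. S' t \<omega>') \<partial>M \<partial>M)"
  proof (rule nn_integral_cong_AE)
    show "AE \<omega>' in M. (\<integral>\<^sup>+\<omega>. \<Phi> ((e \<circ> b) \<omega>, (e' \<circ> s) \<omega>') \<partial>M) = (\<integral>\<^sup>+\<omega>. \<Phi> (\<lambda>t. B' t \<omega>, \<lambda>t. S' t \<omega>') \<partial>M)"
      using eqS
    proof eventually_elim
      fix \<omega>' assume *: "(e' \<circ> s) \<omega>' = (\<lambda>t. S' t \<omega>')"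
      show "(\<integral>\<^sup>+\<omega>. \<Phi> ((e \<circ> b) \<omega>, (e' \<circ> s) \<omega>') \<partial>M) = (\<integral>\<^sup>+\<omega>. \<Phi> (\<lambda>t. B' t \<omega>, \<lambda>t. S' t \<omega>') \<partial>M)"
        unfolding * by (rule nn_integral_cong_AE) (use eqB in \<open>eventually_elim, simp only:\<close>)
    qed
  qed
  finally show ?thesis .
qed

text \<open>As a function of \<open>u\<close> this is the kernel into which the clock is inserted.
  It is defined for all real \<open>u\<close>, so that no sign condition enters its
  measurability.\<close>

definition prob_B :: "real \<Rightarrow> 'v set \<Rightarrow> ennreal" where
  "prob_B u A = (\<integral>\<^sup>+\<omega>. indicator A (B' u \<omega>) \<partial>M)"

lemma prob_B_meas [measurable]:
  assumes [measurable]: "A \<in> sets borel" shows "(\<lambda>u. prob_B u A) \<in> borel_measurable borel"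
proof -
  have "(\<lambda>(u, \<omega>). indicator A (right_ext (\<lambda>t. B' t \<omega>) u) :: ennreal) \<in> borel_measurable (borel \<Otimes>\<^sub>M M)"
    unfolding split_beta'
    by (intro measurable_compose[OF _ borel_measurable_indicator[OF assms]] measurable_right_ext
          measurable_compose[OF measurable_snd B'_path]) measurable
  then have "(\<lambda>u. \<integral>\<^sup>+\<omega>. indicator A (right_ext (\<lambda>t. B' t \<omega>) u) \<partial>M) \<in> borel_measurable borel"
    by (rule borel_measurable_nn_integral)
  then show ?thesis unfolding prob_B_def by (simp add: B'_rcont)
qed

lemma prob_B_eq:
  assumes "0 \<le> u" "A \<in> sets borel" shows "prob_B u A = emeasure (distr M borel (B u)) A"
proof -
  note [measurable] = B_meas[OF assms(1)] assms(2)
  have "prob_B u A = (\<integral>\<^sup>+\<omega>. indicator A (B u \<omega>) \<partial>M)"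
    unfolding prob_B_def using AE_B' assms(1) by (intro nn_integral_cong_AE) (auto elim!: eventually_mono)
  also have "\<dots> = (\<integral>\<^sup>+x. indicator A x \<partial>distr M borel (B u))" by (rule nn_integral_distr[symmetric]) auto
  finally show ?thesis by simp
qed

lemma B'_increments:
  assumes s: "mono s" "0 \<le> s 0" and A: "\<And>i. A i \<in> sets borel"
  shows "(\<integral>\<^sup>+\<omega>. (if \<forall>i<n. B' (s (Suc i)) \<omega> - B' (s i) \<omega> \<in> A i then 1 else 0) \<partial>M) =
    (\<Prod>i<n::nat. prob_B (s (Suc i) - s i) (A i))"
\<comment> \<open>The finite form of independence requires a nonempty index set.\<close>
proof (cases "n = 0")
  case True
  then show ?thesis by (simp add: emeasure_space_1)
next
  case False
  have s0: "0 \<le> s i" for i using s monoD[OF s(1), of 0 i] by simp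
  note [measurable] = B_meas[OF s0] A
  have ind: "indep_vars (\<lambda>_. borel) (\<lambda>i \<omega>. B (s (Suc i)) \<omega> - B (s i) \<omega>) {..<n}"
    using bm s unfolding brownian_motion_def levy_process_def by (auto simp: mono_def)
  define E where "E i = (\<lambda>\<omega>. B (s (Suc i)) \<omega> - B (s i) \<omega>) -` A i \<inter> space M" for i
  have Em[measurable]: "E i \<in> sets M" for i
    unfolding E_def by (rule measurable_sets[OF _ A]) measurable
  have "(\<integral>\<^sup>+\<omega>. (if \<forall>i<n. B' (s (Suc i)) \<omega> - B' (s i) \<omega> \<in> A i then 1 else 0) \<partial>M) =
     (\<integral>\<^sup>+\<omega>. indicator (\<Inter>i\<in>{..<n}. E i) \<omega> \<partial>M)"
  proof (rule nn_integral_cong_AE)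
    show "AE \<omega> in M. (if \<forall>i<n. B' (s (Suc i)) \<omega> - B' (s i) \<omega> \<in> A i then 1 else 0 :: ennreal) =
       indicator (\<Inter>i\<in>{..<n}. E i) \<omega>"
      using AE_B' AE_space by eventually_elim (auto simp: E_def s0 indicator_def)
  qed
  also have "\<dots> = emeasure M (\<Inter>i\<in>{..<n}. E i)" using False by (intro nn_integral_indicator) auto
  also have "\<dots> = ennreal (\<Prod>i<n. prob (E i))"
    using indep_varsD_finite[OF ind, of A] False unfolding E_def by (simp add: emeasure_eq_measure lessThan_empty_iff)
  also have "\<dots> = (\<Prod>i<n. emeasure M (E i))" by (simp add: prod_ennreal emeasure_eq_measure)
  also have "\<dots> = (\<Prod>i<n. prob_B (s (Suc i) - s i) (A i))"
  proof (intro prod.cong refl)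
    fix i
    have d: "0 \<le> s (Suc i) - s i" using s(1) by (simp add: mono_def)
    have "distr M borel (\<lambda>\<omega>. B (s i + (s (Suc i) - s i)) \<omega> - B (s i) \<omega>) = distr M borel (B (s (Suc i) - s i))"
      using bm d s0[of i] unfolding brownian_motion_def levy_process_def by blast
    then have "emeasure (distr M borel (\<lambda>\<omega>. B (s (Suc i)) \<omega> - B (s i) \<omega>)) (A i) = prob_B (s (Suc i) - s i) (A i)"
      using prob_B_eq[OF d A[of i]] by simp
    then show "emeasure M (E i) = prob_B (s (Suc i) - s i) (A i)"
      unfolding E_def by (subst (asm) emeasure_distr) auto
  qed
  finally show ?thesis .
qed

section \<open>Laws and increments of the subordinate process\<close>

lemma X'_law:
  assumes A[measurable]: "A \<in> sets borel"
  shows "emeasure (distr M borel (X' t)) A = (\<integral>\<^sup>+\<omega>. prob_B (S' t \<omega>) A \<partial>M)"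
proof -
  define \<Phi> where "\<Phi> p = (indicator A (right_ext (fst p) (snd p t)) :: ennreal)" for p :: "(real \<Rightarrow> 'v) \<times> (real \<Rightarrow> real)"
  have "\<Phi> \<in> borel_measurable (path_algebra \<Otimes>\<^sub>M path_algebra)"
    unfolding \<Phi>_def
    by (intro measurable_compose[OF _ borel_measurable_indicator[OF A]] measurable_right_ext measurable_fst
         measurable_path_component measurable_snd)
  from nn_integral_decouple[OF this]
  have "(\<integral>\<^sup>+\<omega>. indicator A (X' t \<omega>) \<partial>M) = (\<integral>\<^sup>+\<omega>. prob_B (S' t \<omega>) A \<partial>M)"
    unfolding \<Phi>_def prob_B_def by (simp add: B'_rcont X'_def)
  moreover have "emeasure (distr M borel (X' t)) A = (\<integral>\<^sup>+x. indicator A x \<partial>distr M borel (X' t))" by simp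
  then have "emeasure (distr M borel (X' t)) A = (\<integral>\<^sup>+\<omega>. indicator A (X' t \<omega>) \<partial>M)"
    by (subst (asm) nn_integral_distr) auto
  ultimately show ?thesis by simp
qed

text \<open>With the clock frozen, increments of \<open>X'\<close> are Brownian increments over
  intervals of the clock, so their probability is a product of kernels in the clock increments.
  Independence and stationarity of the latter finish the computation.\<close>

lemma X'_increments:
  assumes t: "mono t" "0 \<le> t 0" and A: "\<And>i. A i \<in> sets borel"
  shows "emeasure M {\<omega> \<in> space M. \<forall>i<n::nat. X' (t (Suc i)) \<omega> - X' (t i) \<omega> \<in> A i} =
    (\<Prod>i<n. emeasure (distr M borel (X' (t (Suc i) - t i))) (A i))"
proof -
  have t0: "0 \<le> t i" for i using t monoD[OF t(1), of 0 i] by simp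
  have [measurable]: "A i \<in> sets borel" for i by (rule A)
  define \<Phi> where "\<Phi> p = (if \<forall>i<n. right_ext (fst p) (snd p (t (Suc i))) - right_ext (fst p) (snd p (t i)) \<in> A i then 1 else 0 :: ennreal)"
    for p :: "(real \<Rightarrow> 'v) \<times> (real \<Rightarrow> real)"
  have [measurable]: "(\<lambda>p. right_ext (fst p) (snd p r)) \<in> borel_measurable (path_algebra \<Otimes>\<^sub>M path_algebra)" for r :: real
    by (intro measurable_right_ext measurable_fst measurable_path_component measurable_snd)
  have \<Phi>m: "\<Phi> \<in> borel_measurable (path_algebra \<Otimes>\<^sub>M path_algebra)"
    unfolding \<Phi>_def by measurable
  have "emeasure M {\<omega> \<in> space M. \<forall>i<n::nat. X' (t (Suc i)) \<omega> - X' (t i) \<omega> \<in> A i} =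
     (\<integral>\<^sup>+\<omega>. indicator {\<omega> \<in> space M. \<forall>i<n::nat. X' (t (Suc i)) \<omega> - X' (t i) \<omega> \<in> A i} \<omega> \<partial>M)"
    by (rule nn_integral_indicator[symmetric]) measurable
  also have "\<dots> = (\<integral>\<^sup>+\<omega>. \<Phi> (\<lambda>t. B' t \<omega>, \<lambda>t. S' t \<omega>) \<partial>M)"
    by (intro nn_integral_cong) (simp add: \<Phi>_def X'_eq indicator_def)
  also have "\<dots> = (\<integral>\<^sup>+\<omega>'. \<integral>\<^sup>+\<omega>. \<Phi> (\<lambda>t. B' t \<omega>, \<lambda>t. S' t \<omega>') \<partial>M \<partial>M)"
    by (rule nn_integral_decouple[OF \<Phi>m])
  also have "\<dots> = (\<integral>\<^sup>+\<omega>'. (\<Prod>i<n. prob_B (S' (t (Suc i)) \<omega>' - S' (t i) \<omega>') (A i)) \<partial>M)"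
  proof (rule nn_integral_cong)
    fix \<omega>'
    have m: "mono (\<lambda>i. S' (t i) \<omega>')" using t(1) by (auto simp: mono_def intro: S'_mono)
    show "(\<integral>\<^sup>+\<omega>. \<Phi> (\<lambda>t. B' t \<omega>, \<lambda>t. S' t \<omega>') \<partial>M) = (\<Prod>i<n. prob_B (S' (t (Suc i)) \<omega>' - S' (t i) \<omega>') (A i))"
      using B'_increments[OF m S'_nonneg A, of n] by (simp add: \<Phi>_def B'_rcont)
  qed
  \<comment> \<open>Back to \<open>S\<close>, for which independence and stationarity of increments
    are assumed.\<close>
  also have "\<dots> = (\<integral>\<^sup>+\<omega>'. (\<Prod>i<n. prob_B (S (t (Suc i)) \<omega>' - S (t i) \<omega>') (A i)) \<partial>M)"
    using AE_S' by (intro nn_integral_cong_AE) (auto elim!: eventually_mono simp: t0)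
  also have "\<dots> = (\<Prod>i<n. \<integral>\<^sup>+\<omega>'. prob_B (S (t (Suc i)) \<omega>' - S (t i) \<omega>') (A i) \<partial>M)"
  proof (cases "n = 0")
    case True then show ?thesis by (simp add: emeasure_space_1)
  next
    case False
    have ind: "indep_vars (\<lambda>_. borel) (\<lambda>i \<omega>. S (t (Suc i)) \<omega> - S (t i) \<omega>) {..<n}"
      using sub t unfolding subordinator_def levy_process_def by (auto simp: mono_def)
    show ?thesis
      by (intro indep_vars_nn_integral indep_vars_compose2[OF ind]) auto
  qed
  also have "\<dots> = (\<Prod>i<n. emeasure (distr M borel (X' (t (Suc i) - t i))) (A i))"
  proof (intro prod.cong refl)
    fix i
    have d: "0 \<le> t (Suc i) - t i" using t(1) by (simp add: mono_def)
    note [measurable] = S_meas[OF t0] S_meas[OF d]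
    have "distr M borel (\<lambda>\<omega>. S (t i + (t (Suc i) - t i)) \<omega> - S (t i) \<omega>) = distr M borel (S (t (Suc i) - t i))"
      using sub d t0[of i] unfolding subordinator_def levy_process_def by blast
    then have e: "distr M borel (\<lambda>\<omega>. S (t (Suc i)) \<omega> - S (t i) \<omega>) = distr M borel (S (t (Suc i) - t i))" by simp
    have "(\<integral>\<^sup>+\<omega>'. prob_B (S (t (Suc i)) \<omega>' - S (t i) \<omega>') (A i) \<partial>M) =
       (\<integral>\<^sup>+u. prob_B u (A i) \<partial>distr M borel (\<lambda>\<omega>. S (t (Suc i)) \<omega> - S (t i) \<omega>))"
      by (subst nn_integral_distr) auto
    also have "\<dots> = (\<integral>\<^sup>+\<omega>'. prob_B (S (t (Suc i) - t i) \<omega>') (A i) \<partial>M)"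
      unfolding e by (subst nn_integral_distr) auto
    also have "\<dots> = (\<integral>\<^sup>+\<omega>'. prob_B (S' (t (Suc i) - t i) \<omega>') (A i) \<partial>M)"
      using AE_S' d by (intro nn_integral_cong_AE) (auto elim!: eventually_mono)
    also have "\<dots> = emeasure (distr M borel (X' (t (Suc i) - t i))) (A i)" by (rule X'_law[symmetric]) simp
    finally show "(\<integral>\<^sup>+\<omega>'. prob_B (S (t (Suc i)) \<omega>' - S (t i) \<omega>') (A i) \<partial>M) =
      emeasure (distr M borel (X' (t (Suc i) - t i))) (A i)" .
  qed
  finally show ?thesis .
qed

lemma X'_symmetric:
  assumes A[measurable]: "A \<in> sets borel"
  shows "emeasure (distr M borel (X' t)) (uminus -` A) = emeasure (distr M borel (X' t)) A"
proof -
  have m[measurable]: "uminus -` A \<in> sets borel"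
    using measurable_sets_borel[OF borel_measurable_uminus[OF measurable_ident] A] by (simp add: vimage_def)
  have "prob_B u (uminus -` A) = prob_B u A" if u: "0 \<le> u" for u
  proof -
    note [measurable] = B_meas[OF u]
    have "emeasure (distr M borel (B u)) (uminus -` A) = emeasure (distr M borel (\<lambda>\<omega>. - B u \<omega>)) A"
      by (subst (1 2) emeasure_distr) (auto simp: vimage_def)
    then show ?thesis unfolding brownian_law(2)[OF bm u] using u A m by (simp add: prob_B_eq)
  qed
  then show ?thesis by (simp add: X'_law S'_nonneg)
qed

text \<open>The atom at 0 is bounded by the Laplace transform, that is by
  \<open>exp (- t * \<Psi> (u\<^sup>2))\<close> for every \<open>u > 0\<close>. The Hartman-Wintner
  condition sends the exponent to minus infinity.\<close>

lemma S_pos: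
  assumes t: "0 < t"
  shows "AE \<omega> in M. S' t \<omega> \<noteq> 0"
proof -
  have lim: "filterlim (\<lambda>u. \<Psi> (u\<^sup>2)) at_top at_top"
  proof (rule filterlim_at_top_mono)
    show "filterlim ln at_top (at_top :: real filter)" by (rule ln_at_top)
    have "eventually (\<lambda>u. 1 \<le> \<Psi> (u\<^sup>2) / ln \<bar>u\<bar>) at_infinity"
      using hw unfolding hartman_wintner_def filterlim_at_top by blast
    then have "eventually (\<lambda>u. 1 \<le> \<Psi> (u\<^sup>2) / ln \<bar>u\<bar>) at_top"
      using at_top_le_at_infinity by (rule filter_leD[rotated])
    then show "eventually (\<lambda>u. ln u \<le> \<Psi> (u\<^sup>2)) at_top"
      using eventually_gt_at_top[of 1]
    proof eventually_elim
      fix u :: real assume u: "1 \<le> \<Psi> (u\<^sup>2) / ln \<bar>u\<bar>" "1 < u"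
      then have "0 < ln u" by simp
      then show "ln u \<le> \<Psi> (u\<^sup>2)" using u by (simp add: pos_le_divide_eq)
    qed
  qed
  have le: "prob {\<omega> \<in> space M. S' t \<omega> = 0} \<le> exp (- t * \<Psi> (u\<^sup>2))" if u: "0 < u" for u
  proof -
    have "exp (- t * \<Psi> (u\<^sup>2)) = (LINT \<omega>|M. exp (- (u\<^sup>2) * S t \<omega>))"
      using sub t u unfolding subordinator_def by simp
    also have "\<dots> = (LINT \<omega>|M. exp (- (u\<^sup>2) * S' t \<omega>))"
    proof (rule integral_cong_AE)
      show "AE \<omega> in M. exp (- (u\<^sup>2) * S t \<omega>) = exp (- (u\<^sup>2) * S' t \<omega>)"
        using AE_S' by eventually_elim (use t in simp)
    qed (use t S_meas[of t] in simp_all)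
    also have "\<dots> \<ge> (LINT \<omega>|M. indicator {\<omega> \<in> space M. S' t \<omega> = 0} \<omega>)"
    proof (rule integral_mono)
      show "integrable M (\<lambda>\<omega>. exp (- (u\<^sup>2) * S' t \<omega>))"
        by (rule integrable_const_bound[where B=1]) (auto simp: S'_nonneg)
      show "integrable M (indicat_real {\<omega> \<in> space M. S' t \<omega> = 0})"
        by (rule integrable_const_bound[where B=1]) (auto simp: indicator_def)
    qed (auto simp: indicator_def)
    finally show ?thesis by simp
  qed
  have "((\<lambda>u. exp (- t * \<Psi> (u\<^sup>2))) \<longlongrightarrow> 0) at_top"
  proof (rule filterlim_compose[OF exp_at_bot])
    have "filterlim (\<lambda>u. t * \<Psi> (u\<^sup>2)) at_top at_top"
      using t lim by (intro filterlim_tendsto_pos_mult_at_top[OF tendsto_const])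
    then show "filterlim (\<lambda>u. - t * \<Psi> (u\<^sup>2)) at_bot at_top" by (simp add: filterlim_uminus_at_bot)
  qed
  moreover have "eventually (\<lambda>u. prob {\<omega> \<in> space M. S' t \<omega> = 0} \<le> exp (- t * \<Psi> (u\<^sup>2))) at_top"
    using eventually_gt_at_top[of 0] by eventually_elim (rule le)
  ultimately have "prob {\<omega> \<in> space M. S' t \<omega> = 0} \<le> 0"
    by (rule tendsto_lowerbound) simp
  then have "emeasure M {\<omega> \<in> space M. S' t \<omega> = 0} = 0"
    by (simp add: emeasure_eq_measure measure_le_0_iff)
  then show ?thesis by (intro AE_I[where N="{\<omega> \<in> space M. S' t \<omega> = 0}"]) auto
qed

text \<open>Since the clock is almost surely positive at time \<open>t\<close>, the law is a mixture
  of nondegenerate Gaussian laws.\<close>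

lemma X'_ac:
  assumes t: "0 < t" and A: "A \<in> null_sets lborel"
  shows "emeasure (distr M borel (X' t)) A = 0"
proof -
  have [measurable]: "A \<in> sets borel" using A by auto
  have "(\<integral>\<^sup>+\<omega>. prob_B (S' t \<omega>) A \<partial>M) = (\<integral>\<^sup>+\<omega>. 0 \<partial>M)"
    using S_pos[OF t]
  proof (intro nn_integral_cong_AE, eventually_elim)
    fix \<omega> assume "S' t \<omega> \<noteq> 0"
    then have "0 < S' t \<omega>" using S'_nonneg[of t \<omega>] by simp
    then show "prob_B (S' t \<omega>) A = 0" using brownian_ac[OF bm _ A] by (simp add: prob_B_eq)
  qed
  then show ?thesis by (simp add: X'_law)
qed

lemma sym_levy_X': "sym_levy (completion M) X'"
proof -
  interpret P: prob_space "completion M"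
    by (rule prob_spaceI) (simp add: emeasure_space_1)
  have d: "distr (completion M) borel (X' t) = distr M borel (X' t)" for t by (rule distr_completion) simp
  show ?thesis
  proof (intro sym_levy.intro sym_levy_axioms.intro)
    show "prob_space (completion M)" by (rule P.prob_space_axioms)
    show "complete_measure (completion M)" by (rule completion.complete_measure_axioms)
    fix n :: nat and t :: "nat \<Rightarrow> real" and A assume t: "mono t" "0 \<le> t 0" and A: "\<And>i::nat. A i \<in> sets (borel :: 'v measure)"
    have [measurable]: "A i \<in> sets borel" for i by (rule A)
    have "{\<omega> \<in> space M. \<forall>i<n. X' (t (Suc i)) \<omega> - X' (t i) \<omega> \<in> A i} \<in> sets M" by measurable
    then show "emeasure (completion M) {\<omega> \<in> space (completion M). \<forall>i<n. X' (t (Suc i)) \<omega> - X' (t i) \<omega> \<in> A i} =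
      (\<Prod>i<n. emeasure (distr (completion M) borel (X' (t (Suc i) - t i))) (A i))"
      unfolding d X'_increments[OF t A, symmetric] by simp
  qed (auto simp: d X'_rcont X'_symmetric X'_ac X'_nonpos intro: measurable_completion)
qed

end

section \<open>Hitting and exit times\<close>

text \<open>A path in the open set \<open>D\<close> up to time \<open>r\<close> stays there until
  some \<open>b > r\<close> by right-continuity, so the infimum is at least \<open>b\<close>; this
  gives the strict inequality. The start in \<open>D\<close> covers time 0, which the exit time
  ignores.\<close>

lemma exit_time_less_iff:
  fixes p :: "real \<Rightarrow> 'v::euclidean_space"
  assumes p: "rcont p" and D: "open D" and x: "x + p 0 \<in> D" and Y: "\<And>t. 0 \<le> t \<Longrightarrow> Y t \<omega> = x + p t" and r: "0 \<le> r"
  shows "ereal r < exit_time Y D \<omega> \<longleftrightarrow> (\<forall>r'\<in>{0..r}. x + p r' \<in> D)"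
proof
  assume *: "ereal r < exit_time Y D \<omega>"
  show "\<forall>r'\<in>{0..r}. x + p r' \<in> D"
  proof (rule ballI, rule ccontr)
    fix r' assume r': "r' \<in> {0..r}" "x + p r' \<notin> D"
    then have "0 < r'" using x by (cases "r' = 0") auto
    then have "exit_time Y D \<omega> \<le> ereal r'" unfolding exit_time_def using r' Y[of r'] by (intro Inf_lower) auto
    also have "\<dots> \<le> ereal r" using r' by simp
    finally show False using * by simp
  qed
next
  assume *: "\<forall>r'\<in>{0..r}. x + p r' \<in> D"
  then obtain b where b: "b > r" "\<And>r'. r \<le> r' \<Longrightarrow> r' < b \<Longrightarrow> x + p r' \<in> D"
    using rcont_open[OF p D, of x r] r by auto
  have "ereal b \<le> exit_time Y D \<omega>"
    unfolding exit_time_def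
  proof (rule Inf_greatest, clarify)
    fix t assume t: "0 < t" "Y t \<omega> \<notin> D"
    then have "x + p t \<notin> D" using Y[of t] by simp
    then have "b \<le> t" using * b(2)[of t] t(1) by (cases "t \<le> r"; cases "t < b") auto
    then show "ereal b \<le> ereal t" by simp
  qed
  then show "ereal r < exit_time Y D \<omega>" using b(1) by (metis ereal_less(2) less_ereal.simps(1) less_le_trans)
qed

lemma hitting_time_eq:
  assumes Y: "\<And>t. 0 \<le> t \<Longrightarrow> Y t \<omega> = x + p t" and hit: "\<exists>r>0. x + p r \<in> B"
  shows "hitting_time Y B \<omega> = ereal (hit_time B x p)"
proof (rule antisym)
  define H where "H = {r. 0 < r \<and> x + p r \<in> B}"
  have bdd: "bdd_below H" by (rule bdd_belowI[of _ 0]) (auto simp: H_def)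
  have ne: "H \<noteq> {}" using hit by (auto simp: H_def)
  have mem: "0 < t \<and> Y t \<omega> \<in> B \<longleftrightarrow> t \<in> H" for t using Y[of t] by (auto simp: H_def)
  have eq: "hitting_time Y B \<omega> = Inf {ereal t |t. t \<in> H}" unfolding hitting_time_def mem ..
  have h: "hit_time B x p = Inf H" by (simp add: hit_time_def H_def)
  show "ereal (hit_time B x p) \<le> hitting_time Y B \<omega>"
    unfolding eq h by (rule Inf_greatest) (use cInf_lower[OF _ bdd] in auto)
  show "hitting_time Y B \<omega> \<le> ereal (hit_time B x p)"
  proof (rule ccontr)
    assume "\<not> hitting_time Y B \<omega> \<le> ereal (hit_time B x p)"
    then obtain c where c: "ereal (Inf H) < ereal c" "ereal c < hitting_time Y B \<omega>"
      unfolding h not_le using ereal_dense2 by blast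
    from c(1) obtain t where t: "t \<in> H" "t < c" using cInf_lessD[OF ne, of c] by auto
    have "hitting_time Y B \<omega> \<le> ereal t" unfolding eq using t(1) by (intro Inf_lower) auto
    also have "\<dots> < ereal c" using t(2) by simp
    finally show False using c(2) by simp
  qed
qed

lemma hitting_time_infinite:
  assumes Y: "\<And>t. 0 \<le> t \<Longrightarrow> Y t \<omega> = x + p t" and hit: "\<not> (\<exists>r>0. x + p r \<in> B)"
  shows "hitting_time Y B \<omega> = \<infinity>"
proof -
  have "{ereal t |t. 0 < t \<and> Y t \<omega> \<in> B} = {}" using assms by auto
  then show ?thesis unfolding hitting_time_def by (simp only: Inf_empty top_ereal_def)
qed

text \<open>Were the position at the infimum outside the closure, right-continuity would keep it
  outside for a while and the infimum would be larger. An open set itself need not contain that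
  position, for instance when the path enters continuously.\<close>

lemma hit_time_closure:
  fixes p :: "real \<Rightarrow> 'v::euclidean_space"
  assumes p: "rcont p" and hit: "\<exists>r>0. x + p r \<in> B"
  shows "0 \<le> hit_time B x p" "x + p (hit_time B x p) \<in> closure B"
proof -
  define H where "H = {r. 0 < r \<and> x + p r \<in> B}"
  have ne: "H \<noteq> {}" using hit by (auto simp: H_def)
  have bdd: "bdd_below H" by (rule bdd_belowI[of _ 0]) (auto simp: H_def)
  have h: "hit_time B x p = Inf H" by (simp add: hit_time_def H_def)
  show "0 \<le> hit_time B x p" unfolding h using ne by (intro cInf_greatest) (auto simp: H_def)
  show "x + p (hit_time B x p) \<in> closure B"
  proof (rule ccontr)
    assume "x + p (hit_time B x p) \<notin> closure B"
    then obtain b where b: "b > Inf H" "\<And>r. Inf H \<le> r \<Longrightarrow> r < b \<Longrightarrow> x + p r \<in> - closure B"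
      using rcont_open[OF p, of "- closure B" x "Inf H"] unfolding h by auto
    obtain t where t: "t \<in> H" "t < b" using cInf_lessD[OF ne b(1)] by blast
    have "Inf H \<le> t" using t(1) bdd by (rule cInf_lower)
    then have "x + p t \<notin> closure B" using b(2) t(2) by auto
    then show False using t(1) closure_subset[of B] by (auto simp: H_def)
  qed
qed

section \<open>Time integrals of Lebesgue measurable potentials\<close>

lemma lebesgue_integral_AE_eq:
  fixes f :: "real \<Rightarrow> real"
  assumes eq: "AE s in lborel. f s = g s" and g[measurable]: "g \<in> borel_measurable lborel"
  shows "(LINT s|lebesgue. f s) = (LINT s|lborel. g s)"
proof -
  have eq': "AE s in lebesgue. f s = g s" using eq by (rule AE_completion)
  have gm: "g \<in> borel_measurable lebesgue" using g by (rule measurable_completion)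
  have "f \<in> borel_measurable lebesgue"
    by (rule complete_measurable_AE_eq[OF completion.complete_measure_axioms gm eq']) simp
  then have "(LINT s|lebesgue. f s) = (LINT s|lebesgue. g s)" using gm eq' by (intro integral_cong_AE)
  also have "\<dots> = (LINT s|lborel. g s)" by (rule integral_completion) simp
  finally show ?thesis .
qed

lemma time_integral_eq:
  assumes ae: "AE s in lborel. 0 \<le> s \<longrightarrow> W (Y s \<omega>) = W' (x + p s)"
    and [measurable]: "W' \<in> borel_measurable borel" "(p :: real \<Rightarrow> 'v::euclidean_space) \<in> borel_measurable borel"
  shows "time_integral W Y (ereal r) \<omega> = (LINT s:{0..r}|lborel. W' (x + p s))"
proof -
  have "{s. 0 \<le> s \<and> ereal s \<le> ereal r} = {0..r}" by auto
  then show ?thesis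
    unfolding time_integral_def set_lebesgue_integral_def
    by (simp only:, intro lebesgue_integral_AE_eq) (use ae in \<open>auto elim!: eventually_mono simp: indicator_def\<close>)
qed

section \<open>Values at the hitting time\<close>

context ground_state_target
begin

lemma hit_time_meas:
  fixes x :: 'v
  defines "\<tau> \<equiv> \<lambda>\<omega>. if \<exists>r>0. x + X r \<omega> \<in> B then hit_time B x (\<lambda>r. X r \<omega>) else 0"
  shows "\<tau> \<in> borel_measurable M"
proof (subst borel_measurable_iff_less, rule allI)
  fix c :: real
  have hit_iff: "(\<exists>r>0. x + X r \<omega> \<in> B) \<longleftrightarrow> (\<exists>n. hits B x (real (Suc n)) (\<lambda>r. X r \<omega>))" for \<omega>
  proof
    assume "\<exists>r>0. x + X r \<omega> \<in> B"
    then obtain r where r: "r > 0" "x + X r \<omega> \<in> B" by blast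
    obtain n where "r \<le> real n" using real_arch_simple by blast
    then show "\<exists>n. hits B x (real (Suc n)) (\<lambda>r. X r \<omega>)" unfolding hits_def using r by (intro exI[of _ n] exI[of _ r]) auto
  qed (auto simp: hits_def)
  have lt_iff: "(\<exists>r>0. x + X r \<omega> \<in> B) \<and> hit_time B x (\<lambda>r. X r \<omega>) < c \<longleftrightarrow>
      (\<exists>q\<in>\<rat> \<inter> {0<..<c}. hits B x q (\<lambda>r. X r \<omega>))" for \<omega>
  proof
    assume *: "(\<exists>r>0. x + X r \<omega> \<in> B) \<and> hit_time B x (\<lambda>r. X r \<omega>) < c"
    then have "{r. 0 < r \<and> x + X r \<omega> \<in> B} \<noteq> {}" by auto
    from cInf_lessD[OF this, of c] * obtain r where r: "0 < r" "x + X r \<omega> \<in> B" "r < c"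
      by (auto simp: hit_time_def)
    obtain q where "q \<in> \<rat>" "r < q" "q < c" using Rats_dense_in_real[OF r(3)] by blast
    then show "\<exists>q\<in>\<rat> \<inter> {0<..<c}. hits B x q (\<lambda>r. X r \<omega>)"
      using r by (intro bexI[of _ q]) (auto simp: hits_def intro!: exI[of _ r])
  next
    assume "\<exists>q\<in>\<rat> \<inter> {0<..<c}. hits B x q (\<lambda>r. X r \<omega>)"
    then obtain q where q: "q < c" "hits B x q (\<lambda>r. X r \<omega>)" by auto
    then show "(\<exists>r>0. x + X r \<omega> \<in> B) \<and> hit_time B x (\<lambda>r. X r \<omega>) < c"
      using hit_time_props(2)[OF q(2)] by (auto simp: hits_def)
  qed
  \<comment> \<open>The second set accounts for the default value 0 on paths that never hit.\<close>
  have "{\<omega> \<in> space M. \<tau> \<omega> < c} = {\<omega> \<in> space M. \<exists>q\<in>\<rat> \<inter> {0<..<c}. hits B x q (\<lambda>r. X r \<omega>)} \<union>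
      {\<omega> \<in> space M. \<not> (\<exists>n. hits B x (real (Suc n)) (\<lambda>r. X r \<omega>)) \<and> 0 < c}"
    unfolding lt_iff[symmetric] hit_iff[symmetric] \<tau>_def by auto
  also have "\<dots> \<in> sets M"
  proof (intro sets.Un)
    have "countable (\<rat> \<inter> {0<..<c})" using countable_rat by blast
    then show "{\<omega> \<in> space M. \<exists>q\<in>\<rat> \<inter> {0<..<c}. hits B x q (\<lambda>r. X r \<omega>)} \<in> sets M"
      by (intro sets.sets_Collect_countable_Ex' hits_meas) auto
    have "{\<omega> \<in> space M. \<exists>n. hits B x (real (Suc n)) (\<lambda>r. X r \<omega>)} \<in> sets M"
      by (intro sets.sets_Collect_countable_Ex hits_meas) auto
    then show "{\<omega> \<in> space M. \<not> (\<exists>n. hits B x (real (Suc n)) (\<lambda>r. X r \<omega>)) \<and> 0 < c} \<in> sets M"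
      by (intro sets.sets_Collect_conj sets.sets_Collect_neg sets.sets_Collect_const)
  qed
  finally show "{\<omega> \<in> space M. \<tau> \<omega> < c} \<in> sets M" .
qed

lemma hitting_value_meas:
  fixes x :: 'v
  defines "\<tau> \<equiv> \<lambda>\<omega>. if \<exists>r>0. x + X r \<omega> \<in> B then hit_time B x (\<lambda>r. X r \<omega>) else 0"
  shows "(\<lambda>\<omega>. \<phi> (x + X (\<tau> \<omega>) \<omega>)) \<in> borel_measurable M"
proof -
  have [measurable]: "\<tau> \<in> borel_measurable M" unfolding \<tau>_def by (rule hit_time_meas)
  have "(\<lambda>\<omega>. \<phi> (x + right_ext (\<lambda>r. X r \<omega>) (\<tau> \<omega>))) \<in> borel_measurable M" by measurable
  then show ?thesis by (simp add: X_rcont)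
qed

text \<open>The integrand without the factor \<open>\<phi>\<close> is \<open>F\<close> divided by
  the value of \<open>\<phi>\<close> at the hitting point. That point is in the closure of
  \<open>B\<close>, so the divisor lies between \<open>m\<close> and \<open>m'\<close>; positivity
  of \<open>m\<close> also provides integrability.\<close>

lemma hitting_bounds:
  assumes x: "x \<in> D" "x \<notin> B" and m: "0 < m" "\<And>y. y \<in> closure B \<Longrightarrow> m \<le> \<phi> y" "\<And>y. y \<in> closure B \<Longrightarrow> \<phi> y \<le> m'"
    and I: "AE \<omega> in M. I \<omega> = (if \<exists>r>0. x + X r \<omega> \<in> B then
        mart x (hit_time B x (\<lambda>r. X r \<omega>)) (\<lambda>r. X r \<omega>) / \<phi> (x + X (hit_time B x (\<lambda>r. X r \<omega>)) \<omega>) else 0)"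
  shows "m * (LINT \<omega>|M. I \<omega>) \<le> \<phi> x" "\<phi> x \<le> m' * (LINT \<omega>|M. I \<omega>)"
proof -
  define F where "F \<omega> = (if \<exists>r>0. x + X r \<omega> \<in> B then mart x (hit_time B x (\<lambda>r. X r \<omega>)) (\<lambda>r. X r \<omega>) else 0)" for \<omega>
  define \<tau> where "\<tau> \<omega> = (if \<exists>r>0. x + X r \<omega> \<in> B then hit_time B x (\<lambda>r. X r \<omega>) else 0)" for \<omega>
  define J where "J \<omega> = F \<omega> / \<phi> (x + X (\<tau> \<omega>) \<omega>)" for \<omega>
  have Fm[measurable]: "F \<in> borel_measurable M" and Fi: "(\<integral>\<^sup>+\<omega>. ennreal (F \<omega>) \<partial>M) = ennreal (\<phi> x)"
    unfolding F_def by (rule hitting_expectation[OF x])+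
  have F0: "0 \<le> F \<omega>" for \<omega> by (simp add: F_def mart_nonneg)
  have F_int: "integrable M F" by (rule integrableI_nonneg) (use F0 Fi in auto)
  have F_eq: "(LINT \<omega>|M. F \<omega>) = \<phi> x"
    by (subst integral_eq_nn_integral) (use F0 Fi \<phi>_nonneg in auto)
  have Jm[measurable]: "J \<in> borel_measurable M"
    using hitting_value_meas[of x] unfolding J_def \<tau>_def by measurable
  have val: "m \<le> \<phi> (x + X (\<tau> \<omega>) \<omega>)" "\<phi> (x + X (\<tau> \<omega>) \<omega>) \<le> m'" if "\<exists>r>0. x + X r \<omega> \<in> B" for \<omega>
    using hit_time_closure(2)[OF X_rcont that] that m(2,3) by (simp_all add: \<tau>_def)
  have J: "0 \<le> J \<omega>" "m * J \<omega> \<le> F \<omega>" "F \<omega> \<le> m' * J \<omega>" for \<omega>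
  proof -
    have "0 \<le> J \<omega> \<and> m * J \<omega> \<le> F \<omega> \<and> F \<omega> \<le> m' * J \<omega>"
    proof (cases "\<exists>r>0. x + X r \<omega> \<in> B")
      case True
      define v where "v = \<phi> (x + X (\<tau> \<omega>) \<omega>)"
      have v: "0 < v" "m \<le> v" "v \<le> m'" using val[OF True] m(1) by (auto simp: v_def)
      have "F \<omega> = v * J \<omega>" "0 \<le> J \<omega>" using v(1) F0[of \<omega>] by (auto simp: J_def v_def[symmetric])
      then show ?thesis using v by (auto intro: mult_right_mono)
    next
      case False
      then have "F \<omega> = 0" by (simp only: F_def if_False)
      then show ?thesis by (simp add: J_def)
    qed
    then show "0 \<le> J \<omega>" "m * J \<omega> \<le> F \<omega>" "F \<omega> \<le> m' * J \<omega>" by auto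
  qed
  have J_int: "integrable M J"
  proof (rule Bochner_Integration.integrable_bound[of M "\<lambda>\<omega>. F \<omega> / m"])
    show "AE \<omega> in M. norm (J \<omega>) \<le> norm (F \<omega> / m)"
      using J F0 m(1) by (intro AE_I2) (auto simp: field_simps)
  qed (use F_int in auto)
  have IJ: "AE \<omega> in M. I \<omega> = J \<omega>"
    using I by eventually_elim (auto simp: J_def F_def \<tau>_def)
  have Im: "I \<in> borel_measurable M"
    by (rule complete_measurable_AE_eq[OF complete Jm IJ]) simp
  have "(LINT \<omega>|M. I \<omega>) = (LINT \<omega>|M. J \<omega>)" using IJ Im by (intro integral_cong_AE) auto
  moreover have "m * (LINT \<omega>|M. J \<omega>) \<le> (LINT \<omega>|M. F \<omega>)"
    using J_int F_int J by (subst integral_mult_right_zero[symmetric], intro integral_mono) auto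
  moreover have "(LINT \<omega>|M. F \<omega>) \<le> m' * (LINT \<omega>|M. J \<omega>)"
    using J_int F_int J by (subst integral_mult_right_zero[symmetric], intro integral_mono) auto
  ultimately show "m * (LINT \<omega>|M. I \<omega>) \<le> \<phi> x" "\<phi> x \<le> m' * (LINT \<omega>|M. I \<omega>)" by (simp_all add: F_eq)
qed

lemma hitting_integral:
  assumes x: "x \<in> D" "x \<notin> B"
    and I: "AE \<omega> in M. I \<omega> = (if \<exists>r>0. x + X r \<omega> \<in> B then
        mart x (hit_time B x (\<lambda>r. X r \<omega>)) (\<lambda>r. X r \<omega>) else 0)"
  shows "(LINT \<omega>|M. I \<omega>) = \<phi> x"
proof -
  define F where "F \<omega> = (if \<exists>r>0. x + X r \<omega> \<in> B then mart x (hit_time B x (\<lambda>r. X r \<omega>)) (\<lambda>r. X r \<omega>) else 0)" for \<omega>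
  have Fm[measurable]: "F \<in> borel_measurable M" and Fi: "(\<integral>\<^sup>+\<omega>. ennreal (F \<omega>) \<partial>M) = ennreal (\<phi> x)"
    unfolding F_def by (rule hitting_expectation[OF x])+
  have F0: "0 \<le> F \<omega>" for \<omega> by (simp add: F_def mart_nonneg)
  have IF: "AE \<omega> in M. I \<omega> = F \<omega>" using I unfolding F_def .
  have Im: "I \<in> borel_measurable M"
    by (rule complete_measurable_AE_eq[OF complete Fm IF]) simp
  have "(LINT \<omega>|M. I \<omega>) = (LINT \<omega>|M. F \<omega>)" using IF Im by (intro integral_cong_AE) auto
  also have "\<dots> = \<phi> x" by (subst integral_eq_nn_integral) (use F0 Fi \<phi>_nonneg in auto)
  finally show ?thesis .
qed

end

section \<open>The principal eigenfunction\<close>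

lemma essentially_bounded_borel:
  fixes V :: "'v::euclidean_space \<Rightarrow> real"
  assumes "essentially_bounded V"
  obtains V' C where "V' \<in> borel_measurable borel" "\<And>y. \<bar>V' y\<bar> \<le> C" "AE y in lborel. V y = V' y"
proof -
  obtain C where V: "V \<in> borel_measurable lebesgue" and C: "AE x in lebesgue. \<bar>V x\<bar> \<le> C"
    using assms by (auto simp: essentially_bounded_def)
  obtain g where g[measurable]: "g \<in> borel_measurable lborel" and eq: "AE x in lborel. V x = g x"
    using completion_ex_borel_measurable_real[OF V] by blast
  \<comment> \<open>The cutoff turns the almost everywhere bound into one that holds everywhere; the
    absolute value keeps the two cutoff levels in order.\<close>
  define V' where "V' y = max (- \<bar>C\<bar>) (min \<bar>C\<bar> (g y))" for y
  have "AE x in lborel. \<bar>V x\<bar> \<le> C" using C by (simp add: AE_completion_iff)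
  with eq have "AE y in lborel. V y = V' y"
    by eventually_elim (auto simp: V'_def)
  moreover have "V' \<in> borel_measurable borel" unfolding V'_def by measurable
  moreover have "\<bar>V' y\<bar> \<le> \<bar>C\<bar>" for y by (auto simp: V'_def)
  ultimately show ?thesis using that by blast
qed

lemma subordination_exists:
  assumes "subordinate_brownian_motion M B S \<Psi> X" "hartman_wintner \<Psi>"
  obtains G where "subordination M B S \<Psi> G"
proof -
  have bm: "brownian_motion M B" and sub: "subordinator M S \<Psi>" using assms(1)
    by (auto simp: subordinate_brownian_motion_def)
  have B: "levy_process M B" and S: "levy_process M S" using bm sub by (auto simp: brownian_motion_def subordinator_def)
  interpret prob_space M using B by (simp add: levy_process_def)
  have "AE \<omega> in M. continuous_on {0..} (\<lambda>t. B t \<omega>) \<and> B 0 \<omega> = 0 \<and> mono_on {0..} (\<lambda>t. S t \<omega>) \<and> S 0 \<omega> = 0 \<and>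
      cadlag_path (\<lambda>t. S t \<omega>)"
    using bm sub B S unfolding brownian_motion_def subordinator_def levy_process_def by auto
  then obtain N where N: "\<And>\<omega>. \<omega> \<in> space M - N \<Longrightarrow> continuous_on {0..} (\<lambda>t. B t \<omega>) \<and> B 0 \<omega> = 0 \<and>
      mono_on {0..} (\<lambda>t. S t \<omega>) \<and> S 0 \<omega> = 0 \<and> cadlag_path (\<lambda>t. S t \<omega>)" "N \<in> null_sets M"
    by (rule AE_E3) blast
  have "subordination M B S \<Psi> (space M - N)"
  proof (intro subordination.intro subordination_axioms.intro)
    show "AE \<omega> in M. \<omega> \<in> space M - N" using AE_not_in[OF N(2)] AE_space by eventually_elim auto
  qed (use N assms prob_space_axioms in
      \<open>auto simp: subordinate_brownian_motion_def cadlag_path_def\<close>)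
  then show ?thesis using that by blast
qed

text \<open>By Fubini and absolute continuity the path spends no time in a Lebesgue null set, which
  makes time integrals independent of the representative of \<open>V\<close>. Time 0 is left out
  because the starting point may lie in \<open>N\<close>.\<close>

lemma (in feynman_kac_levy) AE_path_avoids:
  assumes N: "N \<in> null_sets lborel"
  shows "AE \<omega> in M. AE s in lborel. 0 < s \<longrightarrow> x + X s \<omega> \<notin> N"
proof -
  interpret MR: pair_sigma_finite M "lborel :: real measure" ..
  have [measurable]: "N \<in> sets borel" using N by auto
  have "(\<lambda>w. right_ext (\<lambda>t. X t (fst w)) (snd w)) \<in> borel_measurable (M \<Otimes>\<^sub>M lborel)"
    by (intro measurable_right_ext measurable_compose[OF measurable_fst path_meas]) measurable
  then have [measurable]: "(\<lambda>w. X (snd w) (fst w)) \<in> borel_measurable (M \<Otimes>\<^sub>M lborel)" by (simp add: X_rcont)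
  have "{w \<in> space (M \<Otimes>\<^sub>M lborel). 0 < snd w \<longrightarrow> x + X (snd w) (fst w) \<notin> N} \<in> sets (M \<Otimes>\<^sub>M lborel)"
    by measurable
  moreover have "AE s in lborel. AE \<omega> in M. 0 < s \<longrightarrow> x + X s \<omega> \<notin> N"
  proof (rule AE_I2)
    fix s :: real
    show "AE \<omega> in M. 0 < s \<longrightarrow> x + X s \<omega> \<notin> N"
      using AE_not_in_null[OF N, of s x] by (cases "0 < s") auto
  qed
  ultimately show ?thesis
    using MR.AE_commute[where P="\<lambda>\<omega> s. 0 < s \<longrightarrow> x + X s \<omega> \<notin> N"] by simp
qed

text \<open>Connects the regular version and the bounded Borel potential, on which the theory above
  rests, with the given process and potential.\<close>

locale process_version = feynman_kac_levy "completion M" X' V' C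
  for M :: "'w measure" and X' :: "real \<Rightarrow> 'w \<Rightarrow> 'v::euclidean_space" and V' :: "'v \<Rightarrow> real" and C :: real +
  fixes X :: "real \<Rightarrow> 'w \<Rightarrow> 'v" and V :: "'v \<Rightarrow> real"
  assumes X_version: "AE \<omega> in completion M. \<forall>t\<ge>0. X t \<omega> = X' t \<omega>"
    and V_version: "AE y in lborel. V y = V' y"
begin

definition good :: "'v \<Rightarrow> 'w \<Rightarrow> bool" where
  "good x \<omega> \<longleftrightarrow> (\<forall>t\<ge>0. started x X t \<omega> = x + X' t \<omega>) \<and>
     (AE s in lborel. 0 \<le> s \<longrightarrow> V (started x X s \<omega>) = V' (x + X' s \<omega>))"

lemma AE_good: "AE \<omega> in completion M. good x \<omega>"
proof -
  obtain N where N: "N \<in> null_sets lborel" "{y \<in> space lborel. V y \<noteq> V' y} \<subseteq> N"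
    using V_version unfolding eventually_ae_filter by auto
  from X_version AE_path_avoids[OF N(1), of x] show ?thesis
  proof eventually_elim
    fix \<omega> assume X: "\<forall>t\<ge>0. X t \<omega> = X' t \<omega>" and ae: "AE s in lborel. 0 < s \<longrightarrow> x + X' s \<omega> \<notin> N"
    have "AE s in lborel. 0 \<le> s \<longrightarrow> V (started x X s \<omega>) = V' (x + X' s \<omega>)"
      using ae AE_lborel_singleton[of 0]
    proof eventually_elim
      fix s :: real assume s: "0 < s \<longrightarrow> x + X' s \<omega> \<notin> N" "s \<noteq> 0"
      show "0 \<le> s \<longrightarrow> V (started x X s \<omega>) = V' (x + X' s \<omega>)"
      proof
        assume "0 \<le> s"
        then have "x + X' s \<omega> \<notin> N" "X s \<omega> = X' s \<omega>" using s X by auto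
        then show "V (started x X s \<omega>) = V' (x + X' s \<omega>)" using N(2) by (auto simp: started_def)
      qed
    qed
    then show "good x \<omega>" using X by (simp add: good_def started_def)
  qed
qed

lemma good_path: "good x \<omega> \<Longrightarrow> 0 \<le> t \<Longrightarrow> started x X t \<omega> = x + X' t \<omega>"
  by (simp add: good_def)

lemma good_time_integral:
  assumes "good x \<omega>" "0 \<le> r"
  shows "time_integral V (started x X) (ereal r) \<omega> = pot x r (\<lambda>t. X' t \<omega>)"
    and "time_integral (\<lambda>y. a - V y) (started x X) (ereal r) \<omega> = a * r - pot x r (\<lambda>t. X' t \<omega>)"
proof -
  have m[measurable]: "(\<lambda>t. X' t \<omega>) \<in> borel_measurable borel" by (rule rcont_measurable[OF X_rcont])
  have ae: "AE s in lborel. 0 \<le> s \<longrightarrow> V (started x X s \<omega>) = V' (x + X' s \<omega>)"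
    using assms(1) unfolding good_def by blast
  show "time_integral V (started x X) (ereal r) \<omega> = pot x r (\<lambda>t. X' t \<omega>)"
    unfolding pot_def using ae by (intro time_integral_eq) auto
  have "time_integral (\<lambda>y. a - V y) (started x X) (ereal r) \<omega> = (LINT s:{0..r}|lborel. a - V' (x + X' s \<omega>))"
    using ae by (intro time_integral_eq[where W'="\<lambda>y. a - V' y"]) (auto elim!: eventually_mono)
  also have "\<dots> = (LINT s:{0..r}|lborel. a) - (LINT s:{0..r}|lborel. V' (x + X' s \<omega>))"
    by (intro set_integral_diff pot_integrable m) (simp add: set_integrable_def emeasure_lborel_Icc_eq)
  also have "(LINT s:{0..r}|lborel. a) = a * r"
    using assms(2) by (simp add: set_lebesgue_integral_def mult.commute)
  finally show "time_integral (\<lambda>y. a - V y) (started x X) (ereal r) \<omega> = a * r - pot x r (\<lambda>t. X' t \<omega>)"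
    by (simp add: pot_def)
qed

lemma good_exit:
  assumes "good x \<omega>" "open D" "x \<in> D" "0 \<le> r"
  shows "ereal r < exit_time (started x X) D \<omega> \<longleftrightarrow> (\<forall>r'\<in>{0..r}. x + X' r' \<omega> \<in> D)"
  using assms good_path[OF assms(1)]
  by (intro exit_time_less_iff[where Y="started x X"] X_rcont) (auto simp: X_nonpos)

text \<open>Quasi-left-continuity turns the exit time indicator into \<open>stays\<close>.
  Finiteness does not have to be checked: the Bochner integral of a nonnegative function that is not
  integrable and \<open>enn2real\<close> of infinity are both 0.\<close>

lemma feynman_kac_semigroup:
  assumes D: "open D" "D \<noteq> UNIV" and x: "x \<in> D" and t: "0 < t"
    and f[measurable]: "f \<in> borel_measurable borel" and f0: "\<And>y. 0 \<le> f y"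
  shows "feynman_kac M X D V t f x = enn2real (semigroup (inner_sets D) t (\<lambda>y. ennreal (f y)) x)"
proof -
  define w where "w \<omega> = weight (inner_sets D) t (\<lambda>y. ennreal (f y)) x (\<lambda>t. X' t \<omega>)" for \<omega>
  have w[measurable]: "w \<in> borel_measurable (completion M)"
    unfolding w_def using t by (intro measurable_weight closed_inner_sets) auto
  have fin: "w \<omega> < \<top>" for \<omega> by (auto simp: w_def weight_def ennreal_mult_less_top)
  have ae: "AE \<omega> in completion M. exp (- time_integral V (started x X) (ereal t) \<omega>) * f (started x X t \<omega>) *
        of_bool (ereal t < exit_time (started x X) D \<omega>) = enn2real (w \<omega>)"
    using AE_good[of x] stays_inner[OF D less_imp_le[OF t], of x]
  proof eventually_elim
    fix \<omega> assume g: "good x \<omega>"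
      and st: "(\<forall>r\<in>{0..t}. x + X' r \<omega> \<in> D) \<longrightarrow> stays (inner_sets D) x t (\<lambda>t. X' t \<omega>)"
    have "stays (inner_sets D) x t (\<lambda>t. X' t \<omega>) \<Longrightarrow> \<forall>r\<in>{0..t}. x + X' r \<omega> \<in> D"
      using inner_sets_subset[of D] unfolding stays_def by blast
    then have "ereal t < exit_time (started x X) D \<omega> \<longleftrightarrow> stays (inner_sets D) x t (\<lambda>t. X' t \<omega>)"
      using st good_exit[OF g D(1) x, of t] t by auto
    then show "exp (- time_integral V (started x X) (ereal t) \<omega>) * f (started x X t \<omega>) *
        of_bool (ereal t < exit_time (started x X) D \<omega>) = enn2real (w \<omega>)"
      using good_time_integral(1)[OF g, of t] good_path[OF g, of t] t f0
      by (simp add: w_def weight_def enn2real_mult)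
  qed
  have m: "(\<lambda>\<omega>. exp (- time_integral V (started x X) (ereal t) \<omega>) * f (started x X t \<omega>) *
        of_bool (ereal t < exit_time (started x X) D \<omega>)) \<in> borel_measurable (completion M)"
    by (rule complete_measurable_AE_eq[OF complete _ ae]) simp_all
  have "feynman_kac M X D V t f x = (LINT \<omega>|completion M. enn2real (w \<omega>))"
    unfolding feynman_kac_def using m ae by (intro integral_cong_AE) auto
  also have "\<dots> = enn2real (\<integral>\<^sup>+\<omega>. ennreal (enn2real (w \<omega>)) \<partial>completion M)"
    by (rule integral_eq_nn_integral) auto
  also have "(\<lambda>\<omega>. ennreal (enn2real (w \<omega>))) = w" using fin by (auto simp: fun_eq_iff)
  finally show ?thesis unfolding semigroup_def w_def .
qed

end

section \<open>From semigroup eigenfunctions to the generator\<close>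

lemma exp_quotient_tendsto:
  fixes lam :: real
  shows "((\<lambda>t. (exp (- lam * t) - 1) / t + lam) \<longlongrightarrow> 0) (at_right 0)"
proof -
  have "((\<lambda>t. exp (- lam * t)) has_real_derivative (- lam)) (at 0)"
    by (auto intro!: derivative_eq_intros)
  then have "((\<lambda>t. (exp (- lam * t) - 1) / t) \<longlongrightarrow> - lam) (at 0)"
    by (simp add: has_field_derivative_iff)
  then have "((\<lambda>t. (exp (- lam * t) - 1) / t) \<longlongrightarrow> - lam) (at_right 0)"
    by (rule tendsto_within_subset) auto
  then have "((\<lambda>t. (exp (- lam * t) - 1) / t + lam) \<longlongrightarrow> - lam + lam) (at_right 0)"
    by (intro tendsto_intros)
  then show ?thesis by simp
qed

text \<open>The error of the difference quotient is a scalar multiple of \<open>u\<close>, and the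
  scalar tends to 0 with \<open>t\<close>. Boundedness of \<open>u\<close> on a bounded set makes
  its L2 norm finite.\<close>

lemma fk_generator_eigen:
  fixes u :: "'v::euclidean_space \<Rightarrow> real"
  assumes u[measurable]: "u \<in> borel_measurable borel" and K: "\<And>y. \<bar>u y\<bar> \<le> K" and D: "open D" "bounded D"
    and eig: "\<And>t. 0 < t \<Longrightarrow> AE x in lborel. x \<in> D \<longrightarrow> feynman_kac M X D V t u x = exp (- lam * t) * u x"
  shows "hamiltonian M X D V u (\<lambda>x. lam * u x)"
proof -
  have Ds: "D \<in> sets lebesgue" using D(1) by simp
  have um: "u \<in> borel_measurable (lebesgue_on D)"
    by (intro measurable_restrict_space1 measurable_completion) simp
  have Dfin: "emeasure (lebesgue_on D) (space (lebesgue_on D)) < \<infinity>"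
    using emeasure_bounded_finite[OF D(2)] Ds D(1) by (simp add: emeasure_restrict_space)
  interpret LD: finite_measure "lebesgue_on D"
    by (rule finite_measureI) (use Dfin in auto)
  have sq: "integrable (lebesgue_on D) (\<lambda>x. (c * u x)\<^sup>2)" for c :: real
  proof (rule LD.integrable_const_bound[where B="(c * K)\<^sup>2"])
    have "\<bar>c * u x\<bar> \<le> \<bar>c * K\<bar>" for x
      using K[of x] by (simp add: abs_mult) (intro mult_left_mono, auto intro: order.trans[OF _ abs_ge_self])
    then have "(c * u x)\<^sup>2 \<le> (c * K)\<^sup>2" for x by (metis abs_le_square_iff)
    then show "AE x in lebesgue_on D. norm ((c * u x)\<^sup>2) \<le> (c * K)\<^sup>2" by simp
  qed (use um in simp)
  have L2: "u \<in> L2_on D" "(\<lambda>x. - (lam * u x)) \<in> L2_on D"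
    using um sq[of 1] sq[of lam] by (auto simp: L2_on_def)
  define I where "I = (LINT x|lebesgue_on D. (u x)\<^sup>2)"
  have "((\<lambda>t. ennreal (((exp (- lam * t) - 1) / t + lam)\<^sup>2 * I)) \<longlongrightarrow> ennreal (0\<^sup>2 * I)) (at_right 0)"
    by (intro tendsto_intros exp_quotient_tendsto)
  moreover have "eventually (\<lambda>t. ennreal (((exp (- lam * t) - 1) / t + lam)\<^sup>2 * I) =
     (\<integral>\<^sup>+x. ennreal (((feynman_kac M X D V t u x - u x) / t - - (lam * u x))\<^sup>2) \<partial>lebesgue_on D)) (at_right 0)"
    using eventually_at_right_less[of 0]
  proof eventually_elim
    fix t :: real assume t: "0 < t"
    define c where "c = (exp (- lam * t) - 1) / t + lam"
    have "AE x in lebesgue. x \<in> D \<longrightarrow> feynman_kac M X D V t u x = exp (- lam * t) * u x"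
      using eig[OF t] by (rule AE_completion)
    then have "AE x in lebesgue_on D. feynman_kac M X D V t u x = exp (- lam * t) * u x"
      using Ds by (subst AE_restrict_space_iff) auto
    then have "(\<integral>\<^sup>+x. ennreal (((feynman_kac M X D V t u x - u x) / t - - (lam * u x))\<^sup>2) \<partial>lebesgue_on D) =
       (\<integral>\<^sup>+x. ennreal ((c * u x)\<^sup>2) \<partial>lebesgue_on D)"
    proof (intro nn_integral_cong_AE, eventually_elim)
      fix x assume "feynman_kac M X D V t u x = exp (- lam * t) * u x"
      then have "(feynman_kac M X D V t u x - u x) / t - - (lam * u x) = c * u x"
        using t by (simp add: c_def field_simps)
      then show "ennreal (((feynman_kac M X D V t u x - u x) / t - - (lam * u x))\<^sup>2) = ennreal ((c * u x)\<^sup>2)" by simp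
    qed
    also have "\<dots> = ennreal (LINT x|lebesgue_on D. (c * u x)\<^sup>2)"
      using sq[of c] by (rule nn_integral_eq_integral) simp
    also have "(LINT x|lebesgue_on D. (c * u x)\<^sup>2) = c\<^sup>2 * I" by (simp add: I_def power_mult_distrib)
    finally show "ennreal (((exp (- lam * t) - 1) / t + lam)\<^sup>2 * I) =
     (\<integral>\<^sup>+x. ennreal (((feynman_kac M X D V t u x - u x) / t - - (lam * u x))\<^sup>2) \<partial>lebesgue_on D)" by (simp add: c_def)
  qed
  ultimately have "((\<lambda>t. \<integral>\<^sup>+x. ennreal (((feynman_kac M X D V t u x - u x) / t - - (lam * u x))\<^sup>2) \<partial>lebesgue_on D) \<longlongrightarrow> 0) (at_right 0)"
    by (simp add: tendsto_cong)
  then show ?thesis using L2 by (simp add: hamiltonian_def fk_generator_def)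
qed

context process_version
begin

lemma ground_state_of_principal_eigenpair:
  assumes D: "bounded_domain D" and pe: "principal_eigenpair M X D V \<phi> lam"
  shows "ground_state (completion M) X' V' C D \<phi> lam"
proof -
  have Do: "open D" "bounded D" using D by (auto simp: bounded_domain_def)
  have DU: "D \<noteq> UNIV" using Do(2) not_bounded_UNIV by auto
  have \<phi>: "\<And>x. x \<in> D \<Longrightarrow> 0 < \<phi> x" "\<And>x. x \<notin> D \<Longrightarrow> \<phi> x = 0" "continuous_on UNIV \<phi>"
    "\<And>t x. 0 \<le> t \<Longrightarrow> x \<in> D \<Longrightarrow> feynman_kac M X D V t \<phi> x = exp (- lam * t) * \<phi> x"
    using pe by (auto simp: principal_eigenpair_def)
  have \<phi>0: "0 \<le> \<phi> x" for x using \<phi>(1,2)[of x] by (cases "x \<in> D") auto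
  have \<phi>m[measurable]: "\<phi> \<in> borel_measurable borel" using \<phi>(3) by (rule borel_measurable_continuous_onI)
  show ?thesis
  proof (intro ground_state.intro ground_state_axioms.intro)
    show "feynman_kac_levy (completion M) X' V' C" by (rule feynman_kac_levy_axioms)
    fix t :: real and x assume t: "0 < t" and x: "x \<in> D"
    have e: "enn2real (semigroup (inner_sets D) t (\<lambda>y. ennreal (\<phi> y)) x) = exp (- lam * t) * \<phi> x"
      using feynman_kac_semigroup[OF Do(1) DU x t \<phi>m \<phi>0] \<phi>(4)[of t x] t x by simp
    \<comment> \<open>\<open>enn2real\<close> sends infinity to 0, so a nonzero value certifies
      finiteness.\<close>
    then have "enn2real (semigroup (inner_sets D) t (\<lambda>y. ennreal (\<phi> y)) x) \<noteq> 0" using \<phi>(1)[OF x] by simp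
    then have "semigroup (inner_sets D) t (\<lambda>y. ennreal (\<phi> y)) x < \<top>"
      by (cases "semigroup (inner_sets D) t (\<lambda>y. ennreal (\<phi> y)) x = \<top>") (simp_all add: less_top[symmetric])
    then show "semigroup (inner_sets D) t (\<lambda>y. ennreal (\<phi> y)) x = ennreal (exp (- lam * t) * \<phi> x)"
      using e by (metis ennreal_enn2real)
  next
    fix u assume u: "u \<in> borel_measurable borel" "\<And>x. 0 \<le> u x" "\<And>x. u x \<le> \<phi> x"
      and eig: "\<And>t. 0 < t \<Longrightarrow> AE x in lborel. x \<in> D \<longrightarrow>
        semigroup (inner_sets D) t (\<lambda>y. ennreal (u y)) x = ennreal (exp (- lam * t) * u x)"
    have AE_iff: "(AE x in lebesgue_on D. P x) \<longleftrightarrow> (AE x in lborel. x \<in> D \<longrightarrow> P x)" for P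
      using Do(1) by (subst AE_restrict_space_iff) (auto simp: AE_completion_iff)
    have "compact (\<phi> ` closure D)"
      using Do by (intro compact_continuous_image continuous_on_subset[OF \<phi>(3)]) (auto simp: compact_closure)
    then obtain K where K: "\<And>y. y \<in> closure D \<Longrightarrow> norm (\<phi> y) \<le> K"
      using compact_imp_bounded bounded_iff by (metis imageI)
    have uK: "\<bar>u y\<bar> \<le> max K 0" for y
      using K[of y] u(2,3)[of y] \<phi>(2)[of y] closure_subset[of D] by (cases "y \<in> D") force+
    have "hamiltonian M X D V u (\<lambda>x. lam * u x)"
    proof (rule fk_generator_eigen[OF u(1) uK Do])
      fix t :: real assume t: "0 < t"
      show "AE x in lborel. x \<in> D \<longrightarrow> feynman_kac M X D V t u x = exp (- lam * t) * u x"
        using eig[OF t]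
      proof eventually_elim
        fix x assume *: "x \<in> D \<longrightarrow> semigroup (inner_sets D) t (\<lambda>y. ennreal (u y)) x = ennreal (exp (- lam * t) * u x)"
        show "x \<in> D \<longrightarrow> feynman_kac M X D V t u x = exp (- lam * t) * u x"
          using * feynman_kac_semigroup[OF Do(1) DU _ t u(1,2), of x] u(2)[of x] by auto
      qed
    qed
    show "\<exists>c. AE x in lborel. x \<in> D \<longrightarrow> u x = c * \<phi> x"
    \<comment> \<open>The zero function is not an eigenfunction, so simplicity does not apply to it;
      \<open>c = 0\<close> serves instead.\<close>
    proof (cases "AE x in lebesgue_on D. u x = 0")
      case True
      then show ?thesis unfolding AE_iff by (intro exI[of _ 0]) simp
    next
      case False
      then have "eigenfunction M X D V lam u"
        using \<open>hamiltonian M X D V u (\<lambda>x. lam * u x)\<close> by (simp add: eigenfunction_def)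
      moreover have "eigenfunction M X D V lam \<phi>" "simple_eigenvalue M X D V lam"
        using pe by (auto simp: principal_eigenpair_def)
      ultimately have "\<exists>c. AE x in lebesgue_on D. u x = c * \<phi> x"
        unfolding simple_eigenvalue_def by blast
      then show ?thesis unfolding AE_iff .
    qed
  qed (use Do \<phi> in auto)
qed

text \<open>On a path that never hits, the hitting time is infinite and cannot be strictly below the
  exit time, so the integrand is 0 whatever its other factors are. The function \<open>f\<close>
  will be \<open>\<phi>\<close> or the constant 1.\<close>

lemma hitting_functional_AE:
  assumes gs: "ground_state (completion M) X' V' C D \<phi> lam" and x: "x \<in> D"
  shows "AE \<omega> in completion M.
     (let Y = started x X; \<tau> = hitting_time Y B \<omega> in
       exp (time_integral (\<lambda>y. lam - V y) Y \<tau> \<omega>) * f (Y (real_of_ereal \<tau>) \<omega>) * of_bool (\<tau> < exit_time Y D \<omega>)) =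
     (if \<exists>r>0. x + X' r \<omega> \<in> B then
       (let h = hit_time B x (\<lambda>r. X' r \<omega>) in
         exp (lam * h - pot x h (\<lambda>r. X' r \<omega>)) * f (x + X' h \<omega>) * of_bool (\<forall>r'\<in>{0..h}. x + X' r' \<omega> \<in> D)) else 0)"
  using AE_good[of x]
proof eventually_elim
  fix \<omega> assume g: "good x \<omega>"
  have D: "open D" using gs by (simp add: ground_state_def ground_state_axioms_def)
  show "(let Y = started x X; \<tau> = hitting_time Y B \<omega> in
       exp (time_integral (\<lambda>y. lam - V y) Y \<tau> \<omega>) * f (Y (real_of_ereal \<tau>) \<omega>) * of_bool (\<tau> < exit_time Y D \<omega>)) =
     (if \<exists>r>0. x + X' r \<omega> \<in> B then
       (let h = hit_time B x (\<lambda>r. X' r \<omega>) in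
         exp (lam * h - pot x h (\<lambda>r. X' r \<omega>)) * f (x + X' h \<omega>) * of_bool (\<forall>r'\<in>{0..h}. x + X' r' \<omega> \<in> D)) else 0)"
  proof (cases "\<exists>r>0. x + X' r \<omega> \<in> B")
    case True
    define h where "h = hit_time B x (\<lambda>r. X' r \<omega>)"
    have h: "0 \<le> h" unfolding h_def by (rule hit_time_closure(1)[OF X_rcont True])
    have "hitting_time (started x X) B \<omega> = ereal h"
      unfolding h_def by (rule hitting_time_eq[where Y="started x X", OF good_path[OF g] True])
    then show ?thesis
      using True good_time_integral(2)[OF g h, of lam] good_exit[OF g D x h] good_path[OF g h]
      by (simp add: h_def[symmetric] Let_def)
  next
    case False
    then have "hitting_time (started x X) B \<omega> = \<infinity>"
      by (intro hitting_time_infinite[where Y="started x X", OF good_path[OF g]]) auto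
    then show ?thesis unfolding if_not_P[OF False] by (simp add: Let_def)
  qed
qed

end

theorem theorem4p1:
  fixes M :: "'w measure"
    and B X :: "real \<Rightarrow> 'w \<Rightarrow> 'v::euclidean_space"
    and S :: "real \<Rightarrow> 'w \<Rightarrow> real"
    and \<Psi> :: "real \<Rightarrow> real"
    and V \<phi> :: "'v \<Rightarrow> real"
    and lam :: real
    and D :: "'v set"
    and xhat :: 'v
  assumes "bernstein0 \<Psi>"
    and "hartman_wintner \<Psi>"
    and "subordinate_brownian_motion M B S \<Psi> X"
    and "essentially_bounded V"
    and "bounded_domain D"
    and "regular_boundary M X D"
    and "\<exists>Dn :: nat \<Rightarrow> 'v set.
           (\<forall>n\<ge>1. bounded_domain (Dn n) \<and> regular_boundary M X (Dn n) \<and>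
                   Dn (Suc n) \<subseteq> Dn n \<and> closure (Dn (Suc n)) \<subseteq> Dn n) \<and>
           (\<Inter>n\<in>{1..}. Dn n) = closure D"
    and "principal_eigenpair M X D V \<phi> lam"
    and "xhat \<in> D"
  shows
    "(\<forall>r>0. \<forall>x \<in> D - closure (ball xhat r).
        \<phi> x = (LINT \<omega>|completion M.
          (let Y = started x X; \<tau> = hitting_time Y (ball xhat r) \<omega> in
             exp (time_integral (\<lambda>y. lam - V y) Y \<tau> \<omega>) * \<phi> (Y (real_of_ereal \<tau>) \<omega>) *
             of_bool (\<tau> < exit_time Y D \<omega>)))) \<and>
     (\<forall>x\<in>D. \<exists>L.
        ((\<lambda>r. LINT \<omega>|completion M.
          (let Y = started x X; \<tau> = hitting_time Y (ball xhat r) \<omega> in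
             exp (time_integral (\<lambda>y. lam - V y) Y \<tau> \<omega>) *
             of_bool (\<tau> < exit_time Y D \<omega>))) \<longlongrightarrow> L) (at_right 0) \<and>
        \<phi> x = \<phi> xhat * L)"
proof -
  obtain G where "subordination M B S \<Psi> G" using subordination_exists[OF assms(3,2)] by blast
  then interpret SB: subordination M B S \<Psi> G .
  obtain V' C where V': "V' \<in> borel_measurable borel" "\<And>y. \<bar>V' y\<bar> \<le> C" "AE y in lborel. V y = V' y"
    using essentially_bounded_borel[OF assms(4)] by blast
  have X_eq: "X = (\<lambda>t \<omega>. B (S t \<omega>) \<omega>)" using assms(3) by (simp add: subordinate_brownian_motion_def)
  interpret PV: process_version M SB.X' V' C X V
  proof (intro process_version.intro feynman_kac_levy.intro feynman_kac_levy_axioms.intro process_version_axioms.intro)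
    show "sym_levy (completion M) SB.X'" by (rule SB.sym_levy_X')
    have "AE \<omega> in M. \<forall>t\<ge>0. X t \<omega> = SB.X' t \<omega>" using SB.AE_X' by eventually_elim (simp add: X_eq)
    then show "AE \<omega> in completion M. \<forall>t\<ge>0. X t \<omega> = SB.X' t \<omega>" by (rule AE_completion)
  qed (use V' in auto)
  have gs: "ground_state (completion M) SB.X' V' C D \<phi> lam"
    by (rule PV.ground_state_of_principal_eigenpair[OF assms(5,8)])
  then interpret GS: ground_state "completion M" SB.X' V' C D \<phi> lam .
  have target: "ground_state_target (completion M) SB.X' V' C D \<phi> lam (ball xhat r)" if "0 < r" for r
  proof -
    have "xhat \<in> ball xhat r \<inter> D" using assms(9) that by simp
    then have "ball xhat r \<inter> D \<noteq> {}" by blast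
    then show ?thesis using gs by (simp add: ground_state_target_def ground_state_target_axioms_def)
  qed
  define F where "F r x f \<omega> = (let Y = started x X; \<tau> = hitting_time Y (ball xhat r) \<omega> in
     exp (time_integral (\<lambda>y. lam - V y) Y \<tau> \<omega>) * f (Y (real_of_ereal \<tau>) \<omega>) * of_bool (\<tau> < exit_time Y D \<omega>))"
    for r x and f :: "'v \<Rightarrow> real" and \<omega>
  define E where "E r x = (LINT \<omega>|completion M.
          (let Y = started x X; \<tau> = hitting_time Y (ball xhat r) \<omega> in
             exp (time_integral (\<lambda>y. lam - V y) Y \<tau> \<omega>) * of_bool (\<tau> < exit_time Y D \<omega>)))" for r x
  have E_F: "E r x = (LINT \<omega>|completion M. F r x (\<lambda>_. 1) \<omega>)" for r x by (simp add: E_def F_def Let_def)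
  have first: "(LINT \<omega>|completion M. F r x \<phi> \<omega>) = \<phi> x" if r: "0 < r" and x: "x \<in> D" "x \<notin> ball xhat r" for r x
  proof -
    interpret T: ground_state_target "completion M" SB.X' V' C D \<phi> lam "ball xhat r" by (rule target[OF r])
    show ?thesis
    proof (rule T.hitting_integral[OF x])
      show "AE \<omega> in completion M. F r x \<phi> \<omega> = (if \<exists>ra>0. x + SB.X' ra \<omega> \<in> ball xhat r then
          GS.mart x (hit_time (ball xhat r) x (\<lambda>r. SB.X' r \<omega>)) (\<lambda>r. SB.X' r \<omega>) else 0)"
        using PV.hitting_functional_AE[OF gs x(1), of "ball xhat r" \<phi>] unfolding F_def
        by eventually_elim (auto simp: GS.mart_def Let_def)
    qed
  qed
  \<comment> \<open>The closed ball appears because at the hitting time the process is only known to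
    be in the closure of the open one.\<close>
  have bounds: "m * E r x \<le> \<phi> x \<and> \<phi> x \<le> m' * E r x"
    if r: "0 < r" and x: "x \<in> D" "x \<notin> ball xhat r" and m: "0 < m" "\<And>y. y \<in> cball xhat r \<Longrightarrow> m \<le> \<phi> y \<and> \<phi> y \<le> m'"
    for r x m m'
  proof -
    interpret T: ground_state_target "completion M" SB.X' V' C D \<phi> lam "ball xhat r" by (rule target[OF r])
    have "AE \<omega> in completion M. F r x (\<lambda>_. 1) \<omega> = (if \<exists>ra>0. x + SB.X' ra \<omega> \<in> ball xhat r then
          GS.mart x (hit_time (ball xhat r) x (\<lambda>r. SB.X' r \<omega>)) (\<lambda>r. SB.X' r \<omega>) /
          \<phi> (x + SB.X' (hit_time (ball xhat r) x (\<lambda>r. SB.X' r \<omega>)) \<omega>) else 0)"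
      using PV.hitting_functional_AE[OF gs x(1), of "ball xhat r" "\<lambda>_. 1"] unfolding F_def
    proof eventually_elim
      case (elim \<omega>)
      show ?case
      proof (cases "\<exists>ra>0. x + SB.X' ra \<omega> \<in> ball xhat r")
        case True
        have "x + SB.X' (hit_time (ball xhat r) x (\<lambda>r. SB.X' r \<omega>)) \<omega> \<in> cball xhat r"
          using hit_time_closure(2)[OF SB.X'_rcont True] r by simp
        then have "\<phi> (x + SB.X' (hit_time (ball xhat r) x (\<lambda>r. SB.X' r \<omega>)) \<omega>) \<noteq> 0" using m by force
        then show ?thesis using elim True by (auto simp: GS.mart_def Let_def)
      next
        case False
        show ?thesis using elim unfolding if_not_P[OF False] .
      qed
    qed
    note T.hitting_bounds[OF x m(1) _ _ this, of m']
    then show ?thesis using m(2) r by (simp add: E_F)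
  qed
  have \<phi>pos: "0 < \<phi> y" if "y \<in> D" for y using GS.\<phi>_pos[OF that] .
  \<comment> \<open>Started at the centre, the process remains in the ball for a short time by
    right-continuity; the infimum of the positive hitting times is 0 and the integrand is 1.\<close>
  have start: "E r xhat = 1" if r: "0 < r" for r
  proof -
    have ae: "AE \<omega> in completion M. F r xhat (\<lambda>_. 1) \<omega> = 1"
      using PV.hitting_functional_AE[OF gs assms(9), of "ball xhat r" "\<lambda>_. 1"] unfolding F_def
    proof eventually_elim
      case (elim \<omega>)
      have "xhat + SB.X' 0 \<omega> \<in> ball xhat r" using r by (simp add: SB.X'_nonpos)
      then obtain b where b: "b > 0" "\<And>r'. 0 \<le> r' \<Longrightarrow> r' < b \<Longrightarrow> xhat + SB.X' r' \<omega> \<in> ball xhat r"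
        using rcont_open[OF SB.X'_rcont[of \<omega>] open_ball] by blast
      have ex: "\<exists>r'>0. xhat + SB.X' r' \<omega> \<in> ball xhat r" using b by (intro exI[of _ "b / 2"]) auto
      define h where "h = hit_time (ball xhat r) xhat (\<lambda>r. SB.X' r \<omega>)"
      have "0 \<le> h" unfolding h_def by (rule hit_time_closure(1)[OF SB.X'_rcont ex])
      moreover have "h \<le> e" if "0 < e" for e
      proof -
        have e: "0 < min e (b / 2)" "min e (b / 2) < b" using that b(1) by auto
        have "h \<le> min e (b / 2)"
          unfolding h_def hit_time_def
        proof (rule cInf_lower)
          show "min e (b / 2) \<in> {ra. 0 < ra \<and> xhat + SB.X' ra \<omega> \<in> ball xhat r}" using e b(2) by simp
        qed (rule bdd_belowI[of _ 0], auto)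
        then show ?thesis by simp
      qed
      ultimately have h0: "h = 0" by (meson dense_ge order.antisym)
      have "\<bar>PV.pot xhat 0 (\<lambda>r. SB.X' r \<omega>)\<bar> \<le> C * 0"
        by (rule PV.pot_bound[OF rcont_measurable[OF SB.X'_rcont]]) simp
      then show ?case using elim ex assms(9) by (simp add: h_def[symmetric] h0 Let_def SB.X'_nonpos)
    qed
    have "F r xhat (\<lambda>_. 1) \<in> borel_measurable (completion M)"
      by (rule complete_measurable_AE_eq[OF PV.complete _ ae]) simp_all
    then have "(LINT \<omega>|completion M. F r xhat (\<lambda>_. 1) \<omega>) = (LINT \<omega>|completion M. 1)"
      using ae by (intro integral_cong_AE) simp_all
    then show ?thesis unfolding E_F using PV.prob_space by simp
  qed
  have limit: "((\<lambda>r. E r x) \<longlongrightarrow> \<phi> x / \<phi> xhat) (at_right 0)" if x: "x \<in> D" for x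
  proof (cases "x = xhat")
    case True
    have "eventually (\<lambda>r. E r x = \<phi> x / \<phi> xhat) (at_right 0)"
      using eventually_at_right_less[of 0]
      by eventually_elim (use start True \<phi>pos[OF assms(9)] in auto)
    then show ?thesis by (rule tendsto_eventually)
  next
    case False
    define a where "a = \<phi> xhat"
    have a: "0 < a" using \<phi>pos[OF assms(9)] by (simp add: a_def)
    \<comment> \<open>Take \<open>r\<close> so small that \<open>\<phi>\<close> differs from
      \<open>a\<close> by at most \<open>e\<close> on the closed ball and that \<open>x\<close> lies
      outside the open one.\<close>
    have near: "eventually (\<lambda>r. (a - e) * E r x \<le> \<phi> x \<and> \<phi> x \<le> (a + e) * E r x) (at_right 0)" if e: "0 < e" "e < a" for e
    proof -
      have "isCont \<phi> xhat" using GS.\<phi>_cont by (simp add: continuous_on_eq_continuous_at)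
      then obtain d where d: "d > 0" "\<And>y. dist y xhat < d \<Longrightarrow> dist (\<phi> y) (\<phi> xhat) < e"
        using e(1) unfolding continuous_at_eps_delta by blast
      have "0 < min d (dist x xhat)" using d(1) False by simp
      then have "eventually (\<lambda>r. r < min d (dist x xhat)) (at_right 0)"
        unfolding eventually_at_right_field by blast
      with eventually_at_right_less[of 0] show ?thesis
      proof eventually_elim
        fix r :: real assume r: "0 < r" "r < min d (dist x xhat)"
        have "a - e \<le> \<phi> y \<and> \<phi> y \<le> a + e" if "y \<in> cball xhat r" for y
        proof -
          have "dist y xhat < d" using that r by (simp add: dist_commute)
          then show ?thesis using d(2)[of y] by (simp add: a_def dist_real_def abs_less_iff)
        qed
        moreover have "x \<notin> ball xhat r" using r by (simp add: dist_commute)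
        ultimately show "(a - e) * E r x \<le> \<phi> x \<and> \<phi> x \<le> (a + e) * E r x"
          using r e x by (intro bounds) auto
      qed
    qed
    \<comment> \<open>For fixed \<open>e\<close> the expectation is, for small \<open>r\<close>,
      between these two quotients; \<open>e\<close> tends to 0 only after \<open>r\<close>.\<close>
    have up: "((\<lambda>e. \<phi> x / (a - e)) \<longlongrightarrow> \<phi> x / (a - 0)) (at_right 0)"
      and lo: "((\<lambda>e. \<phi> x / (a + e)) \<longlongrightarrow> \<phi> x / (a + 0)) (at_right 0)"
      using a by (intro tendsto_intros; simp)+
    have small: "eventually (\<lambda>e. 0 < e \<and> e < a) (at_right 0)"
      unfolding eventually_at_right_field using a by blast
    have "((\<lambda>r. E r x) \<longlongrightarrow> \<phi> x / a) (at_right 0)"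
    proof (rule order_tendstoI)
      fix c assume "c < \<phi> x / a"
      then have "eventually (\<lambda>e. c < \<phi> x / (a + e)) (at_right 0)" using order_tendstoD(1)[OF lo, of c] by simp
      from eventually_happens'[OF _ eventually_conj[OF this small]]
      obtain e where e: "c < \<phi> x / (a + e)" "0 < e" "e < a" by auto
      show "eventually (\<lambda>r. c < E r x) (at_right 0)"
        using near[OF e(2,3)]
      proof eventually_elim
        case (elim r)
        then have "\<phi> x / (a + e) \<le> E r x" using e a by (simp add: pos_divide_le_eq mult.commute)
        then show ?case using e(1) by simp
      qed
    next
      fix c assume "\<phi> x / a < c"
      then have "eventually (\<lambda>e. \<phi> x / (a - e) < c) (at_right 0)" using order_tendstoD(2)[OF up, of c] by simp
      from eventually_happens'[OF _ eventually_conj[OF this small]]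
      obtain e where e: "\<phi> x / (a - e) < c" "0 < e" "e < a" by auto
      show "eventually (\<lambda>r. E r x < c) (at_right 0)"
        using near[OF e(2,3)]
      proof eventually_elim
        case (elim r)
        then have "E r x \<le> \<phi> x / (a - e)" using e a by (simp add: pos_le_divide_eq mult.commute)
        then show ?case using e(1) by simp
      qed
    qed
    then show ?thesis by (simp add: a_def)
  qed
  show ?thesis
  proof (intro conjI allI impI ballI)
    fix r x assume r: "0 < r" and x: "x \<in> D - closure (ball xhat r)"
    then have "x \<notin> ball xhat r" using closure_subset[of "ball xhat r"] by blast
    then show "\<phi> x = (LINT \<omega>|completion M.
          (let Y = started x X; \<tau> = hitting_time Y (ball xhat r) \<omega> in
             exp (time_integral (\<lambda>y. lam - V y) Y \<tau> \<omega>) * \<phi> (Y (real_of_ereal \<tau>) \<omega>) *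
             of_bool (\<tau> < exit_time Y D \<omega>)))"
      using first[OF r, of x] x by (simp add: F_def)
  next
    fix x assume x: "x \<in> D"
    show "\<exists>L. ((\<lambda>r. LINT \<omega>|completion M.
          (let Y = started x X; \<tau> = hitting_time Y (ball xhat r) \<omega> in
             exp (time_integral (\<lambda>y. lam - V y) Y \<tau> \<omega>) *
             of_bool (\<tau> < exit_time Y D \<omega>))) \<longlongrightarrow> L) (at_right 0) \<and> \<phi> x = \<phi> xhat * L"
      using limit[OF x] \<phi>pos[OF assms(9)] unfolding E_def by (intro exI[of _ "\<phi> x / \<phi> xhat"]) auto
  qed
qed

end
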